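(* Let $(\mathcal{T},\mathcal{T}')$ be one of the following pairs of Bianchi types of class A: $$(IX,VIII),\quad (VIII,IX),\quad (VII_0,VI_0),\quad (VI_0,VII_0),\quad (II,II).$$ Let $G$ and $G'$ be three-dimensional Lie groups of type $\mathcal{T}$ and $\mathcal{T}'$ respectively, each equipped with a basis of left-invariant 1-forms $e^1,e^2,e^3$ satisfying the structure equations listed in the context for its type. Then the system of ordinary differential equations describing the diagonal hyper-Kähler structures of type $\mathcal{T}$ coincides with the system describing the diagonal hyper-symplectic structures of type $\mathcal{T}'$. Precisely, let $I\subset\mathbb{R}$ be an open interval and let $f_1,f_2,f_3,f$ be smooth nowhere vanishing functions on $I$. Then the following three conditions are equivalent: (1) the diagonal almost hyper-Hermitian structure $(F_1,F_2,F_3)$ on $G\times I$ determined by $(f_1,f_2,f_3,f)$ is hyper-Kähler; (2) the diagonal almost hyper-parahermitian structure $(\Omega_1,\Omega_2,\Omega_3)$ on $G'\times I$ determined by $(f_1,f_2,f_3,f)$ (in the case $(II,II)$: determined by $(f_1,f_2,-f_3,f)$) is hyper-symplectic; (3) $(f_1,f_2,f_3,f)$ satisfies the system $$\frac{d}{dt}(f_1f_2)=\epsilon_3\, f f_3,\qquad \frac{d}{dt}(f_1f_3)=\epsilon_2\, f f_2,\qquad \frac{d}{dt}(f_2f_3)=\epsilon_1\, f f_1,$$ where $(\epsilon_1,\epsilon_2,\epsilon_3)$ equals $(1,1,1)$ for $(IX,VIII)$, $(1,1,-1)$ for $(VIII,IX)$, $(0,1,1)$ for $(VII_0,VI_0)$,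 $(0,1,-1)$ for $(VI_0,VII_0)$, and $(0,0,1)$ for $(II,II)$.
   Context: Write $e^{ij}=e^i\wedge e^j$. Structure equations used for each type: - Type $IX$ ($SU(2)$): $de^1=-e^{23}$, $de^2=-e^{31}$, $de^3=-e^{12}$. - Type $VIII$ ($SU(1,1)$): $de^1=-e^{23}$, $de^2=-e^{31}$, $de^3=e^{12}$. - Type $VII_0$ (rigid motions of the Euclidean 2-plane): $de^1=0$, $de^2=e^{13}$, $de^3=-e^{12}$. - Type $VI_0$ (rigid motions of the Lorentzian 2-plane): $de^1=0$, $de^2=e^{13}$, $de^3=e^{12}$. - Type $II$ (Heisenberg group): $de^1=de^2=0$, $de^3=-e^{12}$. Given $f_1,f_2,f_3,f$ on $I$, put $e^i(t)=f_i(t)e^i$ for $i=1,2,3$ (diagonal evolution). The diagonal almost hyper-Hermitian structure on $G\times I$ determined by $(f_1,f_2,f_3,f)$ is the one with metric $g=(e^1(t))^2+(e^2(t))^2+(e^3(t))^2+f(t)^2dt^2$ and fundamental 2-forms $F_s(\cdot,\cdot)=g(J_s\cdot,\cdot)$ given by $F_1=e^1(t)\wedge e^2(t)+e^3(t)\wedge f(t)dt$, $F_2=e^1(t)\wedge e^3(t)-e^2(t)\wedge f(t)dt$, $F_3=e^2(t)\wedge e^3(t)+e^1(t)\wedge f(t)dt$; here $J_1,J_2,J_3$ are almost complex structures, isometric for $g$, with $J_1J_2=-J_2J_1=J_3$. It is hyper-Kähler if $J_1,J_2,J_3$ are parallel with respect to the Levi-Civita connection of $g$. The diagonal almost hyper-parahermitian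 structure on $G'\times I$ determined by $(f_1,f_2,f_3,f)$ is the one with neutral metric $g=(e^1(t))^2+(e^2(t))^2-(e^3(t))^2-f(t)^2dt^2$ and fundamental 2-forms $\Omega_1=g(\cdot,J\cdot)$, $\Omega_2=g(\cdot,P_1\cdot)$, $\Omega_3=g(\cdot,P_2\cdot)$ given by $\Omega_1=-e^1(t)\wedge e^2(t)+e^3(t)\wedge f(t)dt$, $\Omega_2=e^1(t)\wedge e^3(t)-e^2(t)\wedge f(t)dt$, $\Omega_3=e^2(t)\wedge e^3(t)+e^1(t)\wedge f(t)dt$; here $J^2=-P_1^2=-P_2^2=-\mathrm{Id}$, $JP_1=-P_1J=P_2$, and $g(J\cdot,J\cdot)=-g(P_1\cdot,P_1\cdot)=-g(P_2\cdot,P_2\cdot)=g(\cdot,\cdot)$. It is hyper-symplectic if $d\Omega_1=d\Omega_2=d\Omega_3=0$. *)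

theory Defs
  imports "HOL-Analysis.Analysis" "HOL-Algebra.Group"
begin

section \<open>Smooth functions on Euclidean spaces\<close>

text \<open>The next two notions are used for open sets \<open>S\<close> only.\<close>

fun Ck_on :: "nat \<Rightarrow> ('a::euclidean_space \<Rightarrow> 'b::real_normed_vector) \<Rightarrow> 'a set \<Rightarrow> bool" where
  "Ck_on 0 f S \<longleftrightarrow> continuous_on S f"
| "Ck_on (Suc k) f S \<longleftrightarrow>
     (\<forall>x\<in>S. f differentiable (at x)) \<and> (\<forall>v. Ck_on k (\<lambda>x. frechet_derivative f (at x) v) S)"

definition smooth_eucl :: "('a::euclidean_space \<Rightarrow> 'b::real_normed_vector) \<Rightarrow> 'a set \<Rightarrow> bool" where
  "smooth_eucl f S \<longleftrightarrow> (\<forall>k. Ck_on k f S)"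

section \<open>Smooth manifolds\<close>

text \<open>
  A manifold is given by an atlas, a set of charts \<open>(V, \<phi>)\<close>; its points are the points covered by
  the charts. They form an open subset of the ambient type, whose type class provides
  the (Hausdorff, second countable) topology. Functions, forms and fields are total functions
  whose values outside the manifold are irrelevant.
\<close>

type_synonym ('p, 'e) atlas = "('p set \<times> ('p \<Rightarrow> 'e)) set"

definition points :: "('p, 'e) atlas \<Rightarrow> 'p set" where
  "points M = (\<Union>(V, \<phi>)\<in>M. V)"

definition smooth_manifold ::
  "('p::{t2_space, second_countable_topology}, 'e::euclidean_space) atlas \<Rightarrow> bool" where
  "smooth_manifold M \<longleftrightarrow>
     (\<forall>(V, \<phi>)\<in>M. open V \<and> open (\<phi> ` V) \<and> homeomorphism V (\<phi> ` V) \<phi> (inv_into V \<phi>)) \<and>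
     (\<forall>(V, \<phi>)\<in>M. \<forall>(W, \<psi>)\<in>M. smooth_eucl (\<psi> \<circ> inv_into V \<phi>) (\<phi> ` (V \<inter> W)))"

definition prod_atlas :: "('p, 'e) atlas \<Rightarrow> ('q, 'f) atlas \<Rightarrow> ('p \<times> 'q, 'e \<times> 'f) atlas" where
  "prod_atlas M N = {(V \<times> W, map_prod \<phi> \<psi>) | V \<phi> W \<psi>. (V, \<phi>) \<in> M \<and> (W, \<psi>) \<in> N}"

definition smooth_fun_on ::
  "('p::topological_space, 'e::euclidean_space) atlas \<Rightarrow> 'p set \<Rightarrow> ('p \<Rightarrow> real) \<Rightarrow> bool" where
  "smooth_fun_on M U f \<longleftrightarrow> open U \<and> U \<subseteq> points M \<and>
     (\<forall>(V, \<phi>)\<in>M. smooth_eucl (f \<circ> inv_into V \<phi>) (\<phi> ` (U \<inter> V)))"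

definition smooth_near ::
  "('p::topological_space, 'e::euclidean_space) atlas \<Rightarrow> 'p \<Rightarrow> ('p \<Rightarrow> real) \<Rightarrow> bool" where
  "smooth_near M p f \<longleftrightarrow> (\<exists>U. p \<in> U \<and> smooth_fun_on M U f)"

definition smooth_map ::
  "('p::topological_space, 'e::euclidean_space) atlas \<Rightarrow> ('q::topological_space, 'f::euclidean_space) atlas
     \<Rightarrow> ('p \<Rightarrow> 'q) \<Rightarrow> bool" where
  "smooth_map M N F \<longleftrightarrow> F ` points M \<subseteq> points N \<and> continuous_on (points M) F \<and>
     (\<forall>(V, \<phi>)\<in>M. \<forall>(W, \<psi>)\<in>N. smooth_eucl (\<psi> \<circ> F \<circ> inv_into V \<phi>) (\<phi> ` (V \<inter> F -` W)))"

section \<open>Tangent vectors and vector fields\<close>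

type_synonym 'p tvec = "('p \<Rightarrow> real) \<Rightarrow> real"
type_synonym 'p vfield = "'p \<Rightarrow> 'p tvec"
type_synonym 'p form1 = "'p \<Rightarrow> 'p tvec \<Rightarrow> real"
type_synonym 'p form2 = "'p \<Rightarrow> 'p tvec \<Rightarrow> 'p tvec \<Rightarrow> real"
type_synonym 'p endo = "'p \<Rightarrow> 'p tvec \<Rightarrow> 'p tvec"

text \<open>
  Tangent vectors at \<open>p\<close> are the derivations at \<open>p\<close> of the functions that are smooth near \<open>p\<close>. The
  Leibniz rule forces them to depend on the germ of the function only: apply it to a function
  vanishing near \<open>p\<close> multiplied by the indicator function of its support. The value 0 on all
  other functions is a normalisation making equality of tangent vectors equality of operators.
\<close>

definition tangent ::
  "('p::topological_space, 'e::euclidean_space) atlas \<Rightarrow> 'p \<Rightarrow> 'p tvec set" where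
  "tangent M p = {v.
     (\<forall>f g. smooth_near M p f \<longrightarrow> smooth_near M p g \<longrightarrow> v (\<lambda>x. f x + g x) = v f + v g) \<and>
     (\<forall>c f. smooth_near M p f \<longrightarrow> v (\<lambda>x. c * f x) = c * v f) \<and>
     (\<forall>f g. smooth_near M p f \<longrightarrow> smooth_near M p g \<longrightarrow>
        v (\<lambda>x. f x * g x) = f p * v g + g p * v f) \<and>
     (\<forall>f. \<not> smooth_near M p f \<longrightarrow> v f = 0)}"

definition vadd :: "'p tvec \<Rightarrow> 'p tvec \<Rightarrow> 'p tvec" where
  "vadd v w = (\<lambda>f. v f + w f)"

definition vscale :: "real \<Rightarrow> 'p tvec \<Rightarrow> 'p tvec" where
  "vscale c v = (\<lambda>f. c * v f)"

definition push ::
  "('q::topological_space, 'f::euclidean_space) atlas \<Rightarrow> ('p \<Rightarrow> 'q) \<Rightarrow> 'p \<Rightarrow> 'p tvec \<Rightarrow> 'q tvec" where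
  "push N F p v = (\<lambda>f. if smooth_near N (F p) f then v (f \<circ> F) else 0)"

definition vector_field_on ::
  "('p::topological_space, 'e::euclidean_space) atlas \<Rightarrow> 'p set \<Rightarrow> 'p vfield \<Rightarrow> bool" where
  "vector_field_on M U X \<longleftrightarrow> open U \<and> U \<subseteq> points M \<and> (\<forall>p\<in>U. X p \<in> tangent M p) \<and>
     (\<forall>W f. W \<subseteq> U \<longrightarrow> smooth_fun_on M W f \<longrightarrow> smooth_fun_on M W (\<lambda>p. X p f))"

abbreviation vector_field ::
  "('p::topological_space, 'e::euclidean_space) atlas \<Rightarrow> 'p vfield \<Rightarrow> bool" where
  "vector_field M X \<equiv> vector_field_on M (points M) X"

definition bracket ::
  "('p::topological_space, 'e::euclidean_space) atlas \<Rightarrow> 'p vfield \<Rightarrow> 'p vfield \<Rightarrow> 'p vfield" where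
  "bracket M X Y =
     (\<lambda>p f. if smooth_near M p f then X p (\<lambda>q. Y q f) - Y p (\<lambda>q. X q f) else 0)"

section \<open>Differential forms\<close>

definition one_form ::
  "('p::topological_space, 'e::euclidean_space) atlas \<Rightarrow> 'p form1 \<Rightarrow> bool" where
  "one_form M \<theta> \<longleftrightarrow>
     (\<forall>p\<in>points M. \<forall>v\<in>tangent M p. \<forall>w\<in>tangent M p. \<forall>c.
        \<theta> p (vadd v w) = \<theta> p v + \<theta> p w \<and> \<theta> p (vscale c v) = c * \<theta> p v) \<and>
     (\<forall>U X. vector_field_on M U X \<longrightarrow> smooth_fun_on M U (\<lambda>p. \<theta> p (X p)))"

definition wedge :: "'p form1 \<Rightarrow> 'p form1 \<Rightarrow> 'p form2" where
  "wedge \<alpha> \<beta> = (\<lambda>p u v. \<alpha> p u * \<beta> p v - \<alpha> p v * \<beta> p u)"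

definition pullback ::
  "('q::topological_space, 'f::euclidean_space) atlas \<Rightarrow> ('p \<Rightarrow> 'q) \<Rightarrow> 'q form1 \<Rightarrow> 'p form1" where
  "pullback N F \<theta> = (\<lambda>p v. \<theta> (F p) (push N F p v))"

text \<open>Exterior derivatives evaluated on vector fields, normalised so that
  \<open>d(\<phi> \<theta>) = d\<phi> \<and> \<theta> + \<phi> d\<theta>\<close> for the wedge product above.\<close>

definition ext_d1 ::
  "('p::topological_space, 'e::euclidean_space) atlas \<Rightarrow> 'p form1 \<Rightarrow> 'p vfield \<Rightarrow> 'p vfield \<Rightarrow> 'p \<Rightarrow> real" where
  "ext_d1 M \<theta> X Y p = X p (\<lambda>q. \<theta> q (Y q)) - Y p (\<lambda>q. \<theta> q (X q)) - \<theta> p (bracket M X Y p)"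

definition ext_d2 ::
  "('p::topological_space, 'e::euclidean_space) atlas \<Rightarrow> 'p form2
     \<Rightarrow> 'p vfield \<Rightarrow> 'p vfield \<Rightarrow> 'p vfield \<Rightarrow> 'p \<Rightarrow> real" where
  "ext_d2 M F X Y Z p =
     X p (\<lambda>q. F q (Y q) (Z q)) - Y p (\<lambda>q. F q (X q) (Z q)) + Z p (\<lambda>q. F q (X q) (Y q))
     - F p (bracket M X Y p) (Z p) + F p (bracket M X Z p) (Y p) - F p (bracket M Y Z p) (X p)"

definition d1_is ::
  "('p::topological_space, 'e::euclidean_space) atlas \<Rightarrow> 'p form1 \<Rightarrow> 'p form2 \<Rightarrow> bool" where
  "d1_is M \<theta> F \<longleftrightarrow>
     (\<forall>X Y. vector_field M X \<longrightarrow> vector_field M Y \<longrightarrow>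
        (\<forall>p\<in>points M. ext_d1 M \<theta> X Y p = F p (X p) (Y p)))"

definition closed2 ::
  "('p::topological_space, 'e::euclidean_space) atlas \<Rightarrow> 'p form2 \<Rightarrow> bool" where
  "closed2 M F \<longleftrightarrow>
     (\<forall>X Y Z. vector_field M X \<longrightarrow> vector_field M Y \<longrightarrow> vector_field M Z \<longrightarrow>
        (\<forall>p\<in>points M. ext_d2 M F X Y Z p = 0))"

section \<open>Metrics, endomorphism fields and the Levi-Civita connection\<close>

definition smooth_sym_bilinear ::
  "('p::topological_space, 'e::euclidean_space) atlas \<Rightarrow> 'p form2 \<Rightarrow> bool" where
  "smooth_sym_bilinear M g \<longleftrightarrow>
     (\<forall>p\<in>points M. \<forall>u\<in>tangent M p. \<forall>v\<in>tangent M p. \<forall>w\<in>tangent M p. \<forall>c.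
        g p u v = g p v u \<and>
        g p (vadd u v) w = g p u w + g p v w \<and> g p (vscale c u) v = c * g p u v) \<and>
     (\<forall>U X Y. vector_field_on M U X \<longrightarrow> vector_field_on M U Y \<longrightarrow>
        smooth_fun_on M U (\<lambda>p. g p (X p) (Y p)))"

definition riemannian_metric ::
  "('p::topological_space, 'e::euclidean_space) atlas \<Rightarrow> 'p form2 \<Rightarrow> bool" where
  "riemannian_metric M g \<longleftrightarrow> smooth_sym_bilinear M g \<and>
     (\<forall>p\<in>points M. \<forall>v\<in>tangent M p. v \<noteq> (\<lambda>f. 0) \<longrightarrow> g p v v > 0)"

text \<open>Metrics of signature \<open>(2,2)\<close> on 4-manifolds\<close>

definition neutral_metric4 ::
  "('p::topological_space, 'e::euclidean_space) atlas \<Rightarrow> 'p form2 \<Rightarrow> bool" where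
  "neutral_metric4 M g \<longleftrightarrow> smooth_sym_bilinear M g \<and>
     (\<forall>p\<in>points M. \<exists>u1\<in>tangent M p. \<exists>u2\<in>tangent M p. \<exists>u3\<in>tangent M p. \<exists>u4\<in>tangent M p.
        (\<forall>v\<in>tangent M p. \<exists>a b c d.
           v = vadd (vscale a u1) (vadd (vscale b u2) (vadd (vscale c u3) (vscale d u4)))) \<and>
        g p u1 u1 = 1 \<and> g p u2 u2 = 1 \<and> g p u3 u3 = -1 \<and> g p u4 u4 = -1 \<and>
        g p u1 u2 = 0 \<and> g p u1 u3 = 0 \<and> g p u1 u4 = 0 \<and>
        g p u2 u3 = 0 \<and> g p u2 u4 = 0 \<and> g p u3 u4 = 0)"

definition endo_field ::
  "('p::topological_space, 'e::euclidean_space) atlas \<Rightarrow> 'p endo \<Rightarrow> bool" where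
  "endo_field M J \<longleftrightarrow>
     (\<forall>p\<in>points M. \<forall>v\<in>tangent M p. \<forall>w\<in>tangent M p. \<forall>c. J p v \<in> tangent M p \<and>
        J p (vadd v w) = vadd (J p v) (J p w) \<and> J p (vscale c v) = vscale c (J p v)) \<and>
     (\<forall>U X. vector_field_on M U X \<longrightarrow> vector_field_on M U (\<lambda>p. J p (X p)))"

definition affine_connection ::
  "('p::topological_space, 'e::euclidean_space) atlas \<Rightarrow> ('p vfield \<Rightarrow> 'p vfield \<Rightarrow> 'p vfield) \<Rightarrow> bool"
where
  "affine_connection M D \<longleftrightarrow>
     (\<forall>X Y. vector_field M X \<longrightarrow> vector_field M Y \<longrightarrow> vector_field M (D X Y)) \<and>
     (\<forall>X Y Z. vector_field M X \<longrightarrow> vector_field M Y \<longrightarrow> vector_field M Z \<longrightarrow>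
        (\<forall>p\<in>points M.
           D (\<lambda>q. vadd (X q) (Y q)) Z p = vadd (D X Z p) (D Y Z p) \<and>
           D X (\<lambda>q. vadd (Y q) (Z q)) p = vadd (D X Y p) (D X Z p))) \<and>
     (\<forall>X Y h. vector_field M X \<longrightarrow> vector_field M Y \<longrightarrow> smooth_fun_on M (points M) h \<longrightarrow>
        (\<forall>p\<in>points M.
           D (\<lambda>q. vscale (h q) (X q)) Y p = vscale (h p) (D X Y p) \<and>
           D X (\<lambda>q. vscale (h q) (Y q)) p = vadd (vscale (X p h) (Y p)) (vscale (h p) (D X Y p))))"

definition levi_civita_connection ::
  "('p::topological_space, 'e::euclidean_space) atlas \<Rightarrow> 'p form2
     \<Rightarrow> ('p vfield \<Rightarrow> 'p vfield \<Rightarrow> 'p vfield) \<Rightarrow> bool" where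
  "levi_civita_connection M g D \<longleftrightarrow> affine_connection M D \<and>
     (\<forall>X Y. vector_field M X \<longrightarrow> vector_field M Y \<longrightarrow>
        (\<forall>p\<in>points M. D X Y p = vadd (D Y X p) (bracket M X Y p))) \<and>
     (\<forall>X Y Z. vector_field M X \<longrightarrow> vector_field M Y \<longrightarrow> vector_field M Z \<longrightarrow>
        (\<forall>p\<in>points M. X p (\<lambda>q. g q (Y q) (Z q)) = g p (D X Y p) (Z p) + g p (Y p) (D X Z p)))"

definition parallel_endo ::
  "('p::topological_space, 'e::euclidean_space) atlas \<Rightarrow> ('p vfield \<Rightarrow> 'p vfield \<Rightarrow> 'p vfield)
     \<Rightarrow> 'p endo \<Rightarrow> bool" where
  "parallel_endo M D J \<longleftrightarrow>
     (\<forall>X Y. vector_field M X \<longrightarrow> vector_field M Y \<longrightarrow>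
        (\<forall>p\<in>points M. D X (\<lambda>q. J q (Y q)) p = J p (D X Y p)))"

section \<open>Hyper-Kaehler and hyper-symplectic structures\<close>

definition almost_hyper_hermitian ::
  "('p::topological_space, 'e::euclidean_space) atlas \<Rightarrow> 'p form2
     \<Rightarrow> 'p endo \<Rightarrow> 'p endo \<Rightarrow> 'p endo \<Rightarrow> bool" where
  "almost_hyper_hermitian M g J1 J2 J3 \<longleftrightarrow> riemannian_metric M g \<and>
     endo_field M J1 \<and> endo_field M J2 \<and> endo_field M J3 \<and>
     (\<forall>p\<in>points M. \<forall>u\<in>tangent M p. \<forall>v\<in>tangent M p.
        J1 p (J1 p v) = vscale (-1) v \<and> J2 p (J2 p v) = vscale (-1) v \<and>
        J3 p (J3 p v) = vscale (-1) v \<and>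
        J1 p (J2 p v) = J3 p v \<and> J2 p (J1 p v) = vscale (-1) (J3 p v) \<and>
        g p (J1 p u) (J1 p v) = g p u v \<and> g p (J2 p u) (J2 p v) = g p u v \<and>
        g p (J3 p u) (J3 p v) = g p u v)"

text \<open>The tensors \<open>J1\<close>, \<open>J2\<close>, \<open>J3\<close> are determined by \<open>g\<close> and the fundamental forms, and the
  connection \<open>D\<close> is determined by \<open>g\<close>.\<close>

definition hyper_kaehler ::
  "('p::topological_space, 'e::euclidean_space) atlas \<Rightarrow> 'p form2
     \<Rightarrow> 'p form2 \<Rightarrow> 'p form2 \<Rightarrow> 'p form2 \<Rightarrow> bool" where
  "hyper_kaehler M g F1 F2 F3 \<longleftrightarrow> (\<exists>J1 J2 J3. almost_hyper_hermitian M g J1 J2 J3 \<and>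
     (\<forall>p\<in>points M. \<forall>u\<in>tangent M p. \<forall>v\<in>tangent M p.
        F1 p u v = g p (J1 p u) v \<and> F2 p u v = g p (J2 p u) v \<and> F3 p u v = g p (J3 p u) v) \<and>
     (\<exists>D. levi_civita_connection M g D \<and>
        parallel_endo M D J1 \<and> parallel_endo M D J2 \<and> parallel_endo M D J3))"

definition almost_hyper_parahermitian ::
  "('p::topological_space, 'e::euclidean_space) atlas \<Rightarrow> 'p form2
     \<Rightarrow> 'p endo \<Rightarrow> 'p endo \<Rightarrow> 'p endo \<Rightarrow> bool" where
  "almost_hyper_parahermitian M g J P1 P2 \<longleftrightarrow> neutral_metric4 M g \<and>
     endo_field M J \<and> endo_field M P1 \<and> endo_field M P2 \<and>
     (\<forall>p\<in>points M. \<forall>u\<in>tangent M p. \<forall>v\<in>tangent M p.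
        J p (J p v) = vscale (-1) v \<and> P1 p (P1 p v) = v \<and> P2 p (P2 p v) = v \<and>
        J p (P1 p v) = P2 p v \<and> P1 p (J p v) = vscale (-1) (P2 p v) \<and>
        g p (J p u) (J p v) = g p u v \<and> g p (P1 p u) (P1 p v) = - g p u v \<and>
        g p (P2 p u) (P2 p v) = - g p u v)"

definition hyper_symplectic ::
  "('p::topological_space, 'e::euclidean_space) atlas \<Rightarrow> 'p form2
     \<Rightarrow> 'p form2 \<Rightarrow> 'p form2 \<Rightarrow> 'p form2 \<Rightarrow> bool" where
  "hyper_symplectic M g \<Omega>1 \<Omega>2 \<Omega>3 \<longleftrightarrow> (\<exists>J P1 P2. almost_hyper_parahermitian M g J P1 P2 \<and>
     (\<forall>p\<in>points M. \<forall>u\<in>tangent M p. \<forall>v\<in>tangent M p.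
        \<Omega>1 p u v = g p u (J p v) \<and> \<Omega>2 p u v = g p u (P1 p v) \<and> \<Omega>3 p u v = g p u (P2 p v))) \<and>
     closed2 M \<Omega>1 \<and> closed2 M \<Omega>2 \<and> closed2 M \<Omega>3"

section \<open>Lie groups of Bianchi class A\<close>

definition lie_group ::
  "'g::{t2_space, second_countable_topology} monoid \<Rightarrow> ('g, 'e::euclidean_space) atlas \<Rightarrow> bool" where
  "lie_group G A \<longleftrightarrow> group G \<and> smooth_manifold A \<and> points A = carrier G \<and>
     smooth_map (prod_atlas A A) A (\<lambda>(x, y). x \<otimes>\<^bsub>G\<^esub> y) \<and> smooth_map A A (m_inv G)"

definition left_invariant ::
  "'g::{t2_space, second_countable_topology} monoid \<Rightarrow> ('g, 'e::euclidean_space) atlas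
     \<Rightarrow> 'g form1 \<Rightarrow> bool" where
  "left_invariant G A \<theta> \<longleftrightarrow> one_form A \<theta> \<and>
     (\<forall>a\<in>carrier G. \<forall>p\<in>carrier G. \<forall>v\<in>tangent A p.
        pullback A (\<lambda>x. a \<otimes>\<^bsub>G\<^esub> x) \<theta> p v = \<theta> p v)"

definition left_invariant_basis ::
  "'g::{t2_space, second_countable_topology} monoid \<Rightarrow> ('g, 'e::euclidean_space) atlas
     \<Rightarrow> 'g form1 \<Rightarrow> 'g form1 \<Rightarrow> 'g form1 \<Rightarrow> bool" where
  "left_invariant_basis G A e1 e2 e3 \<longleftrightarrow>
     left_invariant G A e1 \<and> left_invariant G A e2 \<and> left_invariant G A e3 \<and>
     (\<forall>a b c. (\<forall>p\<in>carrier G. \<forall>v\<in>tangent A p. a * e1 p v + b * e2 p v + c * e3 p v = 0)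
        \<longrightarrow> a = 0 \<and> b = 0 \<and> c = 0) \<and>
     (\<forall>\<theta>. left_invariant G A \<theta> \<longrightarrow>
        (\<exists>a b c. \<forall>p\<in>carrier G. \<forall>v\<in>tangent A p. \<theta> p v = a * e1 p v + b * e2 p v + c * e3 p v))"

datatype bianchi = IX | VIII | VII0 | VI0 | II

fun structure_equations ::
  "bianchi \<Rightarrow> ('g::topological_space, 'e::euclidean_space) atlas
     \<Rightarrow> 'g form1 \<Rightarrow> 'g form1 \<Rightarrow> 'g form1 \<Rightarrow> bool" where
  "structure_equations IX A e1 e2 e3 \<longleftrightarrow>
     d1_is A e1 (\<lambda>p u v. - wedge e2 e3 p u v) \<and>
     d1_is A e2 (\<lambda>p u v. - wedge e3 e1 p u v) \<and>
     d1_is A e3 (\<lambda>p u v. - wedge e1 e2 p u v)"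
| "structure_equations VIII A e1 e2 e3 \<longleftrightarrow>
     d1_is A e1 (\<lambda>p u v. - wedge e2 e3 p u v) \<and>
     d1_is A e2 (\<lambda>p u v. - wedge e3 e1 p u v) \<and>
     d1_is A e3 (wedge e1 e2)"
| "structure_equations VII0 A e1 e2 e3 \<longleftrightarrow>
     d1_is A e1 (\<lambda>p u v. 0) \<and>
     d1_is A e2 (wedge e1 e3) \<and>
     d1_is A e3 (\<lambda>p u v. - wedge e1 e2 p u v)"
| "structure_equations VI0 A e1 e2 e3 \<longleftrightarrow>
     d1_is A e1 (\<lambda>p u v. 0) \<and>
     d1_is A e2 (wedge e1 e3) \<and>
     d1_is A e3 (wedge e1 e2)"
| "structure_equations II A e1 e2 e3 \<longleftrightarrow>
     d1_is A e1 (\<lambda>p u v. 0) \<and>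
     d1_is A e2 (\<lambda>p u v. 0) \<and>
     d1_is A e3 (\<lambda>p u v. - wedge e1 e2 p u v)"

definition bianchi_group ::
  "bianchi \<Rightarrow> 'g::{t2_space, second_countable_topology} monoid \<Rightarrow> ('g, real ^ 3) atlas
     \<Rightarrow> 'g form1 \<Rightarrow> 'g form1 \<Rightarrow> 'g form1 \<Rightarrow> bool" where
  "bianchi_group T G A e1 e2 e3 \<longleftrightarrow>
     lie_group G A \<and> left_invariant_basis G A e1 e2 e3 \<and> structure_equations T A e1 e2 e3"

section \<open>Diagonal structures on the product with an interval\<close>

definition cylinder :: "('g, 'e) atlas \<Rightarrow> real set \<Rightarrow> ('g \<times> real, 'e \<times> real) atlas" where
  "cylinder A I = prod_atlas A {(I, \<lambda>t. t)}"

text \<open>The 1-forms \<open>h(t) \<theta>\<close>, with \<open>\<theta>\<close> a form on \<open>G\<close>, and \<open>h(t) dt\<close> on \<open>G \<times> I\<close>\<close>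

definition evolve ::
  "('g::topological_space, 'e::euclidean_space) atlas \<Rightarrow> (real \<Rightarrow> real) \<Rightarrow> 'g form1
     \<Rightarrow> ('g \<times> real) form1" where
  "evolve A h \<theta> = (\<lambda>p v. h (snd p) * pullback A fst \<theta> p v)"

definition dt_form :: "(real \<Rightarrow> real) \<Rightarrow> ('g \<times> real) form1" where
  "dt_form h = (\<lambda>p v. h (snd p) * v snd)"

definition diagonal_hyper_kaehler ::
  "('g::topological_space, 'e::euclidean_space) atlas \<Rightarrow> real set
     \<Rightarrow> 'g form1 \<Rightarrow> 'g form1 \<Rightarrow> 'g form1
     \<Rightarrow> (real \<Rightarrow> real) \<Rightarrow> (real \<Rightarrow> real) \<Rightarrow> (real \<Rightarrow> real) \<Rightarrow> (real \<Rightarrow> real) \<Rightarrow> bool" where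
  "diagonal_hyper_kaehler A I e1 e2 e3 f1 f2 f3 f \<longleftrightarrow>
     (let a = evolve A f1 e1; b = evolve A f2 e2; c = evolve A f3 e3; d = dt_form f in
      hyper_kaehler (cylinder A I)
        (\<lambda>p u v. a p u * a p v + b p u * b p v + c p u * c p v + d p u * d p v)
        (\<lambda>p u v. wedge a b p u v + wedge c d p u v)
        (\<lambda>p u v. wedge a c p u v - wedge b d p u v)
        (\<lambda>p u v. wedge b c p u v + wedge a d p u v))"

definition diagonal_hyper_symplectic ::
  "('g::topological_space, 'e::euclidean_space) atlas \<Rightarrow> real set
     \<Rightarrow> 'g form1 \<Rightarrow> 'g form1 \<Rightarrow> 'g form1
     \<Rightarrow> (real \<Rightarrow> real) \<Rightarrow> (real \<Rightarrow> real) \<Rightarrow> (real \<Rightarrow> real) \<Rightarrow> (real \<Rightarrow> real) \<Rightarrow> bool" where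
  "diagonal_hyper_symplectic A I e1 e2 e3 f1 f2 f3 f \<longleftrightarrow>
     (let a = evolve A f1 e1; b = evolve A f2 e2; c = evolve A f3 e3; d = dt_form f in
      hyper_symplectic (cylinder A I)
        (\<lambda>p u v. a p u * a p v + b p u * b p v - c p u * c p v - d p u * d p v)
        (\<lambda>p u v. - wedge a b p u v + wedge c d p u v)
        (\<lambda>p u v. wedge a c p u v - wedge b d p u v)
        (\<lambda>p u v. wedge b c p u v + wedge a d p u v))"

end

theory Submission
  imports Defs
begin

text \<open>
  Everything reduces to exterior derivatives. Put \<open>a = f\<^sub>1 e\<^sup>1\<close>, \<open>b = f\<^sub>2 e\<^sup>2\<close>, \<open>c = f\<^sub>3 e\<^sup>3\<close>, \<open>d = f dt\<close> on
  the cylinder. All the Bianchi types in question have structure equations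
  \<open>de\<^sup>1 = - \<lambda>\<^sub>1 e\<^sup>2\<^sup>3\<close>, \<open>de\<^sup>2 = - \<lambda>\<^sub>2 e\<^sup>3\<^sup>1\<close>, \<open>de\<^sup>3 = - \<lambda>\<^sub>3 e\<^sup>1\<^sup>2\<close>, and therefore, with
  \<open>h\<^sub>i = f\<^sub>i' / (f f\<^sub>i)\<close>, \<open>A\<^sub>1 = \<lambda>\<^sub>1 f\<^sub>1 / (f\<^sub>2 f\<^sub>3)\<close> and its cyclic analogues \<open>A\<^sub>2\<close>, \<open>A\<^sub>3\<close>,
  \<open>da = - h\<^sub>1 a \<and> d - A\<^sub>1 b \<and> c\<close>, cyclically for \<open>b\<close> and \<open>c\<close>, and \<open>dd = 0\<close>. It follows that
  \<open>d(s a \<and> b + c \<and> d) = (s (h\<^sub>1 + h\<^sub>2) - A\<^sub>3) a \<and> b \<and> d\<close> and similarly for the other two forms, so the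
  three forms are closed iff \<open>h\<^sub>1 + h\<^sub>2 = s A\<^sub>3\<close>, \<open>h\<^sub>1 + h\<^sub>3 = A\<^sub>2\<close>, \<open>h\<^sub>2 + h\<^sub>3 = A\<^sub>1\<close>, where \<open>s = 1\<close> in
  the Hermitian and \<open>s = -1\<close> in the parahermitian case. Multiplying by \<open>f f\<^sub>1 f\<^sub>2\<close> etc. gives
  \<open>(f\<^sub>1 f\<^sub>2)' = s \<lambda>\<^sub>3 f f\<^sub>3\<close>, \<open>(f\<^sub>1 f\<^sub>3)' = \<lambda>\<^sub>2 f f\<^sub>2\<close>, \<open>(f\<^sub>2 f\<^sub>3)' = \<lambda>\<^sub>1 f f\<^sub>1\<close>. In the first four pairs
  the two types differ exactly in the sign of \<open>\<lambda>\<^sub>3\<close>, which compensates \<open>s\<close>; for the Heisenberg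
  group the change of sign of \<open>f\<^sub>3\<close> does.

  For the hyper-symplectic structure closedness is the definition. For the hyper-Kaehler one,
  parallel \<open>J\<^sub>i\<close> make the \<open>F\<^sub>i\<close> closed (\<open>parallel_imp_closed2\<close>). Conversely, in the dual orthonormal frame
  \<open>D\<^sub>X = X + h\<^sub>1 a(X) K\<^sub>1 + h\<^sub>2 b(X) K\<^sub>2 + h\<^sub>3 c(X) K\<^sub>3\<close>, with \<open>K\<^sub>1, K\<^sub>2, K\<^sub>3\<close> the skew quaternionic units that
  commute with all \<open>J\<^sub>i\<close>, is always metric with \<open>DJ\<^sub>i = 0\<close>, and the three equations say that its
  torsion vanishes, so that it is the Levi-Civita connection (\<open>conn_torsion_free\<close>).

  The rest makes frames and \<open>d\<close> available for tangent vectors that are derivations. Hadamard's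
  lemma shows that derivations are combinations of coordinate derivatives (\<open>tangent_eq_coord\<close>), so one-forms
  separating the tangent vectors have a smooth dual frame if their number is the dimension
  (\<open>dual_frame\<close>). Left translations show that a left-invariant basis separates the tangent vectors
  (\<open>left_invariant_basis_separating\<close>), and naturality of \<open>d\<close> (\<open>ext_d1_pullback\<close>) carries the structure equations
  to the cylinder.
\<close>

section \<open>Calculus of smooth functions on Euclidean spaces\<close>

lemma Ck_on_subset: "Ck_on k f S \<Longrightarrow> T \<subseteq> S \<Longrightarrow> Ck_on k f T"
  by (induction k arbitrary: f) (auto intro: continuous_on_subset)

lemma Ck_on_cong:
  assumes "open S" "\<And>x. x \<in> S \<Longrightarrow> f x = g x" "Ck_on k f S"
  shows "Ck_on k g S"
  using assms(2,3)
proof (induction k arbitrary: f g)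
  case 0
  then show ?case by (metis Ck_on.simps(1) continuous_on_cong)
next
  case (Suc k)
  have d: "f differentiable (at x)" if "x \<in> S" for x
    using Suc.prems that by auto
  have "g differentiable (at x)" if "x \<in> S" for x
    using d[OF that] Suc.prems(1)
    by (metis assms(1) differentiable_def has_derivative_transform_within_open that)
  moreover have "Ck_on k (\<lambda>x. frechet_derivative g (at x) v) S" for v
  proof (rule Suc.IH)
    show "Ck_on k (\<lambda>x. frechet_derivative f (at x) v) S" using Suc.prems by simp
    show "frechet_derivative f (at x) v = frechet_derivative g (at x) v" if "x \<in> S" for x
      using frechet_derivative_transform_within_open[OF d[OF that] assms(1) that] Suc.prems(1)
      by simp
  qed
  ultimately show ?case by simp
qed

lemma Ck_on_SucI:
  assumes "open S" "\<And>x. x \<in> S \<Longrightarrow> (f has_derivative f' x) (at x)"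
    and "\<And>v. Ck_on k (\<lambda>x. f' x v) S"
  shows "Ck_on (Suc k) f S"
proof -
  have "Ck_on k (\<lambda>x. frechet_derivative f (at x) v) S" for v
    by (rule Ck_on_cong[OF assms(1) _ assms(3)[of v]])
       (metis assms(2) frechet_derivative_at)
  then show ?thesis using assms(2) by (auto simp: differentiable_def)
qed

lemma Ck_on_SucD: "Ck_on (Suc k) f S \<Longrightarrow> Ck_on k f S"
proof (induction k arbitrary: f)
  case 0
  then show ?case
    by (auto intro!: continuous_at_imp_continuous_on differentiable_imp_continuous_within)
next
  case (Suc k)
  then show ?case by (metis Ck_on.simps(2))
qed

lemma Ck_on_Suc_derivative:
  assumes "Ck_on (Suc k) f S" "x \<in> S"
  shows "(f has_derivative frechet_derivative f (at x)) (at x)"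
  using assms frechet_derivative_works by auto

lemma Ck_on_local:
  assumes "\<And>x. x \<in> S \<Longrightarrow> \<exists>T. open T \<and> x \<in> T \<and> Ck_on k f T"
  shows "Ck_on k f S"
  using assms
proof (induction k arbitrary: f)
  case 0
  have "continuous (at x) f" if "x \<in> S" for x
    using 0[OF that] by (auto simp: continuous_on_eq_continuous_at)
  then show ?case by (simp add: continuous_at_imp_continuous_on)
next
  case (Suc k)
  then show ?case by (metis Ck_on.simps(2))
qed

lemma Ck_on_const: "Ck_on k (\<lambda>x. c) S"
  by (induction k arbitrary: c) auto

lemma Ck_on_bounded_linear:
  assumes "bounded_linear L" "open S" "Ck_on k f S"
  shows "Ck_on k (\<lambda>x. L (f x)) S"
  using assms(3)
proof (induction k arbitrary: f)
  case 0
  then show ?case using assms(1) linear_continuous_on_compose bounded_linear.continuous_on by auto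
next
  case (Suc k)
  show ?case
    using Suc.prems Suc.IH
    by (intro Ck_on_SucI[OF assms(2)
        bounded_linear.has_derivative[OF assms(1) Ck_on_Suc_derivative[OF Suc.prems]]]) auto
qed

lemma Ck_on_add:
  assumes "open S" "Ck_on k f S" "Ck_on k g S"
  shows "Ck_on k (\<lambda>x. f x + g x) S"
  using assms(2,3)
proof (induction k arbitrary: f g)
  case 0
  then show ?case by (auto intro: continuous_on_add)
next
  case (Suc k)
  show ?case
    using Suc.prems Suc.IH
    by (intro Ck_on_SucI[OF assms(1) has_derivative_add[OF
        Ck_on_Suc_derivative[OF Suc.prems(1)] Ck_on_Suc_derivative[OF Suc.prems(2)]]]) auto
qed

lemma Ck_on_sum:
  assumes "open S" "\<And>i. i \<in> A \<Longrightarrow> Ck_on k (f i) S"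
  shows "Ck_on k (\<lambda>x. \<Sum>i\<in>A. f i x) S"
  using assms(2)
  by (induction A rule: infinite_finite_induct) (auto intro: Ck_on_const Ck_on_add[OF assms(1)])

lemma Ck_on_bilinear:
  assumes "bounded_bilinear pr" "open S" "Ck_on k f S" "Ck_on k g S"
  shows "Ck_on k (\<lambda>x. pr (f x) (g x)) S"
  using assms(3,4)
proof (induction k arbitrary: f g)
  case 0
  then show ?case using bounded_bilinear.continuous_on[OF assms(1)] by auto
next
  case (Suc k)
  show ?case
  proof (intro Ck_on_SucI[OF assms(2) bounded_bilinear.FDERIV[OF assms(1)
        Ck_on_Suc_derivative[OF Suc.prems(1)] Ck_on_Suc_derivative[OF Suc.prems(2)]]]; assumption?)
    fix v
    show "Ck_on k (\<lambda>x. pr (f x) (frechet_derivative g (at x) v) +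
        pr (frechet_derivative f (at x) v) (g x)) S"
      using Suc.prems
      by (intro Ck_on_add[OF assms(2)] Suc.IH) (auto intro: Ck_on_SucD)
  qed
qed

lemmas Ck_on_mult = Ck_on_bilinear[OF bounded_bilinear_mult]

lemma Ck_on_inverse:
  fixes f :: "'a::euclidean_space \<Rightarrow> real"
  assumes "open S" "\<And>x. x \<in> S \<Longrightarrow> f x \<noteq> 0" "Ck_on k f S"
  shows "Ck_on k (\<lambda>x. inverse (f x)) S"
  using assms(3)
proof (induction k)
  case 0
  then show ?case using assms(2) by (auto intro: continuous_on_inverse)
next
  case (Suc k)
  have "((\<lambda>x. inverse (f x)) has_derivative
      (\<lambda>v. - (inverse (f x) * frechet_derivative f (at x) v * inverse (f x)))) (at x)"
    if "x \<in> S" for x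
    by (rule Deriv.has_derivative_inverse[OF assms(2)[OF that] Ck_on_Suc_derivative[OF Suc.prems that]])
  then show ?case
  proof (rule Ck_on_SucI[OF assms(1)])
    fix v
    have "Ck_on k (\<lambda>x. inverse (f x)) S" using Suc.IH Ck_on_SucD[OF Suc.prems] by simp
    then show "Ck_on k (\<lambda>x. - (inverse (f x) * frechet_derivative f (at x) v * inverse (f x))) S"
      using Suc.prems
      by (intro Ck_on_bounded_linear[OF bounded_linear_minus[OF bounded_linear_ident] assms(1)]
          Ck_on_mult[OF assms(1)]) auto
  qed
qed

lemma Ck_on_compose:
  fixes f :: "'a::euclidean_space \<Rightarrow> 'b::euclidean_space"
  assumes "open S" "open T" "f ` S \<subseteq> T" "Ck_on k f S" "Ck_on k g T"
  shows "Ck_on k (\<lambda>x. g (f x)) S"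
  using assms(4,5)
proof (induction k arbitrary: g)
  case 0
  then show ?case using assms(3) by (auto intro: continuous_on_compose2)
next
  case (Suc k)
  have "((\<lambda>x. g (f x)) has_derivative (\<lambda>v. \<Sum>b\<in>Basis.
      (frechet_derivative f (at x) v \<bullet> b) *\<^sub>R frechet_derivative g (at (f x)) b)) (at x)"
    if x: "x \<in> S" for x
  proof -
    have g: "(g has_derivative frechet_derivative g (at (f x))) (at (f x))"
      using Ck_on_Suc_derivative[OF Suc.prems(2)] x assms(3) by auto
    then have "linear (frechet_derivative g (at (f x)))"
      by (rule has_derivative_linear)
    then have "frechet_derivative g (at (f x)) w =
        (\<Sum>b\<in>Basis. (w \<bullet> b) *\<^sub>R frechet_derivative g (at (f x)) b)" for w
      by (subst euclidean_representation[of w, symmetric])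
         (simp only: linear_sum linear_cmul)
    then have "frechet_derivative g (at (f x)) \<circ> frechet_derivative f (at x) = (\<lambda>v. \<Sum>b\<in>Basis.
        (frechet_derivative f (at x) v \<bullet> b) *\<^sub>R frechet_derivative g (at (f x)) b)"
      unfolding comp_def by (rule ext)
    then show ?thesis
      using diff_chain_at[OF Ck_on_Suc_derivative[OF Suc.prems(1) x] g] unfolding comp_def by simp
  qed
  then show ?case
  proof (rule Ck_on_SucI[OF assms(1)])
    fix v
    show "Ck_on k (\<lambda>x. \<Sum>b\<in>Basis.
        (frechet_derivative f (at x) v \<bullet> b) *\<^sub>R frechet_derivative g (at (f x)) b) S"
      using Suc.prems Ck_on_SucD
      by (intro Ck_on_sum[OF assms(1)] Ck_on_bilinear[OF bounded_bilinear_scaleR assms(1)]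
          Ck_on_bounded_linear[OF bounded_linear_inner_left assms(1)] Suc.IH) auto
  qed
qed

lemma Ck_on_linear: "bounded_linear L \<Longrightarrow> Ck_on k L S"
  by (cases k)
     (auto simp: linear_continuous_on bounded_linear_imp_differentiable Ck_on_const
       frechet_derivative_at[symmetric, OF bounded_linear_imp_has_derivative])

lemma smooth_eucl_cong:
  "open S \<Longrightarrow> (\<And>x. x \<in> S \<Longrightarrow> f x = g x) \<Longrightarrow> smooth_eucl f S \<Longrightarrow> smooth_eucl g S"
  unfolding smooth_eucl_def by (metis Ck_on_cong)

lemma smooth_eucl_subset: "smooth_eucl f S \<Longrightarrow> T \<subseteq> S \<Longrightarrow> smooth_eucl f T"
  unfolding smooth_eucl_def by (metis Ck_on_subset)

lemma smooth_eucl_local: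
  "(\<And>x. x \<in> S \<Longrightarrow> \<exists>T. open T \<and> x \<in> T \<and> smooth_eucl f T) \<Longrightarrow> smooth_eucl f S"
  unfolding smooth_eucl_def by (metis Ck_on_local)

lemma smooth_eucl_const: "smooth_eucl (\<lambda>x. c) S"
  unfolding smooth_eucl_def by (simp add: Ck_on_const)

lemma smooth_eucl_linear: "bounded_linear L \<Longrightarrow> smooth_eucl L S"
  unfolding smooth_eucl_def by (simp add: Ck_on_linear)

lemma smooth_eucl_bounded_linear:
  "bounded_linear L \<Longrightarrow> open S \<Longrightarrow> smooth_eucl f S \<Longrightarrow> smooth_eucl (\<lambda>x. L (f x)) S"
  unfolding smooth_eucl_def by (metis Ck_on_bounded_linear)

lemma smooth_eucl_add:
  "open S \<Longrightarrow> smooth_eucl f S \<Longrightarrow> smooth_eucl g S \<Longrightarrow> smooth_eucl (\<lambda>x. f x + g x) S"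
  unfolding smooth_eucl_def by (metis Ck_on_add)

lemma smooth_eucl_mult:
  fixes f g :: "'a::euclidean_space \<Rightarrow> real"
  shows "open S \<Longrightarrow> smooth_eucl f S \<Longrightarrow> smooth_eucl g S \<Longrightarrow> smooth_eucl (\<lambda>x. f x * g x) S"
  unfolding smooth_eucl_def by (metis Ck_on_mult)

lemma smooth_eucl_inverse:
  fixes f :: "'a::euclidean_space \<Rightarrow> real"
  shows "open S \<Longrightarrow> (\<And>x. x \<in> S \<Longrightarrow> f x \<noteq> 0) \<Longrightarrow> smooth_eucl f S \<Longrightarrow>
    smooth_eucl (\<lambda>x. inverse (f x)) S"
  unfolding smooth_eucl_def by (metis Ck_on_inverse)

lemma smooth_eucl_compose:
  fixes f :: "'a::euclidean_space \<Rightarrow> 'b::euclidean_space"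
  shows "open S \<Longrightarrow> open T \<Longrightarrow> f ` S \<subseteq> T \<Longrightarrow> smooth_eucl f S \<Longrightarrow> smooth_eucl g T \<Longrightarrow>
    smooth_eucl (\<lambda>x. g (f x)) S"
  unfolding smooth_eucl_def by (metis Ck_on_compose)

lemma smooth_eucl_Pair:
  fixes f :: "'a::euclidean_space \<Rightarrow> 'b::real_normed_vector"
    and g :: "'a \<Rightarrow> 'c::real_normed_vector"
  assumes "open S" "smooth_eucl f S" "smooth_eucl g S"
  shows "smooth_eucl (\<lambda>x. (f x, g x)) S"
proof -
  have "bounded_linear (\<lambda>x::'b. (x, 0::'c))" "bounded_linear (\<lambda>x::'c. (0::'b, x))"
    by (intro bounded_linear_Pair bounded_linear_ident bounded_linear_zero)+
  from smooth_eucl_add[OF assms(1) smooth_eucl_bounded_linear[OF this(1) assms(1,2)]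
    smooth_eucl_bounded_linear[OF this(2) assms(1,3)]]
  show ?thesis by simp
qed

lemma smooth_eucl_frechet:
  "smooth_eucl f S \<Longrightarrow> smooth_eucl (\<lambda>x. frechet_derivative f (at x) v) S"
  unfolding smooth_eucl_def by (metis Ck_on.simps(2))

lemma smooth_eucl_derivative:
  "smooth_eucl f S \<Longrightarrow> x \<in> S \<Longrightarrow> (f has_derivative frechet_derivative f (at x)) (at x)"
  unfolding smooth_eucl_def by (metis Ck_on_Suc_derivative)

lemma smooth_eucl_continuous: "smooth_eucl f S \<Longrightarrow> continuous_on S f"
  unfolding smooth_eucl_def by (metis Ck_on.simps(1))

lemma frechet_derivative_Basis:
  assumes "f differentiable (at x)"
  shows "frechet_derivative f (at x) w =
    (\<Sum>b\<in>Basis. (w \<bullet> b) *\<^sub>R frechet_derivative f (at x) b)"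
  by (subst euclidean_representation[of w, symmetric])
     (simp only: linear_sum[OF linear_frechet_derivative[OF assms]]
        linear_cmul[OF linear_frechet_derivative[OF assms]])

lemma segment_in_ball:
  fixes x :: "'a::euclidean_space"
  assumes "x \<in> ball x0 r" "s \<in> {0..1}"
  shows "x0 + s *\<^sub>R (x - x0) \<in> ball x0 r"
proof -
  have "\<bar>s\<bar> * norm (x - x0) \<le> 1 * norm (x - x0)"
    using assms(2) by (intro mult_right_mono) auto
  then show ?thesis using assms(1) by (simp add: dist_norm norm_minus_commute)
qed

lemma continuous_on_segment_integrand:
  fixes h :: "'a::euclidean_space \<Rightarrow> real"
  assumes "continuous_on (ball x0 r) h"
  shows "continuous_on (ball x0 r \<times> {0..1})
    (\<lambda>z. snd z ^ j * h (x0 + snd z *\<^sub>R (fst z - x0)))"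
proof -
  have "continuous_on (ball x0 r \<times> {0..1::real}) (\<lambda>z. x0 + snd z *\<^sub>R (fst z - x0))"
    by (intro continuous_intros)
  moreover have "(\<lambda>z. x0 + snd z *\<^sub>R (fst z - x0)) ` (ball x0 r \<times> {0..1}) \<subseteq> ball x0 r"
    using segment_in_ball by force
  ultimately have "continuous_on (ball x0 r \<times> {0..1})
      (\<lambda>z. h (x0 + snd z *\<^sub>R (fst z - x0)))"
    by (rule continuous_on_compose2[OF assms])
  then show ?thesis by (intro continuous_intros)
qed

text \<open>Differentiating the integral in the direction \<open>v\<close> replaces \<open>h\<close> by its derivatives and raises the
  power of \<open>s\<close>; with arbitrary \<open>j\<close> the claim reproduces itself under differentiation.\<close>

lemma Ck_on_segment_integral:
  fixes h :: "'a::euclidean_space \<Rightarrow> real"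
  assumes "smooth_eucl h (ball x0 r)"
  shows "Ck_on k (\<lambda>x. integral {0..1} (\<lambda>s. s ^ j * h (x0 + s *\<^sub>R (x - x0)))) (ball x0 r)"
  using assms
proof (induction k arbitrary: h j)
  case 0
  have "continuous_on (ball x0 r)
      (\<lambda>x. integral (cbox 0 1) (\<lambda>s. s ^ j * h (x0 + s *\<^sub>R (x - x0))))"
    using continuous_on_segment_integrand[OF smooth_eucl_continuous[OF 0]]
    by (intro integral_continuous_on_param) (simp add: case_prod_unfold)
  then show ?case by simp
next
  case (Suc k)
  let ?B = "ball x0 r"
  let ?d = "\<lambda>b x. frechet_derivative h (at x) b"
  define F where "F = (\<lambda>x s. \<Sum>b\<in>Basis.
      (s ^ Suc j * ?d b (x0 + s *\<^sub>R (x - x0))) *\<^sub>R blinfun_inner_right b)"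
  have cont: "continuous_on (?B \<times> {0..1}) (\<lambda>z. snd z ^ j * ?d b (x0 + snd z *\<^sub>R (fst z - x0)))" for b j
    by (rule continuous_on_segment_integrand[OF smooth_eucl_continuous[OF
        smooth_eucl_frechet[OF Suc.prems]]])
  have contF: "continuous_on (?B \<times> {0..1}) (\<lambda>z. F (fst z) (snd z))"
    unfolding F_def by (intro continuous_intros cont)
  have sl: "continuous_on {0..1} (\<lambda>s. G x s)"
    if "continuous_on (?B \<times> {0..1}) (\<lambda>z. G (fst z) (snd z))" "x \<in> ?B"
    for G :: "'a \<Rightarrow> real \<Rightarrow> 'z::real_normed_vector" and x
  proof -
    have "continuous_on {0..1} (Pair x :: real \<Rightarrow> _)" by (intro continuous_intros)
    moreover have "Pair x ` {0..1::real} \<subseteq> ball x0 r \<times> {0..1}" using that(2) by auto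
    ultimately show ?thesis using continuous_on_compose2[OF that(1), of "{0..1}" "Pair x"] by simp
  qed
  have der: "((\<lambda>x. s ^ j * h (x0 + s *\<^sub>R (x - x0))) has_derivative blinfun_apply (F x s)) (at x within ?B)"
    if x: "x \<in> ?B" and s: "s \<in> {0..1}" for x s
  proof -
    let ?y = "x0 + s *\<^sub>R (x - x0)"
    have h: "(h has_derivative frechet_derivative h (at ?y)) (at ?y)"
      by (rule smooth_eucl_derivative[OF Suc.prems segment_in_ball[OF x s]])
    have "((\<lambda>x. x0 + s *\<^sub>R (x - x0)) has_derivative (\<lambda>v. s *\<^sub>R v)) (at x)"
      by (auto intro!: derivative_eq_intros)
    from diff_chain_at[OF this h]
    have "((\<lambda>x. h (x0 + s *\<^sub>R (x - x0))) has_derivative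
        (\<lambda>v. frechet_derivative h (at ?y) (s *\<^sub>R v))) (at x)" by (simp add: o_def)
    then have "((\<lambda>x. s ^ j * h (x0 + s *\<^sub>R (x - x0))) has_derivative
        (\<lambda>v. s ^ j * frechet_derivative h (at ?y) (s *\<^sub>R v))) (at x)"
      by (auto intro!: derivative_eq_intros)
    moreover have "s ^ j * frechet_derivative h (at ?y) (s *\<^sub>R v) = blinfun_apply (F x s) v" for v
    proof -
      have d: "h differentiable (at ?y)" using h by (auto simp: differentiable_def)
      show ?thesis
        unfolding F_def frechet_derivative_Basis[OF d, of "s *\<^sub>R v"]
        by (simp add: blinfun.sum_left blinfun.scaleR_left sum_distrib_left mult_ac
            inner_commute power_Suc)
    qed
    ultimately show ?thesis by (simp add: has_derivative_at_withinI)
  qed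
  have "((\<lambda>x. integral {0..1} (\<lambda>s. s ^ j * h (x0 + s *\<^sub>R (x - x0)))) has_derivative
      (\<lambda>v. integral {0..1} (\<lambda>s. \<Sum>b\<in>Basis. (v \<bullet> b) * (s ^ Suc j * ?d b (x0 + s *\<^sub>R (x - x0))))))
      (at x)" if x: "x \<in> ?B" for x
  proof -
    have "((\<lambda>x. integral (cbox 0 1) (\<lambda>s. s ^ j * h (x0 + s *\<^sub>R (x - x0)))) has_derivative
      blinfun_apply (integral (cbox 0 1) (F x))) (at x within ?B)"
    proof (rule leibniz_rule[OF _ _ _ x convex_ball])
      show "(\<lambda>s. s ^ j * h (x0 + s *\<^sub>R (x - x0))) integrable_on cbox 0 1" if "x \<in> ?B" for x
        using sl[OF continuous_on_segment_integrand[OF smooth_eucl_continuous[OF Suc.prems]] that]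
        by (intro integrable_continuous) simp
      show "continuous_on (?B \<times> cbox 0 1) (\<lambda>(x, t). F x t)"
        using contF by (simp add: case_prod_unfold)
    qed (use der in auto)
    then have "((\<lambda>x. integral {0..1} (\<lambda>s. s ^ j * h (x0 + s *\<^sub>R (x - x0)))) has_derivative
      blinfun_apply (integral (cbox 0 1) (F x))) (at x)"
      using x by (simp add: at_within_open[OF _ open_ball] del: mem_ball)
    moreover have "blinfun_apply (integral (cbox 0 1) (F x)) v =
        integral {0..1} (\<lambda>s. \<Sum>b\<in>Basis. (v \<bullet> b) * (s ^ Suc j * ?d b (x0 + s *\<^sub>R (x - x0))))" for v
    proof -
      have "F x integrable_on {0..1}"
        using integrable_continuous_real[OF sl[OF contF x]] .
      from integral_linear[OF this blinfun.bounded_linear_left, of v]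
      show ?thesis
        by (simp add: o_def F_def blinfun.sum_left blinfun.scaleR_left mult_ac inner_commute)
    qed
    ultimately show ?thesis by (rule has_derivative_eq_rhs[OF _ ext])
  qed
  then show ?case
  proof (rule Ck_on_SucI[OF open_ball])
    fix v
    have "Ck_on k (\<lambda>x. \<Sum>b\<in>Basis. (v \<bullet> b) *
        integral {0..1} (\<lambda>s. s ^ Suc j * ?d b (x0 + s *\<^sub>R (x - x0)))) ?B"
      by (intro Ck_on_sum Ck_on_mult Ck_on_const Suc.IH smooth_eucl_frechet Suc.prems open_ball)
    then show "Ck_on k (\<lambda>x. integral {0..1} (\<lambda>s. \<Sum>b\<in>Basis. (v \<bullet> b) *
        (s ^ Suc j * ?d b (x0 + s *\<^sub>R (x - x0))))) ?B"
    proof (rule Ck_on_cong[OF open_ball, rotated])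
      fix x assume x: "x \<in> ?B"
      have i: "(\<lambda>s. (v \<bullet> b) * (s ^ Suc j * ?d b (x0 + s *\<^sub>R (x - x0)))) integrable_on {0..1}" for b
        using sl[OF cont x, of "Suc j" b]
        by (intro integrable_continuous_real continuous_on_mult_left) simp
      show "(\<Sum>b\<in>Basis. (v \<bullet> b) * integral {0..1} (\<lambda>s. s ^ Suc j * ?d b (x0 + s *\<^sub>R (x - x0)))) =
        integral {0..1} (\<lambda>s. \<Sum>b\<in>Basis. (v \<bullet> b) * (s ^ Suc j * ?d b (x0 + s *\<^sub>R (x - x0))))"
        by (subst integral_sum[OF finite_Basis i]) simp
    qed
  qed
qed

text \<open>The factors are \<open>g\<^sub>b(x) = \<integral>\<^sub>0\<^sup>1 \<partial>\<^sub>b f (x\<^sub>0 + s (x - x\<^sub>0)) ds\<close>, and the formula is the fundamental theorem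
  of calculus along the segment from \<open>x\<^sub>0\<close> to \<open>x\<close>.\<close>

lemma hadamard:
  fixes f :: "'a::euclidean_space \<Rightarrow> real"
  assumes "smooth_eucl f (ball x0 r)" "r > 0"
  obtains g where "\<And>b. smooth_eucl (g b) (ball x0 r)"
    and "\<And>x. x \<in> ball x0 r \<Longrightarrow> f x = f x0 + (\<Sum>b\<in>Basis. ((x - x0) \<bullet> b) * g b x)"
    and "\<And>b. g b x0 = frechet_derivative f (at x0) b"
proof
  define g where "g b x = integral {0..1}
    (\<lambda>s. s ^ 0 * frechet_derivative f (at (x0 + s *\<^sub>R (x - x0))) b)" for b x
  show "smooth_eucl (g b) (ball x0 r)" for b
    unfolding smooth_eucl_def g_def using Ck_on_segment_integral[OF smooth_eucl_frechet[OF assms(1)]]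
    by blast
  show "g b x0 = frechet_derivative f (at x0) b" for b
    by (simp add: g_def)
  fix x assume x: "x \<in> ball x0 r"
  let ?y = "\<lambda>s. x0 + s *\<^sub>R (x - x0)"
  have "((\<lambda>s. frechet_derivative f (at (?y s)) (x - x0)) has_integral f (?y 1) - f (?y 0)) {0..1}"
  proof (rule fundamental_theorem_of_calculus)
    fix s :: real assume s: "s \<in> {0..1}"
    note h = smooth_eucl_derivative[OF assms(1) segment_in_ball[OF x s]]
    have "(?y has_derivative (\<lambda>t. t *\<^sub>R (x - x0))) (at s)"
      by (auto intro!: derivative_eq_intros)
    from diff_chain_at[OF this h]
    have "((\<lambda>s. f (?y s)) has_derivative (\<lambda>t. t *\<^sub>R frechet_derivative f (at (?y s)) (x - x0))) (at s)"
      using linear_cmul[OF has_derivative_linear[OF h]] by (simp add: o_def)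
    then show "((\<lambda>s. f (?y s)) has_vector_derivative frechet_derivative f (at (?y s)) (x - x0))
        (at s within {0..1})"
      by (simp add: has_vector_derivative_def has_derivative_at_withinI)
  qed simp
  then have "f x - f x0 = integral {0..1} (\<lambda>s. frechet_derivative f (at (?y s)) (x - x0))"
    by (simp add: integral_unique)
  also have "\<dots> = integral {0..1} (\<lambda>s. \<Sum>b\<in>Basis. ((x - x0) \<bullet> b) * frechet_derivative f (at (?y s)) b)"
  proof (rule integral_cong)
    fix s :: real assume s: "s \<in> {0..1}"
    have "f differentiable (at (?y s))"
      using smooth_eucl_derivative[OF assms(1) segment_in_ball[OF x s]] by (auto simp: differentiable_def)
    from frechet_derivative_Basis[OF this, of "x - x0"]
    show "frechet_derivative f (at (?y s)) (x - x0) =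
      (\<Sum>b\<in>Basis. ((x - x0) \<bullet> b) * frechet_derivative f (at (?y s)) b)" by simp
  qed
  also have "\<dots> = (\<Sum>b\<in>Basis. ((x - x0) \<bullet> b) * g b x)"
  proof -
    have "continuous_on {0..1} (\<lambda>s. frechet_derivative f (at (?y s)) b)" for b
      using x segment_in_ball[OF x]
      by (intro continuous_on_compose2[OF smooth_eucl_continuous[OF
            smooth_eucl_frechet[OF assms(1), of b]]] continuous_intros) auto
    then have "(\<lambda>s. ((x - x0) \<bullet> b) * frechet_derivative f (at (?y s)) b) integrable_on {0..1}" for b
      by (intro integrable_continuous_real continuous_intros)
    then show ?thesis by (subst integral_sum) (auto simp: g_def)
  qed
  finally show "f x = f x0 + (\<Sum>b\<in>Basis. ((x - x0) \<bullet> b) * g b x)" by simp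
qed

section \<open>Smooth functions on manifolds\<close>

lemma chart_facts:
  assumes "smooth_manifold M" "(V, \<phi>) \<in> M"
  shows "open V" "open (\<phi> ` V)" "homeomorphism V (\<phi> ` V) \<phi> (inv_into V \<phi>)"
    "p \<in> V \<Longrightarrow> inv_into V \<phi> (\<phi> p) = p" "V \<subseteq> points M" "continuous_on V \<phi>"
proof -
  show h: "open V" "open (\<phi> ` V)" "homeomorphism V (\<phi> ` V) \<phi> (inv_into V \<phi>)"
    using assms unfolding smooth_manifold_def by blast+
  show "p \<in> V \<Longrightarrow> inv_into V \<phi> (\<phi> p) = p" "continuous_on V \<phi>"
    using h(3) by (auto simp: homeomorphism_def)
  show "V \<subseteq> points M" using assms(2) by (auto simp: points_def)
qed

lemma chart_image_open:
  assumes "smooth_manifold M" "(V, \<phi>) \<in> M" "open T"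
  shows "open (\<phi> ` (V \<inter> T))"
proof -
  note c = chart_facts[OF assms(1,2)]
  have "openin (top_of_set (\<phi> ` V)) (\<phi> ` (V \<inter> T))"
    using c(3) assms(3) by (intro homeomorphism_imp_open_map[OF c(3)]) (auto simp: openin_open)
  then show ?thesis using c(2) openin_open_trans by blast
qed

lemma chart_preimage_open:
  assumes "smooth_manifold M" "(V, \<phi>) \<in> M" "open B"
  shows "open (V \<inter> \<phi> -` B)"
  using chart_facts[OF assms(1,2)] assms(3) continuous_open_preimage by blast

lemma point_chart:
  assumes "p \<in> points M"
  obtains V \<phi> where "(V, \<phi>) \<in> M" "p \<in> V"
  using assms unfolding points_def by auto

lemma points_open: "smooth_manifold M \<Longrightarrow> open (points M)"
  unfolding points_def by (auto intro!: open_UN dest: chart_facts(1))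

lemma transition_smooth:
  assumes "smooth_manifold M" "(V, \<phi>) \<in> M" "(W, \<psi>) \<in> M"
  shows "smooth_eucl (\<psi> \<circ> inv_into V \<phi>) (\<phi> ` (V \<inter> W))"
  using assms unfolding smooth_manifold_def by fast

text \<open>By smoothness of the transition maps, one chart around each point decides smoothness.\<close>

lemma smooth_fun_onI:
  assumes M: "smooth_manifold M" and U: "open U" "U \<subseteq> points M"
    and loc: "\<And>p. p \<in> U \<Longrightarrow> \<exists>V \<phi> T. (V, \<phi>) \<in> M \<and> p \<in> V \<and> open T \<and> p \<in> T \<and>
      smooth_eucl (f \<circ> inv_into V \<phi>) (\<phi> ` (V \<inter> T))"
  shows "smooth_fun_on M U f"
  unfolding smooth_fun_on_def
proof (intro conjI U ballI, clarify)
  fix W \<psi> assume W: "(W, \<psi>) \<in> M"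
  note cW = chart_facts[OF M W]
  show "smooth_eucl (f \<circ> inv_into W \<psi>) (\<psi> ` (U \<inter> W))"
  proof (rule smooth_eucl_local)
    fix x assume "x \<in> \<psi> ` (U \<inter> W)"
    then obtain p where p: "p \<in> U" "p \<in> W" "x = \<psi> p" by auto
    obtain V \<phi> T where V: "(V, \<phi>) \<in> M" "p \<in> V" "open T" "p \<in> T"
      and s: "smooth_eucl (f \<circ> inv_into V \<phi>) (\<phi> ` (V \<inter> T))" using loc[OF p(1)] by blast
    note cV = chart_facts[OF M V(1)]
    let ?T = "\<psi> ` (W \<inter> (V \<inter> T))"
    have o: "open ?T" using cV(1) V(3) by (intro chart_image_open[OF M W]) auto
    have "smooth_eucl (\<lambda>x. (f \<circ> inv_into V \<phi>) ((\<phi> \<circ> inv_into W \<psi>) x)) ?T"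
    proof (rule smooth_eucl_compose[OF o chart_image_open[OF M V(1,3)] _ _ s])
      show "smooth_eucl (\<phi> \<circ> inv_into W \<psi>) ?T"
        by (rule smooth_eucl_subset[OF transition_smooth[OF M W V(1)]]) auto
      show "(\<phi> \<circ> inv_into W \<psi>) ` ?T \<subseteq> \<phi> ` (V \<inter> T)"
        using cW(4) by auto
    qed
    then have "smooth_eucl (f \<circ> inv_into W \<psi>) ?T"
      by (rule smooth_eucl_cong[OF o, rotated]) (auto simp: cW(4) cV(4))
    then show "\<exists>T. open T \<and> x \<in> T \<and> smooth_eucl (f \<circ> inv_into W \<psi>) T"
      using o p V by blast
  qed
qed

lemma smooth_fun_on_chart:
  assumes "smooth_fun_on M U f" "(V, \<phi>) \<in> M"
  shows "smooth_eucl (f \<circ> inv_into V \<phi>) (\<phi> ` (V \<inter> U))"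
  using assms unfolding smooth_fun_on_def by (auto simp: Int_commute)

lemma smooth_fun_on_subset:
  assumes "smooth_fun_on M U f" "open W" "W \<subseteq> U"
  shows "smooth_fun_on M W f"
proof -
  have "smooth_eucl (f \<circ> inv_into V \<phi>) (\<phi> ` (W \<inter> V))" if "(V, \<phi>) \<in> M" for V \<phi>
    using smooth_fun_on_chart[OF assms(1) that] assms(3)
    by (rule_tac smooth_eucl_subset) auto
  then show ?thesis using assms unfolding smooth_fun_on_def by auto
qed

lemma smooth_near_point: "smooth_near M p f \<Longrightarrow> p \<in> points M"
  unfolding smooth_near_def smooth_fun_on_def by auto

lemma smooth_near_obtain:
  assumes "smooth_near M p f" "open U" "p \<in> U"
  obtains W where "smooth_fun_on M W f" "p \<in> W" "W \<subseteq> U" "open W"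
proof -
  obtain T where T: "p \<in> T" "smooth_fun_on M T f" using assms(1) unfolding smooth_near_def by blast
  then have "open T" by (simp add: smooth_fun_on_def)
  then show ?thesis
    using that[of "T \<inter> U"] smooth_fun_on_subset[OF T(2), of "T \<inter> U"] T assms by auto
qed

lemma smooth_fun_on_near: "smooth_fun_on M U f \<Longrightarrow> p \<in> U \<Longrightarrow> smooth_near M p f"
  unfolding smooth_near_def by blast

lemma smooth_fun_on_iff_near:
  assumes "smooth_manifold M" "open U" "\<And>p. p \<in> U \<Longrightarrow> smooth_near M p f"
  shows "smooth_fun_on M U f"
proof (rule smooth_fun_onI[OF assms(1,2)])
  show "U \<subseteq> points M" using assms(3) smooth_near_point by blast
  fix p assume "p \<in> U"
  then obtain W where W: "p \<in> W" "smooth_fun_on M W f" "open W"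
    using smooth_near_obtain[OF assms(3) open_UNIV] by (metis UNIV_I)
  obtain V \<phi> where V: "(V, \<phi>) \<in> M" "p \<in> V"
    using point_chart[of p M] smooth_near_point[OF assms(3)[OF \<open>p \<in> U\<close>]] by blast
  then show "\<exists>V \<phi> T. (V, \<phi>) \<in> M \<and> p \<in> V \<and> open T \<and> p \<in> T \<and>
      smooth_eucl (f \<circ> inv_into V \<phi>) (\<phi> ` (V \<inter> T))"
    using smooth_fun_on_chart[OF W(2) V(1)] W by blast
qed

lemma smooth_fun_on_cong:
  assumes M: "smooth_manifold M" and f: "smooth_fun_on M U f" and eq: "\<And>x. x \<in> U \<Longrightarrow> f x = g x"
  shows "smooth_fun_on M U g"
proof -
  have "open U" using f by (simp add: smooth_fun_on_def)
  have "smooth_eucl (g \<circ> inv_into V \<phi>) (\<phi> ` (U \<inter> V))" if "(V, \<phi>) \<in> M" for V \<phi>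
    using smooth_fun_on_chart[OF f that] chart_image_open[OF M that \<open>open U\<close>]
      chart_facts(4)[OF M that] eq
    by (subst Int_commute, rule_tac smooth_eucl_cong[of _ "f \<circ> inv_into V \<phi>"]) auto
  then show ?thesis using f by (auto simp: smooth_fun_on_def)
qed

lemma smooth_fun_on_const:
  "smooth_manifold M \<Longrightarrow> open U \<Longrightarrow> U \<subseteq> points M \<Longrightarrow> smooth_fun_on M U (\<lambda>x. c)"
  by (auto simp: smooth_fun_on_def o_def smooth_eucl_const)

lemma smooth_fun_on_map2:
  assumes M: "smooth_manifold M"
    and op: "\<And>S (u::'e \<Rightarrow> real) v. open S \<Longrightarrow> smooth_eucl u S \<Longrightarrow> smooth_eucl v S \<Longrightarrow>
      smooth_eucl (\<lambda>x. F (u x) (v x)) S"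
    and fg: "smooth_fun_on M U f" "smooth_fun_on (M :: ('p::{t2_space, second_countable_topology}, 'e::euclidean_space) atlas) U g"
  shows "smooth_fun_on M U (\<lambda>x. F (f x) (g x))"
proof -
  have "open U" "U \<subseteq> points M" using fg(1) by (auto simp: smooth_fun_on_def)
  then show ?thesis
    using op[OF chart_image_open[OF M _ \<open>open U\<close>] smooth_fun_on_chart[OF fg(1)] smooth_fun_on_chart[OF fg(2)]]
    by (auto simp: smooth_fun_on_def o_def Int_commute)
qed

lemma smooth_fun_on_add:
  "smooth_manifold M \<Longrightarrow> smooth_fun_on M U f \<Longrightarrow> smooth_fun_on M U g \<Longrightarrow>
    smooth_fun_on M U (\<lambda>x. f x + g x)"
  by (rule smooth_fun_on_map2[OF _ smooth_eucl_add])

lemma smooth_fun_on_mult: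
  "smooth_manifold M \<Longrightarrow> smooth_fun_on M U f \<Longrightarrow> smooth_fun_on M U g \<Longrightarrow>
    smooth_fun_on M U (\<lambda>x. f x * g x)"
  by (rule smooth_fun_on_map2[OF _ smooth_eucl_mult])

lemma smooth_fun_on_cmult:
  assumes "smooth_manifold M" "smooth_fun_on M U f"
  shows "smooth_fun_on M U (\<lambda>x. c * f x)"
  using smooth_fun_on_mult[OF assms(1) smooth_fun_on_const[OF assms(1)] assms(2)] assms(2)
  by (auto simp: smooth_fun_on_def)

lemma smooth_fun_on_minus:
  "smooth_manifold M \<Longrightarrow> smooth_fun_on M U f \<Longrightarrow> smooth_fun_on M U (\<lambda>x. - f x)"
  using smooth_fun_on_cmult[of M U f "-1"] by simp

lemma smooth_fun_on_diff:
  "smooth_manifold M \<Longrightarrow> smooth_fun_on M U f \<Longrightarrow> smooth_fun_on M U g \<Longrightarrow>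
    smooth_fun_on M U (\<lambda>x. f x - g x)"
  using smooth_fun_on_add[OF _ _ smooth_fun_on_minus[of M U g], of f] by simp

lemma smooth_fun_on_inverse:
  assumes M: "smooth_manifold M" and f: "smooth_fun_on M U f" and nz: "\<And>x. x \<in> U \<Longrightarrow> f x \<noteq> 0"
  shows "smooth_fun_on M U (\<lambda>x. inverse (f x))"
proof -
  have o: "open U" "U \<subseteq> points M" using f by (auto simp: smooth_fun_on_def)
  have "smooth_eucl (\<lambda>x. inverse ((f \<circ> inv_into V \<phi>) x)) (\<phi> ` (V \<inter> U))" if V: "(V, \<phi>) \<in> M" for V \<phi>
    using nz chart_facts(4)[OF M V]
    by (intro smooth_eucl_inverse chart_image_open[OF M V o(1)] smooth_fun_on_chart[OF f V]) auto
  then show ?thesis using o by (auto simp: smooth_fun_on_def o_def Int_commute)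
qed

lemma smooth_fun_on_sum:
  assumes "smooth_manifold M" "open U" "U \<subseteq> points M" "\<And>i. i \<in> A \<Longrightarrow> smooth_fun_on M U (f i)"
  shows "smooth_fun_on M U (\<lambda>x. \<Sum>i\<in>A. f i x)"
  using assms(4)
  by (induction A rule: infinite_finite_induct)
     (auto intro: smooth_fun_on_const[OF assms(1-3)] smooth_fun_on_add[OF assms(1)])

lemma smooth_fun_on_prod:
  assumes "smooth_manifold M" "open U" "U \<subseteq> points M" "\<And>i. i \<in> A \<Longrightarrow> smooth_fun_on M U (f i)"
  shows "smooth_fun_on M U (\<lambda>x. \<Prod>i\<in>A. f i x)"
  using assms(4)
  by (induction A rule: infinite_finite_induct)
     (auto intro: smooth_fun_on_const[OF assms(1-3)] smooth_fun_on_mult[OF assms(1)])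

lemma smooth_near_const: "smooth_manifold M \<Longrightarrow> p \<in> points M \<Longrightarrow> smooth_near M p (\<lambda>x. c)"
  using smooth_fun_on_const[OF _ points_open subset_refl] smooth_fun_on_near by metis

lemma smooth_near_both:
  assumes "smooth_near M p f" "smooth_near M p g"
  obtains W where "p \<in> W" "open W" "smooth_fun_on M W f" "smooth_fun_on M W g"
proof -
  obtain W where W: "smooth_fun_on M W f" "p \<in> W" "open W"
    using smooth_near_obtain[OF assms(1) open_UNIV] by blast
  obtain T where "smooth_fun_on M T g" "p \<in> T" "T \<subseteq> W" "open T"
    using smooth_near_obtain[OF assms(2) W(3,2)] by blast
  then show ?thesis using that smooth_fun_on_subset[OF W(1)] by blast
qed

lemma smooth_near_add:
  "smooth_manifold M \<Longrightarrow> smooth_near M p f \<Longrightarrow> smooth_near M p g \<Longrightarrow> smooth_near M p (\<lambda>x. f x + g x)"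
  by (metis smooth_near_both smooth_fun_on_add smooth_fun_on_near)

lemma smooth_near_mult:
  "smooth_manifold M \<Longrightarrow> smooth_near M p f \<Longrightarrow> smooth_near M p g \<Longrightarrow> smooth_near M p (\<lambda>x. f x * g x)"
  by (metis smooth_near_both smooth_fun_on_mult smooth_fun_on_near)

lemma smooth_near_sum:
  assumes "smooth_manifold M" "p \<in> points M" "\<And>i. i \<in> A \<Longrightarrow> smooth_near M p (f i)"
  shows "smooth_near M p (\<lambda>x. \<Sum>i\<in>A. f i x)"
  using assms(3)
  by (induction A rule: infinite_finite_induct)
     (auto intro: smooth_near_const smooth_near_add assms(1,2))

lemma smooth_near_cong:
  assumes "smooth_manifold M" "smooth_near M p f" "open U" "p \<in> U" "\<And>x. x \<in> U \<Longrightarrow> f x = g x"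
  shows "smooth_near M p g"
proof -
  obtain W where W: "smooth_fun_on M W f" "p \<in> W" "W \<subseteq> U" "open W"
    by (rule smooth_near_obtain[OF assms(2-4)])
  have "smooth_fun_on M W g"
    by (rule smooth_fun_on_cong[OF assms(1) W(1) assms(5)[OF subsetD[OF W(3)]]])
  then show ?thesis using W(2) by (rule smooth_fun_on_near)
qed

lemma smooth_fun_on_chartI:
  assumes M: "smooth_manifold M" and V: "(V, \<phi>) \<in> M" and B: "open B" and h: "smooth_eucl h B"
  shows "smooth_fun_on M (V \<inter> \<phi> -` B) (\<lambda>x. h (\<phi> x))"
proof (rule smooth_fun_onI[OF M])
  note c = chart_facts[OF M V]
  show o: "open (V \<inter> \<phi> -` B)" by (rule chart_preimage_open[OF M V B])
  show "V \<inter> \<phi> -` B \<subseteq> points M" using c(5) by auto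
  fix p assume p: "p \<in> V \<inter> \<phi> -` B"
  let ?S = "\<phi> ` (V \<inter> (V \<inter> \<phi> -` B))"
  have "smooth_eucl ((\<lambda>x. h (\<phi> x)) \<circ> inv_into V \<phi>) ?S"
    by (rule smooth_eucl_cong[OF chart_image_open[OF M V o] _ smooth_eucl_subset[OF h]])
       (auto simp: c(4))
  then show "\<exists>V' \<phi>' T. (V', \<phi>') \<in> M \<and> p \<in> V' \<and> open T \<and> p \<in> T \<and>
      smooth_eucl ((\<lambda>x. h (\<phi> x)) \<circ> inv_into V' \<phi>') (\<phi>' ` (V' \<inter> T))"
    using V p o by blast
qed

lemma smooth_fun_on_coordinate:
  assumes "smooth_manifold M" "(V, \<phi>) \<in> M"
  shows "smooth_fun_on M V (\<lambda>x. \<phi> x \<bullet> b)"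
  using smooth_fun_on_chartI[OF assms open_UNIV smooth_eucl_linear[OF bounded_linear_inner_left]]
  by simp

section \<open>Tangent vectors\<close>

lemma tangent_add:
  "v \<in> tangent M p \<Longrightarrow> smooth_near M p f \<Longrightarrow> smooth_near M p g \<Longrightarrow> v (\<lambda>x. f x + g x) = v f + v g"
  unfolding tangent_def by blast

lemma tangent_cmult: "v \<in> tangent M p \<Longrightarrow> smooth_near M p f \<Longrightarrow> v (\<lambda>x. c * f x) = c * v f"
  unfolding tangent_def by blast

lemma tangent_mult:
  "v \<in> tangent M p \<Longrightarrow> smooth_near M p f \<Longrightarrow> smooth_near M p g \<Longrightarrow>
    v (\<lambda>x. f x * g x) = f p * v g + g p * v f"
  unfolding tangent_def by blast

lemma tangent_nonsmooth: "v \<in> tangent M p \<Longrightarrow> \<not> smooth_near M p f \<Longrightarrow> v f = 0"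
  unfolding tangent_def by blast

lemma tangent_const:
  assumes "smooth_manifold M" "p \<in> points M" "v \<in> tangent M p"
  shows "v (\<lambda>x. c) = 0"
proof -
  note s = smooth_near_const[OF assms(1,2)]
  have "v (\<lambda>x. 1 * 1) = 1 * v (\<lambda>x. 1) + 1 * v (\<lambda>x. 1)"
    by (rule tangent_mult[OF assms(3) s s])
  then have "v (\<lambda>x. 1) = 0" by simp
  then show ?thesis using tangent_cmult[OF assms(3) s[of 1], of c] by simp
qed

lemma tangent_sum:
  assumes "smooth_manifold M" "p \<in> points M" "v \<in> tangent M p" "\<And>i. i \<in> A \<Longrightarrow> smooth_near M p (f i)"
  shows "v (\<lambda>x. \<Sum>i\<in>A. f i x) = (\<Sum>i\<in>A. v (f i))"
  using assms(4)
proof (induction A rule: infinite_finite_induct)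
  case (insert i A)
  have "smooth_near M p (\<lambda>x. \<Sum>i\<in>A. f i x)"
    by (rule smooth_near_sum[OF assms(1,2)]) (use insert in auto)
  then show ?case using insert by (simp add: tangent_add[OF assms(3)])
qed (simp_all add: tangent_const[OF assms(1-3)])

text \<open>If \<open>h\<close> vanishes near \<open>p\<close>, then it is its own product with the indicator function of the
  complement of that neighbourhood; both factors vanish at \<open>p\<close>, so the Leibniz rule kills it.\<close>

lemma tangent_local:
  assumes M: "smooth_manifold M" and v: "v \<in> tangent M p" and f: "smooth_near M p f"
    and U: "open U" "p \<in> U" and eq: "\<And>x. x \<in> U \<Longrightarrow> f x = g x"
  shows "v f = v g"
proof -
  note p = smooth_near_point[OF f]
  have g: "smooth_near M p g" by (rule smooth_near_cong[OF M f U eq])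
  define h where "h x = f x + (-1) * g x" for x
  define k :: "'a \<Rightarrow> real" where "k x = (if x \<in> U then 0 else 1)" for x
  have h: "smooth_near M p h"
    unfolding h_def by (intro smooth_near_add[OF M] smooth_near_mult[OF M] f g smooth_near_const[OF M p])
  have k: "smooth_near M p k"
    by (rule smooth_near_cong[OF M smooth_near_const[OF M p, of 0] U]) (simp add: k_def)
  have "h = (\<lambda>x. h x * k x)" using eq by (auto simp: h_def k_def)
  then have "v h = h p * v k + k p * v h" using tangent_mult[OF v h k] by metis
  then have "v h = 0" using U eq by (simp add: h_def k_def)
  moreover have "v f = v (\<lambda>x. h x + g x)" by (simp add: h_def)
  ultimately show ?thesis using tangent_add[OF v h g] by simp
qed

lemma tangent_combination:
  assumes "\<And>i. i \<in> A \<Longrightarrow> v i \<in> tangent M p"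
  shows "(\<lambda>f. \<Sum>i\<in>A. c i * v i f) \<in> tangent M p"
proof -
  have "(\<Sum>i\<in>A. c i * v i (\<lambda>x. f x * g x)) =
      f p * (\<Sum>i\<in>A. c i * v i g) + g p * (\<Sum>i\<in>A. c i * v i f)"
    if "smooth_near M p f" "smooth_near M p g" for f g
  proof -
    have "(\<Sum>i\<in>A. c i * v i (\<lambda>x. f x * g x)) =
        (\<Sum>i\<in>A. f p * (c i * v i g) + g p * (c i * v i f))"
      by (rule sum.cong) (simp_all add: tangent_mult[OF assms that] algebra_simps)
    then show ?thesis by (simp add: sum.distrib sum_distrib_left)
  qed
  moreover have "(\<Sum>i\<in>A. c i * v i (\<lambda>x. f x + g x)) =
      (\<Sum>i\<in>A. c i * v i f) + (\<Sum>i\<in>A. c i * v i g)"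
    if "smooth_near M p f" "smooth_near M p g" for f g
  proof -
    have "(\<Sum>i\<in>A. c i * v i (\<lambda>x. f x + g x)) = (\<Sum>i\<in>A. c i * v i f + c i * v i g)"
      by (rule sum.cong) (simp_all add: tangent_add[OF assms that] algebra_simps)
    then show ?thesis by (simp add: sum.distrib)
  qed
  moreover have "(\<Sum>i\<in>A. c i * v i (\<lambda>x. d * f x)) = d * (\<Sum>i\<in>A. c i * v i f)"
    if "smooth_near M p f" for d f
    unfolding sum_distrib_left
    by (rule sum.cong) (simp_all add: tangent_cmult[OF assms that])
  moreover have "(\<Sum>i\<in>A. c i * v i f) = 0" if "\<not> smooth_near M p f" for f
    by (rule sum.neutral) (simp add: tangent_nonsmooth[OF assms that])
  ultimately show ?thesis unfolding tangent_def by blast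
qed

lemma tangent_vadd:
  assumes "v \<in> tangent M p" "w \<in> tangent M p"
  shows "vadd v w \<in> tangent M p"
proof -
  have "(\<lambda>f. \<Sum>i\<in>{True, False}. 1 * (if i then v else w) f) \<in> tangent M p"
    by (rule tangent_combination) (use assms in auto)
  then show ?thesis by (simp add: vadd_def)
qed

lemma tangent_vscale:
  assumes "v \<in> tangent M p"
  shows "vscale c v \<in> tangent M p"
  using tangent_combination[of "{()}" "\<lambda>_. v" M p "\<lambda>_. c"] assms by (simp add: vscale_def)

lemma tangent_zero: "(\<lambda>f. 0) \<in> tangent M p"
  unfolding tangent_def by auto

definition coord_vector ::
  "('p::topological_space, 'e::euclidean_space) atlas \<Rightarrow> 'p set \<Rightarrow> ('p \<Rightarrow> 'e) \<Rightarrow> 'e \<Rightarrow> 'p vfield" where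
  "coord_vector M V \<phi> w p =
     (\<lambda>f. if smooth_near M p f then frechet_derivative (f \<circ> inv_into V \<phi>) (at (\<phi> p)) w else 0)"

lemma smooth_near_chart:
  assumes M: "smooth_manifold M" and V: "(V, \<phi>) \<in> M" "p \<in> V" and f: "smooth_near M p f"
  obtains B where "open B" "\<phi> p \<in> B" "B \<subseteq> \<phi> ` V" "smooth_eucl (f \<circ> inv_into V \<phi>) B"
proof -
  obtain W where W: "smooth_fun_on M W f" "p \<in> W" "open W"
    using smooth_near_obtain[OF f open_UNIV] by blast
  then show ?thesis
    using that[OF chart_image_open[OF M V(1) W(3)] _ _ smooth_fun_on_chart[OF W(1) V(1)]] V(2)
    by auto
qed

lemma coord_vector_derivative:
  assumes "smooth_manifold M" "(V, \<phi>) \<in> M" "p \<in> V" "smooth_near M p f"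
  shows "((f \<circ> inv_into V \<phi>) has_derivative (\<lambda>w. coord_vector M V \<phi> w p f)) (at (\<phi> p))"
proof -
  obtain B where B: "open B" "\<phi> p \<in> B" "B \<subseteq> \<phi> ` V" "smooth_eucl (f \<circ> inv_into V \<phi>) B"
    by (rule smooth_near_chart[OF assms])
  show ?thesis using smooth_eucl_derivative[OF B(4,2)] assms(4) by (simp add: coord_vector_def)
qed

lemma coord_vector_eqI:
  assumes "smooth_manifold M" "(V, \<phi>) \<in> M" "p \<in> V" "smooth_near M p f"
    and "((f \<circ> inv_into V \<phi>) has_derivative D) (at (\<phi> p))"
  shows "coord_vector M V \<phi> w p f = D w"
  using has_derivative_unique[OF coord_vector_derivative[OF assms(1-4)] assms(5)] by metis

lemma coord_vector_tangent:
  assumes "smooth_manifold M" "(V, \<phi>) \<in> M" "p \<in> V"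
  shows "coord_vector M V \<phi> w p \<in> tangent M p"
proof -
  note D = coord_vector_derivative[OF assms]
  have p: "p \<in> points M" using assms by (auto simp: points_def)
  have ip: "inv_into V \<phi> (\<phi> p) = p" using chart_facts(4)[OF assms(1,2)] assms(3) by simp
  have "coord_vector M V \<phi> w p (\<lambda>x. f x + g x) = coord_vector M V \<phi> w p f + coord_vector M V \<phi> w p g"
    if "smooth_near M p f" "smooth_near M p g" for f g
    by (rule coord_vector_eqI[OF assms smooth_near_add[OF assms(1) that]])
       (use has_derivative_add[OF D[OF that(1)] D[OF that(2)]] in \<open>simp add: o_def\<close>)
  moreover have "coord_vector M V \<phi> w p (\<lambda>x. f x * g x) =
      f p * coord_vector M V \<phi> w p g + g p * coord_vector M V \<phi> w p f"
    if "smooth_near M p f" "smooth_near M p g" for f g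
    by (rule coord_vector_eqI[OF assms smooth_near_mult[OF assms(1) that]])
       (use has_derivative_mult[OF D[OF that(1)] D[OF that(2)]] in \<open>simp add: o_def ip algebra_simps\<close>)
  moreover have "coord_vector M V \<phi> w p (\<lambda>x. c * f x) = c * coord_vector M V \<phi> w p f"
    if "smooth_near M p f" for f c
    by (rule coord_vector_eqI[OF assms smooth_near_mult[OF assms(1) smooth_near_const[OF assms(1) p] that]])
       (use has_derivative_mult_right[OF D[OF that]] in \<open>simp add: o_def\<close>)
  moreover have "coord_vector M V \<phi> w p f = 0" if "\<not> smooth_near M p f" for f
    using that by (simp add: coord_vector_def)
  ultimately show ?thesis unfolding tangent_def by blast
qed

lemma coord_vector_coordinate:
  assumes M: "smooth_manifold M" and V: "(V, \<phi>) \<in> M" "p \<in> V"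
  shows "coord_vector M V \<phi> w p (\<lambda>x. \<phi> x \<bullet> b) = w \<bullet> b"
proof (rule coord_vector_eqI[OF assms])
  show "smooth_near M p (\<lambda>x. \<phi> x \<bullet> b)"
    by (rule smooth_fun_on_near[OF smooth_fun_on_coordinate[OF M V(1)] V(2)])
  have "((\<lambda>y. y \<bullet> b) has_derivative (\<lambda>w. w \<bullet> b)) (at (\<phi> p))"
    by (rule bounded_linear_imp_has_derivative[OF bounded_linear_inner_left])
  then show "((\<lambda>x. \<phi> x \<bullet> b) \<circ> inv_into V \<phi> has_derivative (\<lambda>w. w \<bullet> b)) (at (\<phi> p))"
    by (rule has_derivative_transform_within_open[OF _ chart_facts(2)[OF M V(1)]])
       (use V chart_facts(4)[OF M V(1)] in auto)
qed

text \<open>By Hadamard's lemma, near \<open>p\<close> a smooth function is its value at \<open>p\<close> plus a sum of products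
  of centred coordinates with smooth functions whose values at \<open>p\<close> are the partial
  derivatives; hence a derivation is determined by its values on the coordinates.\<close>

lemma tangent_eq_coord:
  assumes M: "smooth_manifold M" and V: "(V, \<phi>) \<in> M" "p \<in> V" and v: "v \<in> tangent M p"
  shows "v = (\<lambda>f. \<Sum>b\<in>Basis. v (\<lambda>x. \<phi> x \<bullet> b) * coord_vector M V \<phi> b p f)"
proof
  fix f
  have p: "p \<in> points M" using V by (auto simp: points_def)
  show "v f = (\<Sum>b\<in>Basis. v (\<lambda>x. \<phi> x \<bullet> b) * coord_vector M V \<phi> b p f)"
  proof (cases "smooth_near M p f")
    case False
    then show ?thesis by (simp add: tangent_nonsmooth[OF v] coord_vector_def)
  next
    case True
    obtain B where B: "open B" "\<phi> p \<in> B" "B \<subseteq> \<phi> ` V" "smooth_eucl (f \<circ> inv_into V \<phi>) B"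
      by (rule smooth_near_chart[OF M V True])
    then obtain r where r: "r > 0" "ball (\<phi> p) r \<subseteq> B" using openE by blast
    let ?B = "ball (\<phi> p) r" and ?W = "V \<inter> \<phi> -` ball (\<phi> p) r"
    have ip: "inv_into V \<phi> (\<phi> x) = x" if "x \<in> V" for x
      using chart_facts(4)[OF M V(1) that] .
    obtain g where g: "\<And>b. smooth_eucl (g b) ?B"
      "\<And>x. x \<in> ?B \<Longrightarrow> (f \<circ> inv_into V \<phi>) x = (f \<circ> inv_into V \<phi>) (\<phi> p) + (\<Sum>b\<in>Basis. ((x - \<phi> p) \<bullet> b) * g b x)"
      "\<And>b. g b (\<phi> p) = frechet_derivative (f \<circ> inv_into V \<phi>) (at (\<phi> p)) b"
      using hadamard[OF smooth_eucl_subset[OF B(4) r(2)] r(1)] by blast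
    have W: "open ?W" "p \<in> ?W"
      using chart_preimage_open[OF M V(1) open_ball] V(2) r(1) by auto
    have sg: "smooth_near M p (\<lambda>x. g b (\<phi> x))" for b
      by (rule smooth_fun_on_near[OF smooth_fun_on_chartI[OF M V(1) open_ball g(1)] W(2)])
    have sx: "smooth_near M p (\<lambda>x. \<phi> x \<bullet> b)" for b
      by (rule smooth_fun_on_near[OF smooth_fun_on_coordinate[OF M V(1)] V(2)])
    note c = smooth_near_const[OF M p]
    have sx': "smooth_near M p (\<lambda>x. \<phi> x \<bullet> b + - (\<phi> p \<bullet> b))" for b
      by (rule smooth_near_add[OF M sx c])
    have v': "v (\<lambda>x. \<phi> x \<bullet> b + - (\<phi> p \<bullet> b)) = v (\<lambda>x. \<phi> x \<bullet> b)" for b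
      by (simp only: tangent_add[OF v sx c] tangent_const[OF M p v] add_0_right)
    have s: "smooth_near M p (\<lambda>x. (\<phi> x \<bullet> b + - (\<phi> p \<bullet> b)) * g b (\<phi> x))" for b
      by (rule smooth_near_mult[OF M sx' sg])
    have "v f = v (\<lambda>x. f p + (\<Sum>b\<in>Basis. (\<phi> x \<bullet> b + - (\<phi> p \<bullet> b)) * g b (\<phi> x)))"
    proof (rule tangent_local[OF M v True W])
      fix x assume "x \<in> ?W"
      then show "f x = f p + (\<Sum>b\<in>Basis. (\<phi> x \<bullet> b + - (\<phi> p \<bullet> b)) * g b (\<phi> x))"
        using g(2)[of "\<phi> x"] ip[of x] ip[of p] V(2) by (simp add: inner_diff_left)
    qed
    also have "\<dots> = (\<Sum>b\<in>Basis. v (\<lambda>x. (\<phi> x \<bullet> b + - (\<phi> p \<bullet> b)) * g b (\<phi> x)))"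
      by (simp add: tangent_add[OF v c smooth_near_sum[OF M p s]] tangent_const[OF M p v]
          tangent_sum[OF M p v s] del: add_uminus_conv_diff)
    also have "\<dots> = (\<Sum>b\<in>Basis. g b (\<phi> p) * v (\<lambda>x. \<phi> x \<bullet> b))"
      using tangent_mult[OF v sx' sg] by (simp add: v' del: add_uminus_conv_diff)
    finally show ?thesis using True by (simp add: g(3) coord_vector_def mult.commute)
  qed
qed

lemma tangent_eqI:
  assumes "smooth_manifold M" "(V, \<phi>) \<in> M" "p \<in> V" "v \<in> tangent M p" "w \<in> tangent M p"
    and "\<And>b. b \<in> Basis \<Longrightarrow> v (\<lambda>x. \<phi> x \<bullet> b) = w (\<lambda>x. \<phi> x \<bullet> b)"
  shows "v = w"
  by (subst tangent_eq_coord[OF assms(1-4)], subst tangent_eq_coord[OF assms(1-3,5)])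
     (simp add: assms(6))

section \<open>Vector fields, brackets and one-forms\<close>

lemma vector_field_onD:
  assumes "vector_field_on M U X"
  shows "open U" "U \<subseteq> points M" "p \<in> U \<Longrightarrow> X p \<in> tangent M p"
    "W \<subseteq> U \<Longrightarrow> smooth_fun_on M W f \<Longrightarrow> smooth_fun_on M W (\<lambda>p. X p f)"
  using assms unfolding vector_field_on_def by auto

lemma vector_field_on_subset:
  "vector_field_on M U X \<Longrightarrow> open W \<Longrightarrow> W \<subseteq> U \<Longrightarrow> vector_field_on M W X"
  unfolding vector_field_on_def by (meson subset_trans subsetD)

lemma vector_field_smooth_near:
  assumes "vector_field_on M U X" "p \<in> U" "smooth_near M p f"
  shows "smooth_near M p (\<lambda>q. X q f)"
proof -
  obtain W where "smooth_fun_on M W f" "p \<in> W" "W \<subseteq> U" "open W"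
    by (rule smooth_near_obtain[OF assms(3) vector_field_onD(1)[OF assms(1)] assms(2)])
  then show ?thesis using vector_field_onD(4)[OF assms(1)] smooth_fun_on_near by blast
qed

lemma vector_field_on_local:
  assumes M: "smooth_manifold M" and U: "open U" "U \<subseteq> points M"
    and loc: "\<And>p. p \<in> U \<Longrightarrow> \<exists>W Y. p \<in> W \<and> vector_field_on M W Y \<and> (\<forall>q\<in>W \<inter> U. X q = Y q)"
  shows "vector_field_on M U X"
  unfolding vector_field_on_def
proof (intro conjI U ballI allI impI)
  fix p assume "p \<in> U"
  then show "X p \<in> tangent M p" using loc vector_field_onD(3) by (metis IntI)
next
  fix W f assume W: "W \<subseteq> U" "smooth_fun_on M W f"
  then have oW: "open W" by (simp add: smooth_fun_on_def)
  show "smooth_fun_on M W (\<lambda>p. X p f)"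
  proof (rule smooth_fun_on_iff_near[OF M oW])
    fix p assume p: "p \<in> W"
    then obtain T Y where T: "p \<in> T" "vector_field_on M T Y" "\<forall>q\<in>T \<inter> U. X q = Y q"
      using loc W(1) by blast
    note oT = vector_field_onD(1)[OF T(2)]
    have "smooth_near M p (\<lambda>q. Y q f)"
      by (rule vector_field_smooth_near[OF T(2,1) smooth_fun_on_near[OF W(2) p]])
    then show "smooth_near M p (\<lambda>q. X q f)"
      by (rule smooth_near_cong[OF M _ open_Int[OF oT oW]]) (use p T W in auto)
  qed
qed

lemma vector_field_on_combination:
  assumes M: "smooth_manifold M" and U: "open U" "U \<subseteq> points M"
    and X: "\<And>i. i \<in> A \<Longrightarrow> vector_field_on M U (X i)"
    and c: "\<And>i. i \<in> A \<Longrightarrow> smooth_fun_on M U (c i)"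
  shows "vector_field_on M U (\<lambda>p f. \<Sum>i\<in>A. c i p * X i p f)"
  unfolding vector_field_on_def
proof (intro conjI U ballI allI impI)
  fix p assume "p \<in> U"
  then show "(\<lambda>f. \<Sum>i\<in>A. c i p * X i p f) \<in> tangent M p"
    using vector_field_onD(3)[OF X] by (intro tangent_combination) auto
next
  fix W f assume W: "W \<subseteq> U" "smooth_fun_on M W f"
  then have oW: "open W" "W \<subseteq> points M" by (auto simp: smooth_fun_on_def)
  show "smooth_fun_on M W (\<lambda>p. \<Sum>i\<in>A. c i p * X i p f)"
    by (intro smooth_fun_on_sum[OF M oW] smooth_fun_on_mult[OF M]
        smooth_fun_on_subset[OF c oW(1) W(1)] vector_field_onD(4)[OF X W])
qed

lemma coord_vector_field:
  assumes M: "smooth_manifold M" and V: "(V, \<phi>) \<in> M"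
  shows "vector_field_on M V (coord_vector M V \<phi> w)"
  unfolding vector_field_on_def
proof (intro conjI ballI allI impI)
  note c = chart_facts[OF M V]
  show "open V" "V \<subseteq> points M" using c by auto
  show "coord_vector M V \<phi> w p \<in> tangent M p" if "p \<in> V" for p
    by (rule coord_vector_tangent[OF M V that])
  fix W f assume W: "W \<subseteq> V" "smooth_fun_on M W f"
  then have oW: "open W" by (auto simp: smooth_fun_on_def)
  let ?B = "\<phi> ` (V \<inter> W)"
  have "smooth_fun_on M (V \<inter> \<phi> -` ?B) (\<lambda>x. frechet_derivative (f \<circ> inv_into V \<phi>) (at (\<phi> x)) w)"
    by (rule smooth_fun_on_chartI[OF M V chart_image_open[OF M V oW]
        smooth_eucl_frechet[OF smooth_fun_on_chart[OF W(2) V]]])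
  moreover have "V \<inter> \<phi> -` ?B = W" using W(1) c(4) by (auto, metis)
  ultimately have "smooth_fun_on M W (\<lambda>x. frechet_derivative (f \<circ> inv_into V \<phi>) (at (\<phi> x)) w)"
    by simp
  then show "smooth_fun_on M W (\<lambda>p. coord_vector M V \<phi> w p f)"
    by (rule smooth_fun_on_cong[OF M]) (simp add: coord_vector_def smooth_fun_on_near[OF W(2)])
qed

text \<open>In \<open>X(Y(fg)) - Y(X(fg))\<close> the mixed first-order terms \<open>Xf Yg + Xg Yf\<close> cancel. Locality is needed
  because the product rule for \<open>Y\<close> holds only near \<open>p\<close>.\<close>

lemma bracket_tangent:
  assumes M: "smooth_manifold M" and X: "vector_field_on M U X" and Y: "vector_field_on M U Y"
    and p: "p \<in> U"
  shows "bracket M X Y p \<in> tangent M p"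
proof -
  note Xp = vector_field_onD(3)[OF X p] and Yp = vector_field_onD(3)[OF Y p]
  note sX = vector_field_smooth_near[OF X p] and sY = vector_field_smooth_near[OF Y p]
  have pM: "p \<in> points M" using vector_field_onD(2)[OF X] p by auto
  have loc: "Z p (\<lambda>q. Z' q h) = Z p k"
    if Z: "vector_field_on M U Z" "vector_field_on M U Z'" and W: "p \<in> W" "open W"
      and eq: "\<And>q. q \<in> W \<Longrightarrow> q \<in> U \<Longrightarrow> Z' q h = k q" and h: "smooth_near M p h" for Z Z' h k W
    by (rule tangent_local[OF M vector_field_onD(3)[OF Z(1) p]
          vector_field_smooth_near[OF Z(2) p h] open_Int[OF W(2) vector_field_onD(1)[OF Z(1)]]])
       (use W p eq in auto)
  have add: "Z p (\<lambda>q. Z' q (\<lambda>x. f x + g x)) = Z p (\<lambda>q. Z' q f) + Z p (\<lambda>q. Z' q g)"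
    if Z: "vector_field_on M U Z" "vector_field_on M U Z'"
      and s: "smooth_near M p f" "smooth_near M p g" for Z Z' f g
  proof -
    obtain W where W: "p \<in> W" "open W" "smooth_fun_on M W f" "smooth_fun_on M W g"
      by (rule smooth_near_both[OF s])
    have "Z p (\<lambda>q. Z' q (\<lambda>x. f x + g x)) = Z p (\<lambda>q. Z' q f + Z' q g)"
      by (rule loc[OF Z W(1,2) _ smooth_near_add[OF M s]])
         (rule tangent_add[OF vector_field_onD(3)[OF Z(2)] smooth_fun_on_near[OF W(3)]
            smooth_fun_on_near[OF W(4)]])
    then show ?thesis
      using tangent_add[OF vector_field_onD(3)[OF Z(1) p] vector_field_smooth_near[OF Z(2) p s(1)]
          vector_field_smooth_near[OF Z(2) p s(2)]] by simp
  qed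
  have mult: "Z p (\<lambda>q. Z' q (\<lambda>x. f x * g x)) =
      Z p f * Z' p g + f p * Z p (\<lambda>q. Z' q g) + Z p g * Z' p f + g p * Z p (\<lambda>q. Z' q f)"
    if Z: "vector_field_on M U Z" "vector_field_on M U Z'"
      and s: "smooth_near M p f" "smooth_near M p g" for Z Z' f g
  proof -
    obtain W where W: "p \<in> W" "open W" "smooth_fun_on M W f" "smooth_fun_on M W g"
      by (rule smooth_near_both[OF s])
    note Zp = vector_field_onD(3)[OF Z(1) p] and n = vector_field_smooth_near[OF Z(2) p]
    have "Z p (\<lambda>q. Z' q (\<lambda>x. f x * g x)) = Z p (\<lambda>q. f q * Z' q g + g q * Z' q f)"
      by (rule loc[OF Z W(1,2) _ smooth_near_mult[OF M s]])
         (rule tangent_mult[OF vector_field_onD(3)[OF Z(2)] smooth_fun_on_near[OF W(3)]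
            smooth_fun_on_near[OF W(4)]])
    then show ?thesis
      using tangent_add[OF Zp smooth_near_mult[OF M s(1) n[OF s(2)]] smooth_near_mult[OF M s(2) n[OF s(1)]]]
        tangent_mult[OF Zp s(1) n[OF s(2)]] tangent_mult[OF Zp s(2) n[OF s(1)]] by simp
  qed
  have cmult: "Z p (\<lambda>q. Z' q (\<lambda>x. c * f x)) = c * Z p (\<lambda>q. Z' q f)"
    if Z: "vector_field_on M U Z" "vector_field_on M U Z'" and s: "smooth_near M p f" for Z Z' f c
  proof -
    have "Z p (\<lambda>q. Z' q (\<lambda>x. c)) = Z p (\<lambda>q. 0)"
      by (rule loc[OF Z p vector_field_onD(1)[OF Z(1)] _ smooth_near_const[OF M pM]])
         (use tangent_const[OF M _ vector_field_onD(3)[OF Z(2)]] vector_field_onD(2)[OF Z(1)] in auto)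
    then show ?thesis
      using mult[OF Z smooth_near_const[OF M pM, of c] s]
      by (simp add: tangent_const[OF M pM vector_field_onD(3)[OF Z(1) p]]
          tangent_const[OF M pM vector_field_onD(3)[OF Z(2) p]])
  qed
  show ?thesis
    unfolding tangent_def bracket_def
    using add[OF X Y] add[OF Y X] mult[OF X Y] mult[OF Y X] cmult[OF X Y] cmult[OF Y X]
      smooth_near_add[OF M] smooth_near_mult[OF M] smooth_near_const[OF M pM]
    by (auto simp: algebra_simps)
qed

lemma one_form_add:
  "one_form M \<theta> \<Longrightarrow> p \<in> points M \<Longrightarrow> v \<in> tangent M p \<Longrightarrow> w \<in> tangent M p \<Longrightarrow>
    \<theta> p (vadd v w) = \<theta> p v + \<theta> p w"
  unfolding one_form_def by blast

lemma one_form_scale: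
  "one_form M \<theta> \<Longrightarrow> p \<in> points M \<Longrightarrow> v \<in> tangent M p \<Longrightarrow> \<theta> p (vscale c v) = c * \<theta> p v"
  unfolding one_form_def by blast

lemma one_form_smooth:
  "one_form M \<theta> \<Longrightarrow> vector_field_on M U X \<Longrightarrow> smooth_fun_on M U (\<lambda>p. \<theta> p (X p))"
  unfolding one_form_def by blast

lemma one_form_combination:
  assumes \<theta>: "one_form M \<theta>" and p: "p \<in> points M" and "finite A"
    and "\<And>i. i \<in> A \<Longrightarrow> v i \<in> tangent M p"
  shows "\<theta> p (\<lambda>f. \<Sum>i\<in>A. c i * v i f) = (\<Sum>i\<in>A. c i * \<theta> p (v i))"
  using assms(3,4)
proof (induction A rule: finite_induct)
  case empty
  show ?case using one_form_scale[OF \<theta> p tangent_zero, of 0] by (simp add: vscale_def)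
next
  case (insert i A)
  have "(\<lambda>f. \<Sum>i\<in>insert i A. c i * v i f) = vadd (vscale (c i) (v i)) (\<lambda>f. \<Sum>i\<in>A. c i * v i f)"
    using insert by (simp add: vadd_def vscale_def)
  moreover have "(\<lambda>f. \<Sum>i\<in>A. c i * v i f) \<in> tangent M p"
    by (rule tangent_combination) (use insert in auto)
  ultimately show ?case
    using insert by (simp add: one_form_add[OF \<theta> p] one_form_scale[OF \<theta> p] tangent_vscale)
qed

lemma one_form_coord:
  assumes "smooth_manifold M" "one_form M \<theta>" "(V, \<phi>) \<in> M" "p \<in> V" "v \<in> tangent M p"
  shows "\<theta> p v = (\<Sum>b\<in>Basis. \<theta> p (coord_vector M V \<phi> b p) * v (\<lambda>x. \<phi> x \<bullet> b))"
proof -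
  have "p \<in> points M" using assms(3,4) by (auto simp: points_def)
  from one_form_combination[OF assms(2) this finite_Basis coord_vector_tangent[OF assms(1,3,4)]]
  show ?thesis
    by (subst tangent_eq_coord[OF assms(1,3,4,5)]) (simp add: mult.commute)
qed

text \<open>This is \<open>d(\<Sum> c\<^sub>i dx\<^sub>i) = \<Sum> dc\<^sub>i \<and> dx\<^sub>i\<close>: the second derivatives \<open>X(Y x\<^sub>i) - Y(X x\<^sub>i)\<close> are absorbed by
  the bracket term. The \<open>x\<^sub>i\<close> need not be coordinates, so the formula also covers pulled back forms.\<close>

lemma ext_d1_local:
  assumes M: "smooth_manifold M" and X: "vector_field M X" and Y: "vector_field M Y"
    and W: "open W" "p \<in> W" "W \<subseteq> points M"
    and c: "\<And>i. i \<in> A \<Longrightarrow> smooth_fun_on M W (c i)"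
    and x: "\<And>i. i \<in> A \<Longrightarrow> smooth_fun_on M W (x i)"
    and \<theta>: "\<And>q v. q \<in> W \<Longrightarrow> v \<in> tangent M q \<Longrightarrow> \<theta> q v = (\<Sum>i\<in>A. c i q * v (x i))"
  shows "ext_d1 M \<theta> X Y p = (\<Sum>i\<in>A. X p (c i) * Y p (x i) - Y p (c i) * X p (x i))"
proof -
  have p: "p \<in> points M" using W by auto
  have *: "Z p (\<lambda>q. \<theta> q (Z' q)) = (\<Sum>i\<in>A. c i p * Z p (\<lambda>q. Z' q (x i)) + Z' p (x i) * Z p (c i))"
    if Z: "vector_field M Z" "vector_field M Z'" for Z Z'
  proof -
    note Zp = vector_field_onD(3)[OF Z(1) p]
    have s: "smooth_near M p (\<lambda>q. c i q * Z' q (x i))"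
      "smooth_near M p (c i)" "smooth_near M p (\<lambda>q. Z' q (x i))" if "i \<in> A" for i
      using smooth_fun_on_near[OF c[OF that] W(2)]
        smooth_fun_on_near[OF vector_field_onD(4)[OF Z(2) W(3) x[OF that]] W(2)]
      by (auto intro: smooth_near_mult[OF M])
    have "Z p (\<lambda>q. \<Sum>i\<in>A. c i q * Z' q (x i)) = Z p (\<lambda>q. \<theta> q (Z' q))"
      by (rule tangent_local[OF M Zp smooth_near_sum[OF M p s(1)] W(1,2)])
         (use \<theta> vector_field_onD(3)[OF Z(2)] W(3) in auto)
    moreover have "Z p (\<lambda>q. \<Sum>i\<in>A. c i q * Z' q (x i)) = (\<Sum>i\<in>A. Z p (\<lambda>q. c i q * Z' q (x i)))"
      by (rule tangent_sum[OF M p Zp s(1)])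
    moreover have "\<dots> = (\<Sum>i\<in>A. c i p * Z p (\<lambda>q. Z' q (x i)) + Z' p (x i) * Z p (c i))"
      by (rule sum.cong[OF refl]) (rule tangent_mult[OF Zp s(2,3)])
    ultimately show ?thesis by simp
  qed
  have "\<theta> p (bracket M X Y p) = (\<Sum>i\<in>A. c i p * (X p (\<lambda>q. Y q (x i)) - Y p (\<lambda>q. X q (x i))))"
    using \<theta>[OF W(2) bracket_tangent[OF M X Y p]] smooth_fun_on_near[OF x W(2)]
    by (simp add: bracket_def)
  then show ?thesis
    unfolding ext_d1_def *[OF X Y] *[OF Y X]
    by (simp add: sum_subtractf[symmetric] sum.distrib[symmetric] algebra_simps)
qed

lemma ext_d1_scale:
  assumes M: "smooth_manifold M" and X: "vector_field M X" and Y: "vector_field M Y"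
    and \<theta>: "one_form M \<theta>" and h: "smooth_fun_on M (points M) h" and p: "p \<in> points M"
  shows "ext_d1 M (\<lambda>p v. h p * \<theta> p v) X Y p =
    X p h * \<theta> p (Y p) - Y p h * \<theta> p (X p) + h p * ext_d1 M \<theta> X Y p"
  unfolding ext_d1_def
  using tangent_mult[OF vector_field_onD(3)[OF X p] smooth_fun_on_near[OF h p]
      smooth_fun_on_near[OF one_form_smooth[OF \<theta> Y] p]]
    tangent_mult[OF vector_field_onD(3)[OF Y p] smooth_fun_on_near[OF h p]
      smooth_fun_on_near[OF one_form_smooth[OF \<theta> X] p]]
  by (simp add: algebra_simps)

lemma one_form_scaled:
  assumes "smooth_manifold M" "one_form M \<theta>" "smooth_fun_on M (points M) h"
  shows "one_form M (\<lambda>p v. h p * \<theta> p v)"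
  unfolding one_form_def
proof (intro conjI ballI allI impI)
  fix U X assume X: "vector_field_on M U X"
  show "smooth_fun_on M U (\<lambda>p. h p * \<theta> p (X p))"
    by (intro smooth_fun_on_mult assms one_form_smooth[OF assms(2) X]
        smooth_fun_on_subset[OF assms(3)] vector_field_onD(1,2)[OF X])
qed (auto simp: one_form_add[OF assms(2)] one_form_scale[OF assms(2)] algebra_simps)

section \<open>Smooth maps and pullbacks\<close>

lemma smooth_map_fun:
  assumes M: "smooth_manifold M" and N: "smooth_manifold N" and F: "smooth_map M N F"
    and f: "smooth_fun_on N U f"
  shows "smooth_fun_on M (points M \<inter> F -` U) (\<lambda>x. f (F x))"
proof (rule smooth_fun_onI[OF M])
  have cF: "continuous_on (points M) F" and PF: "F ` points M \<subseteq> points N"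
    and sF: "\<And>V \<phi> W \<psi>. (V, \<phi>) \<in> M \<Longrightarrow> (W, \<psi>) \<in> N \<Longrightarrow>
      smooth_eucl (\<psi> \<circ> F \<circ> inv_into V \<phi>) (\<phi> ` (V \<inter> F -` W))"
    using F unfolding smooth_map_def by auto
  have oF: "open (points M \<inter> F -` T)" if "open T" for T
    by (rule continuous_open_preimage[OF cF points_open[OF M] that])
  have oU: "open U" using f by (simp add: smooth_fun_on_def)
  show "open (points M \<inter> F -` U)" by (rule oF[OF oU])
  fix p assume p: "p \<in> points M \<inter> F -` U"
  obtain V \<phi> where V: "(V, \<phi>) \<in> M" "p \<in> V" using p point_chart[of p M] by blast
  obtain W \<psi> where W: "(W, \<psi>) \<in> N" "F p \<in> W" using p PF point_chart[of "F p" N] by blast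
  note cV = chart_facts[OF M V(1)] and cW = chart_facts[OF N W(1)]
  let ?T = "points M \<inter> F -` (W \<inter> U)"
  have oT: "open ?T" using cW(1) oU by (intro oF) auto
  have oS: "open (\<phi> ` (V \<inter> ?T))" by (rule chart_image_open[OF M V(1) oT])
  have "smooth_eucl (\<lambda>x. (f \<circ> inv_into W \<psi>) ((\<psi> \<circ> F \<circ> inv_into V \<phi>) x)) (\<phi> ` (V \<inter> ?T))"
  proof (rule smooth_eucl_compose[OF oS chart_image_open[OF N W(1) oU] _ _ smooth_fun_on_chart[OF f W(1)]])
    show "smooth_eucl (\<psi> \<circ> F \<circ> inv_into V \<phi>) (\<phi> ` (V \<inter> ?T))"
      by (rule smooth_eucl_subset[OF sF[OF V(1) W(1)]]) auto
    show "(\<psi> \<circ> F \<circ> inv_into V \<phi>) ` (\<phi> ` (V \<inter> ?T)) \<subseteq> \<psi> ` (W \<inter> U)"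
      using cV(4) by auto
  qed
  then have "smooth_eucl ((\<lambda>x. f (F x)) \<circ> inv_into V \<phi>) (\<phi> ` (V \<inter> ?T))"
    by (rule smooth_eucl_cong[OF oS, rotated]) (use cV(4) cW(4) in auto)
  then show "\<exists>V \<phi> T. (V, \<phi>) \<in> M \<and> p \<in> V \<and> open T \<and> p \<in> T \<and>
      smooth_eucl ((\<lambda>x. f (F x)) \<circ> inv_into V \<phi>) (\<phi> ` (V \<inter> T))"
    using V oT p W(2) by blast
qed auto

lemma smooth_map_near:
  assumes "smooth_manifold M" "smooth_manifold N" "smooth_map M N F" "p \<in> points M"
    "smooth_near N (F p) f"
  shows "smooth_near M p (f \<circ> F)"
proof -
  obtain W where "smooth_fun_on N W f" "F p \<in> W" using assms(5) by (auto simp: smooth_near_def)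
  then show ?thesis
    using smooth_fun_on_near[OF smooth_map_fun[OF assms(1-3)], of W f p] assms(4) by (simp add: o_def)
qed

lemma push_tangent:
  assumes N: "smooth_manifold N"
    and F: "\<And>f. smooth_near N (F p) f \<Longrightarrow> smooth_near M p (f \<circ> F)" and v: "v \<in> tangent M p"
  shows "push N F p v \<in> tangent N (F p)"
proof -
  have "push N F p v (\<lambda>x. f x + g x) = push N F p v f + push N F p v g"
    if "smooth_near N (F p) f" "smooth_near N (F p) g" for f g
    using tangent_add[OF v F[OF that(1)] F[OF that(2)]] smooth_near_add[OF N that] that
    by (simp add: push_def o_def)
  moreover have "push N F p v (\<lambda>x. f x * g x) = f (F p) * push N F p v g + g (F p) * push N F p v f"
    if "smooth_near N (F p) f" "smooth_near N (F p) g" for f g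
    using tangent_mult[OF v F[OF that(1)] F[OF that(2)]] smooth_near_mult[OF N that] that
    by (simp add: push_def o_def)
  moreover have "push N F p v (\<lambda>x. c * f x) = c * push N F p v f"
    if "smooth_near N (F p) f" for c f
    using tangent_cmult[OF v F[OF that]] that
      smooth_near_mult[OF N smooth_near_const[OF N smooth_near_point[OF that]] that]
    by (simp add: push_def o_def)
  moreover have "push N F p v f = 0" if "\<not> smooth_near N (F p) f" for f
    using that by (simp add: push_def)
  ultimately show ?thesis unfolding tangent_def by blast
qed

context
  fixes M :: "('p::{t2_space, second_countable_topology}, 'e::euclidean_space) atlas"
    and N :: "('q::{t2_space, second_countable_topology}, 'f::euclidean_space) atlas"
    and F :: "'p \<Rightarrow> 'q"
  assumes M: "smooth_manifold M" and N: "smooth_manifold N" and F: "smooth_map M N F"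
begin

lemma pullback_point: "p \<in> points M \<Longrightarrow> F p \<in> points N"
  using F unfolding smooth_map_def by auto

lemma push_tangent_map: "p \<in> points M \<Longrightarrow> v \<in> tangent M p \<Longrightarrow> push N F p v \<in> tangent N (F p)"
  by (rule push_tangent[OF N smooth_map_near[OF M N F]])

text \<open>Near \<open>p\<close> the pulled back form is \<open>\<Sum> (c\<^sub>b \<circ> F) d(x\<^sub>b \<circ> F)\<close> for coordinates \<open>x\<^sub>b\<close> around \<open>F p\<close>.\<close>

lemma pullback_coord:
  assumes \<theta>: "one_form N \<theta>" and V: "(V, \<phi>) \<in> N"
  shows "smooth_fun_on M (points M \<inter> F -` V) (\<lambda>q. \<theta> (F q) (coord_vector N V \<phi> b (F q)))"
    and "smooth_fun_on M (points M \<inter> F -` V) (\<lambda>q. \<phi> (F q) \<bullet> b)"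
    and "q \<in> points M \<inter> F -` V \<Longrightarrow> v \<in> tangent M q \<Longrightarrow> pullback N F \<theta> q v =
      (\<Sum>b\<in>Basis. \<theta> (F q) (coord_vector N V \<phi> b (F q)) * v (\<lambda>q. \<phi> (F q) \<bullet> b))"
proof -
  show "smooth_fun_on M (points M \<inter> F -` V) (\<lambda>q. \<theta> (F q) (coord_vector N V \<phi> b (F q)))"
    by (rule smooth_map_fun[OF M N F one_form_smooth[OF \<theta> coord_vector_field[OF N V]]])
  show "smooth_fun_on M (points M \<inter> F -` V) (\<lambda>q. \<phi> (F q) \<bullet> b)"
    by (rule smooth_map_fun[OF M N F smooth_fun_on_coordinate[OF N V]])
  assume q: "q \<in> points M \<inter> F -` V" and v: "v \<in> tangent M q"
  then have "push N F q v (\<lambda>x. \<phi> x \<bullet> b) = v (\<lambda>q. \<phi> (F q) \<bullet> b)" for b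
    using smooth_fun_on_near[OF smooth_fun_on_coordinate[OF N V], of "F q"] by (simp add: push_def o_def)
  then show "pullback N F \<theta> q v =
      (\<Sum>b\<in>Basis. \<theta> (F q) (coord_vector N V \<phi> b (F q)) * v (\<lambda>q. \<phi> (F q) \<bullet> b))"
    using one_form_coord[OF N \<theta> V _ push_tangent_map] q v by (simp add: pullback_def)
qed

lemma one_form_pullback:
  assumes \<theta>: "one_form N \<theta>"
  shows "one_form M (pullback N F \<theta>)"
  unfolding one_form_def
proof (intro conjI ballI allI impI)
  fix p v w c assume p: "p \<in> points M" and v: "v \<in> tangent M p" and w: "w \<in> tangent M p"
  have "push N F p (vadd v w) = vadd (push N F p v) (push N F p w)"
    "push N F p (vscale c v) = vscale c (push N F p v)"
    by (auto simp: push_def vadd_def vscale_def)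
  then show "pullback N F \<theta> p (vadd v w) = pullback N F \<theta> p v + pullback N F \<theta> p w"
    "pullback N F \<theta> p (vscale c v) = c * pullback N F \<theta> p v"
    using one_form_add[OF \<theta> pullback_point[OF p] push_tangent_map[OF p v] push_tangent_map[OF p w]]
      one_form_scale[OF \<theta> pullback_point[OF p] push_tangent_map[OF p v]]
    by (auto simp: pullback_def)
next
  fix U X assume X: "vector_field_on M U X"
  note U = vector_field_onD(1,2)[OF X]
  show "smooth_fun_on M U (\<lambda>p. pullback N F \<theta> p (X p))"
  proof (rule smooth_fun_on_iff_near[OF M U(1)])
    fix p assume p: "p \<in> U"
    then obtain V \<phi> where V: "(V, \<phi>) \<in> N" "F p \<in> V"
      using point_chart[OF pullback_point] U(2) by blast
    note c = pullback_coord[OF \<theta> V(1)]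
    let ?W = "U \<inter> (points M \<inter> F -` V)"
    have W: "open ?W" "?W \<subseteq> points M" using U c(1) by (auto simp: smooth_fun_on_def)
    have "smooth_fun_on M ?W (\<lambda>q. \<Sum>b\<in>Basis. \<theta> (F q) (coord_vector N V \<phi> b (F q)) * X q (\<lambda>q. \<phi> (F q) \<bullet> b))"
      by (intro smooth_fun_on_sum[OF M W] smooth_fun_on_mult[OF M] vector_field_onD(4)[OF X]
          smooth_fun_on_subset[OF c(1) W(1)] smooth_fun_on_subset[OF c(2) W(1)]) auto
    then have "smooth_fun_on M ?W (\<lambda>p. pullback N F \<theta> p (X p))"
      by (rule smooth_fun_on_cong[OF M]) (use c(3) vector_field_onD(3)[OF X] in auto)
    then show "smooth_near M p (\<lambda>p. pullback N F \<theta> p (X p))"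
      by (rule smooth_fun_on_near) (use p V U in auto)
  qed
qed

text \<open>Naturality of \<open>d\<close>. Since both sides are computed from the coefficients \<open>c\<^sub>b\<close> near one point,
  it suffices that every tangent vector of \<open>N\<close> extends to a global vector field.\<close>

lemma ext_d1_pullback:
  assumes \<theta>: "one_form N \<theta>" and d: "d1_is N \<theta> \<Phi>"
    and ext: "\<And>q v. q \<in> points N \<Longrightarrow> v \<in> tangent N q \<Longrightarrow> \<exists>Z. vector_field N Z \<and> Z q = v"
    and X: "vector_field M X" and Y: "vector_field M Y" and p: "p \<in> points M"
  shows "ext_d1 M (pullback N F \<theta>) X Y p = \<Phi> (F p) (push N F p (X p)) (push N F p (Y p))"
proof -
  let ?u = "push N F p (X p)" and ?v = "push N F p (Y p)"
  note q = pullback_point[OF p]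
  obtain Z where Z: "vector_field N Z" "Z (F p) = ?u"
    using ext[OF q push_tangent_map[OF p vector_field_onD(3)[OF X p]]] by blast
  obtain Z' where Z': "vector_field N Z'" "Z' (F p) = ?v"
    using ext[OF q push_tangent_map[OF p vector_field_onD(3)[OF Y p]]] by blast
  obtain V \<phi> where V: "(V, \<phi>) \<in> N" "F p \<in> V" using point_chart[OF q] by blast
  note k = chart_facts[OF N V(1)] and c = pullback_coord[OF \<theta> V(1)]
  have W: "open (points M \<inter> F -` V)" using c(1) by (auto simp: smooth_fun_on_def)
  have pW: "p \<in> points M \<inter> F -` V" using p V by auto
  let ?c = "\<lambda>b q. \<theta> q (coord_vector N V \<phi> b q)" and ?x = "\<lambda>b q. \<phi> q \<bullet> b"
  have sc: "smooth_fun_on N V (?c b)" for b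
    by (rule one_form_smooth[OF \<theta> coord_vector_field[OF N V(1)]])
  have sx: "smooth_fun_on N V (?x b)" for b by (rule smooth_fun_on_coordinate[OF N V(1)])
  have "ext_d1 M (pullback N F \<theta>) X Y p =
      (\<Sum>b\<in>Basis. X p (\<lambda>q. ?c b (F q)) * Y p (\<lambda>q. ?x b (F q)) - Y p (\<lambda>q. ?c b (F q)) * X p (\<lambda>q. ?x b (F q)))"
    by (rule ext_d1_local[where W = "points M \<inter> F -` V" and c = "\<lambda>b q. ?c b (F q)"
            and x = "\<lambda>b q. ?x b (F q)", OF M X Y W pW]) (use c in auto)
  also have "\<dots> = (\<Sum>b\<in>Basis. Z (F p) (?c b) * Z' (F p) (?x b) - Z' (F p) (?c b) * Z (F p) (?x b))"
    using smooth_fun_on_near[OF sc V(2)] smooth_fun_on_near[OF sx V(2)]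
    by (simp add: Z Z' push_def o_def)
  also have "\<dots> = ext_d1 N \<theta> Z Z' (F p)"
    by (rule ext_d1_local[where c = ?c and x = ?x, OF N Z(1) Z'(1) k(1) V(2) k(5) sc sx, symmetric])
       (rule one_form_coord[OF N \<theta> V(1)])
  also have "\<dots> = \<Phi> (F p) ?u ?v" using d Z Z' q by (auto simp: d1_is_def)
  finally show ?thesis .
qed

end

section \<open>Products\<close>

lemma prod_atlas_iff:
  "(S, \<Phi>) \<in> prod_atlas M N \<longleftrightarrow>
    (\<exists>V \<phi> W \<psi>. S = V \<times> W \<and> \<Phi> = map_prod \<phi> \<psi> \<and> (V, \<phi>) \<in> M \<and> (W, \<psi>) \<in> N)"
  unfolding prod_atlas_def by auto

lemma points_prod: "points (prod_atlas M N) = points M \<times> points N"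
  unfolding points_def prod_atlas_def by fast

lemma inv_into_map_prod:
  assumes "smooth_manifold M" "smooth_manifold N" "(V, \<phi>) \<in> M" "(W, \<psi>) \<in> N" "z \<in> \<phi> ` V \<times> \<psi> ` W"
  shows "inv_into (V \<times> W) (map_prod \<phi> \<psi>) z = (inv_into V \<phi> (fst z), inv_into W \<psi> (snd z))"
proof -
  note V = chart_facts(4)[OF assms(1,3)] and W = chart_facts(4)[OF assms(2,4)]
  have "inj_on (map_prod \<phi> \<psi>) (V \<times> W)"
    using V W by (intro map_prod_inj_on inj_on_inverseI)
  from inv_into_f_f[OF this, of "(inv_into V \<phi> (fst z), inv_into W \<psi> (snd z))"] show ?thesis
    using assms(5) V W by auto
qed

lemma smooth_manifold_prod:
  assumes M: "smooth_manifold M" and N: "smooth_manifold N"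
  shows "smooth_manifold (prod_atlas M N)"
  unfolding smooth_manifold_def
proof (intro conjI ballI; clarify)
  fix S \<Phi> assume "(S, \<Phi>) \<in> prod_atlas M N"
  then obtain V \<phi> W \<psi> where S: "S = V \<times> W" "\<Phi> = map_prod \<phi> \<psi>" and V: "(V, \<phi>) \<in> M" and W: "(W, \<psi>) \<in> N"
    unfolding prod_atlas_iff by blast
  note cV = chart_facts[OF M V] and cW = chart_facts[OF N W]
  have im: "\<Phi> ` S = \<phi> ` V \<times> \<psi> ` W" unfolding S by (auto simp: map_prod_def)
  note inv = inv_into_map_prod[OF M N V W]
  show "open S \<and> open (\<Phi> ` S) \<and> homeomorphism S (\<Phi> ` S) \<Phi> (inv_into S \<Phi>)"
  proof (intro conjI)
    show "open S" "open (\<Phi> ` S)" unfolding im unfolding S using cV cW by (auto intro: open_Times)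
    have 1: "continuous_on S \<Phi>"
      unfolding S map_prod_def case_prod_unfold
      by (intro continuous_intros continuous_on_compose2[OF cV(6)] continuous_on_compose2[OF cW(6)]) auto
    have "continuous_on (\<phi> ` V) (inv_into V \<phi>)" "continuous_on (\<psi> ` W) (inv_into W \<psi>)"
      using cV(3) cW(3) by (auto simp: homeomorphism_def)
    then have "continuous_on (\<phi> ` V \<times> \<psi> ` W) (\<lambda>z. (inv_into V \<phi> (fst z), inv_into W \<psi> (snd z)))"
      by (intro continuous_intros; erule_tac continuous_on_compose2) (auto intro!: continuous_intros)
    then have 2: "continuous_on (\<Phi> ` S) (inv_into S \<Phi>)"
      unfolding im by (rule continuous_on_eq) (simp add: inv S)
    have 3: "inv_into S \<Phi> (\<Phi> z) = z" if "z \<in> S" for z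
      using that inv[of "\<Phi> z"] cV(4) cW(4) by (auto simp: S)
    then show "homeomorphism S (\<Phi> ` S) \<Phi> (inv_into S \<Phi>)"
      using 1 2 unfolding homeomorphism_def by (auto simp: image_image)
  qed
  fix S' \<Phi>' assume "(S', \<Phi>') \<in> prod_atlas M N"
  then obtain V' \<phi>' W' \<psi>' where S': "S' = V' \<times> W'" "\<Phi>' = map_prod \<phi>' \<psi>'"
    and V': "(V', \<phi>') \<in> M" and W': "(W', \<psi>') \<in> N"
    unfolding prod_atlas_iff by blast
  note cV' = chart_facts[OF M V'] and cW' = chart_facts[OF N W']
  let ?A = "\<phi> ` (V \<inter> V')" and ?B = "\<psi> ` (W \<inter> W')"
  have im2: "\<Phi> ` (S \<inter> S') = ?A \<times> ?B" unfolding S S' by (force simp: map_prod_def)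
  have o: "open ?A" "open ?B" "open (?A \<times> ?B)"
    using chart_image_open[OF M V cV'(1)] chart_image_open[OF N W cW'(1)] by (auto intro: open_Times)
  have "smooth_eucl (\<lambda>z. ((\<phi>' \<circ> inv_into V \<phi>) (fst z), (\<psi>' \<circ> inv_into W \<psi>) (snd z))) (?A \<times> ?B)"
    by (intro smooth_eucl_Pair o
        smooth_eucl_compose[OF o(3,1) _ smooth_eucl_linear[OF bounded_linear_fst] transition_smooth[OF M V V']]
        smooth_eucl_compose[OF o(3,2) _ smooth_eucl_linear[OF bounded_linear_snd] transition_smooth[OF N W W']])
       auto
  then show "smooth_eucl (\<Phi>' \<circ> inv_into S \<Phi>) (\<Phi> ` (S \<inter> S'))"
    unfolding im2 by (rule smooth_eucl_cong[OF o(3), rotated]) (use inv in \<open>auto simp: S S'\<close>)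
qed

lemma smooth_manifold_open_set:
  assumes "open (I::'a::euclidean_space set)"
  shows "smooth_manifold {(I, \<lambda>t. t)}"
proof -
  have inv: "inv_into I (\<lambda>t. t) t = t" if "t \<in> I" for t
    using inv_into_f_f[of "\<lambda>t. t" I t] that by (simp add: inj_on_def)
  then have "homeomorphism I I (\<lambda>t. t) (inv_into I (\<lambda>t. t))"
    unfolding homeomorphism_def
    by (auto intro!: continuous_intros continuous_on_eq[OF continuous_on_id] simp: image_iff)
  moreover have "smooth_eucl ((\<lambda>t. t) \<circ> inv_into I (\<lambda>t. t)) I"
    by (rule smooth_eucl_cong[OF assms _ smooth_eucl_linear[OF bounded_linear_ident]]) (simp add: inv)
  ultimately show ?thesis using assms by (simp add: smooth_manifold_def)
qed

lemma smooth_map_fst: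
  assumes M: "smooth_manifold M" and N: "smooth_manifold N"
  shows "smooth_map (prod_atlas M N) M fst"
  unfolding smooth_map_def
proof (intro conjI ballI; clarify?)
  show "continuous_on (points (prod_atlas M N)) fst" by (intro continuous_intros)
  fix S \<Phi> V' \<phi>' assume "(S, \<Phi>) \<in> prod_atlas M N" and V': "(V', \<phi>') \<in> M"
  then obtain V \<phi> W \<psi> where S: "S = V \<times> W" "\<Phi> = map_prod \<phi> \<psi>" and V: "(V, \<phi>) \<in> M" and W: "(W, \<psi>) \<in> N"
    unfolding prod_atlas_iff by blast
  note inv = inv_into_map_prod[OF M N V W]
  let ?A = "\<phi> ` (V \<inter> V')" and ?B = "\<psi> ` W"
  have im: "\<Phi> ` (S \<inter> fst -` V') = ?A \<times> ?B" unfolding S by (force simp: map_prod_def)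
  have o: "open ?A" "open (?A \<times> ?B)"
    using chart_image_open[OF M V chart_facts(1)[OF M V']] chart_facts(2)[OF N W] by (auto intro: open_Times)
  have "smooth_eucl (\<lambda>z. (\<phi>' \<circ> inv_into V \<phi>) (fst z)) (?A \<times> ?B)"
    by (rule smooth_eucl_compose[OF o(2,1) _ smooth_eucl_linear[OF bounded_linear_fst] transition_smooth[OF M V V']]) auto
  then show "smooth_eucl (\<phi>' \<circ> fst \<circ> inv_into S \<Phi>) (\<Phi> ` (S \<inter> fst -` V'))"
    unfolding im by (rule smooth_eucl_cong[OF o(2), rotated]) (use inv in \<open>auto simp: S\<close>)
qed (auto simp: points_prod)

lemma smooth_map_Pair:
  assumes M: "smooth_manifold M" and N: "smooth_manifold N" and a: "a \<in> points M"
  shows "smooth_map N (prod_atlas M N) (Pair a)"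
  unfolding smooth_map_def
proof (intro conjI ballI; clarify?)
  show "continuous_on (points N) (Pair a)" by (intro continuous_intros)
  fix W' \<psi>' S \<Phi> assume W': "(W', \<psi>') \<in> N" and "(S, \<Phi>) \<in> prod_atlas M N"
  then obtain V \<phi> W \<psi> where S: "S = V \<times> W" "\<Phi> = map_prod \<phi> \<psi>" and V: "(V, \<phi>) \<in> M" and W: "(W, \<psi>) \<in> N"
    unfolding prod_atlas_iff by blast
  show "smooth_eucl (\<Phi> \<circ> Pair a \<circ> inv_into W' \<psi>') (\<psi>' ` (W' \<inter> Pair a -` S))"
  proof (cases "a \<in> V")
    case True
    then have eq: "Pair a -` S = W" by (auto simp: S)
    have o: "open (\<psi>' ` (W' \<inter> W))" by (rule chart_image_open[OF N W' chart_facts(1)[OF N W]])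
    show ?thesis unfolding eq
      by (rule smooth_eucl_cong[OF o _ smooth_eucl_Pair[OF o smooth_eucl_const transition_smooth[OF N W' W]]])
         (simp add: S)
  next
    case False
    then have "Pair a -` S = {}" by (auto simp: S)
    then show ?thesis by (auto intro: smooth_eucl_local)
  qed
qed (use a in \<open>auto simp: points_prod\<close>)

section \<open>Dual frames\<close>

lemma smooth_det:
  fixes A :: "'p::{t2_space, second_countable_topology} \<Rightarrow> 'n::finite \<Rightarrow> 'n \<Rightarrow> real"
    and M :: "('p, 'e::euclidean_space) atlas"
  assumes M: "smooth_manifold M" and U: "open U" "U \<subseteq> points M"
    and A: "\<And>i j. smooth_fun_on M U (\<lambda>p. A p i j)"
  shows "smooth_fun_on M U (\<lambda>p. det (\<chi> i j. A p i j))"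
  unfolding det_def
  by (simp, intro smooth_fun_on_sum[OF M U] smooth_fun_on_mult[OF M] smooth_fun_on_prod[OF M U]
      smooth_fun_on_const[OF M U] A)

lemma one_forms_eqI:
  fixes \<theta> :: "'n \<Rightarrow> 'p::{t2_space, second_countable_topology} form1"
  assumes \<theta>: "\<And>i. one_form M (\<theta> i)" and p: "p \<in> points M"
    and sep: "\<And>v. v \<in> tangent M p \<Longrightarrow> (\<And>i. \<theta> i p v = 0) \<Longrightarrow> v = (\<lambda>f. 0)"
    and v: "v \<in> tangent M p" and w: "w \<in> tangent M p" and eq: "\<And>i. \<theta> i p v = \<theta> i p w"
  shows "v = w"
proof -
  have t: "vadd v (vscale (-1) w) \<in> tangent M p" by (intro tangent_vadd tangent_vscale v w)
  have "\<theta> i p (vadd v (vscale (-1) w)) = 0" for i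
    using one_form_add[OF \<theta> p v tangent_vscale[OF w]] one_form_scale[OF \<theta> p w] eq by simp
  from sep[OF t this] show ?thesis by (auto simp: vadd_def vscale_def fun_eq_iff)
qed

context
  fixes M :: "('p::{t2_space, second_countable_topology}, 'e::euclidean_space) atlas"
    and \<theta> :: "'n::finite \<Rightarrow> 'p form1" and \<beta> :: "'n \<Rightarrow> 'e"
  assumes M: "smooth_manifold M" and \<theta>: "\<And>i. one_form M (\<theta> i)"
    and \<beta>: "bij_betw \<beta> UNIV Basis"
begin

definition coframe_matrix :: "'p set \<Rightarrow> ('p \<Rightarrow> 'e) \<Rightarrow> 'p \<Rightarrow> real ^ 'n ^ 'n" where
  "coframe_matrix V \<phi> q = (\<chi> i j. \<theta> i q (coord_vector M V \<phi> (\<beta> j) q))"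

lemma coframe_matrix_apply:
  assumes V: "(V, \<phi>) \<in> M" "q \<in> V"
  shows "\<theta> i q (\<lambda>f. \<Sum>j\<in>UNIV. x $ j * coord_vector M V \<phi> (\<beta> j) q f) = (coframe_matrix V \<phi> q *v x) $ i"
proof -
  have "q \<in> points M" using V by (auto simp: points_def)
  from one_form_combination[OF \<theta> this finite_class.finite_UNIV coord_vector_tangent[OF M V]]
  show ?thesis by (simp add: coframe_matrix_def matrix_vector_mult_def mult.commute)
qed

lemma coord_combination:
  assumes V: "(V, \<phi>) \<in> M" "q \<in> V" and v: "v \<in> tangent M q"
  shows "v = (\<lambda>f. \<Sum>j\<in>UNIV. v (\<lambda>x. \<phi> x \<bullet> \<beta> j) * coord_vector M V \<phi> (\<beta> j) q f)"
  using tangent_eq_coord[OF M V v]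
  unfolding sum.reindex_bij_betw[OF \<beta>, of "\<lambda>b. v (\<lambda>x. \<phi> x \<bullet> b) * coord_vector M V \<phi> b q f" for f] .

lemma coord_combination_coordinate:
  assumes V: "(V, \<phi>) \<in> M" "q \<in> V"
  shows "(\<Sum>j\<in>UNIV. x j * coord_vector M V \<phi> (\<beta> j) q (\<lambda>y. \<phi> y \<bullet> \<beta> k)) = x k"
proof -
  have ib: "\<beta> j \<bullet> \<beta> k = (if j = k then 1 else 0)" for j k
  proof -
    have "\<beta> j \<in> Basis" "\<beta> k \<in> Basis" "\<beta> j = \<beta> k \<longleftrightarrow> j = k"
      using \<beta> by (auto simp: bij_betw_def inj_on_def)
    then show ?thesis by (simp add: inner_Basis)
  qed
  show ?thesis by (simp add: coord_vector_coordinate[OF M V] ib if_distrib cong: if_cong)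
qed

lemma coframe_matrix_det:
  assumes V: "(V, \<phi>) \<in> M" "q \<in> V"
    and sep: "\<And>v. v \<in> tangent M q \<Longrightarrow> (\<And>i. \<theta> i q v = 0) \<Longrightarrow> v = (\<lambda>f. 0)"
  shows "det (coframe_matrix V \<phi> q) \<noteq> 0"
proof -
  have "x = 0" if x: "coframe_matrix V \<phi> q *v x = 0" for x
  proof -
    have "(\<lambda>f. \<Sum>j\<in>UNIV. x $ j * coord_vector M V \<phi> (\<beta> j) q f) = (\<lambda>f. 0)"
      by (rule sep[OF tangent_combination[OF coord_vector_tangent[OF M V]]])
         (simp add: coframe_matrix_apply[OF V] x)
    then have "x $ k = 0" for k using coord_combination_coordinate[OF V, of "($) x" k] by metis
    then show ?thesis by (simp add: vec_eq_iff)
  qed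
  then show ?thesis
    using matrix_left_invertible_ker invertible_left_inverse invertible_det_nz by blast
qed

text \<open>The fields dual to separating forms are, by Cramer's rule, combinations of coordinate
  fields whose coefficients are quotients of determinants of smooth functions.\<close>

lemma dual_frame:
  assumes sep: "\<And>p v. p \<in> points M \<Longrightarrow> v \<in> tangent M p \<Longrightarrow> (\<And>i. \<theta> i p v = 0) \<Longrightarrow> v = (\<lambda>f. 0)"
  shows "\<exists>U. (\<forall>i. vector_field M (U i)) \<and>
    (\<forall>p\<in>points M. \<forall>i j. \<theta> i p (U j p) = (if i = j then 1 else 0)) \<and>
    (\<forall>p\<in>points M. \<forall>v\<in>tangent M p. v = (\<lambda>f. \<Sum>i\<in>UNIV. \<theta> i p v * U i p f))"
proof -
  let ?P = "\<lambda>k p v. v \<in> tangent M p \<and> (\<forall>i. \<theta> i p v = (if i = k then 1 else 0))"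
  define U where "U k p = (THE v. ?P k p v)" for k p
  have uniq: "v = w" if "p \<in> points M" "?P k p v" "?P k p w" for k p v w
    using that by (intro one_forms_eqI[OF \<theta> that(1) sep[OF that(1)]]) auto
  have loc: "\<exists>Y. vector_field_on M V Y \<and> (\<forall>q\<in>V. ?P k q (Y q))" if V: "(V, \<phi>) \<in> M" for V \<phi> k
  proof -
    note c = chart_facts[OF M V]
    let ?A = "coframe_matrix V \<phi>"
    define x :: "'p \<Rightarrow> real ^ 'n" where
      "x q = (\<chi> j. det (\<chi> i j'. if j' = j then axis k 1 $ i else ?A q $ i $ j') / det (?A q))" for q
    have det: "det (?A q) \<noteq> 0" if "q \<in> V" for q
      by (rule coframe_matrix_det[OF V that sep]) (use that c(5) in auto)
    have entry: "smooth_fun_on M V (\<lambda>q. ?A q $ i $ j)" for i j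
      unfolding coframe_matrix_def by (simp add: one_form_smooth[OF \<theta> coord_vector_field[OF M V]])
    have "smooth_fun_on M V (\<lambda>q. det (\<chi> i j. ?A q $ i $ j))"
      by (rule smooth_det[OF M c(1,5) entry])
    then have d: "smooth_fun_on M V (\<lambda>q. inverse (det (?A q)))"
      using det by (intro smooth_fun_on_inverse[OF M]) simp_all
    have "smooth_fun_on M V (\<lambda>q. det (\<chi> i j'. if j' = j then axis k 1 $ i else ?A q $ i $ j'))" for j
    proof (rule smooth_det[OF M c(1,5)])
      fix i j'
      show "smooth_fun_on M V (\<lambda>q. if j' = j then axis k 1 $ i else ?A q $ i $ j')"
        using entry smooth_fun_on_const[OF M c(1,5)] by (cases "j' = j") auto
    qed
    then have "smooth_fun_on M V (\<lambda>q. x q $ j)" for j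
      unfolding x_def using smooth_fun_on_mult[OF M _ d] by (simp add: divide_inverse)
    then have Y: "vector_field_on M V (\<lambda>q f. \<Sum>j\<in>UNIV. x q $ j * coord_vector M V \<phi> (\<beta> j) q f)"
      by (intro vector_field_on_combination[OF M c(1,5)] coord_vector_field[OF M V])
    have "?A q *v x q = axis k 1" if "q \<in> V" for q
      using cramer[OF det[OF that]] by (simp add: x_def)
    then have "?P k q (\<lambda>f. \<Sum>j\<in>UNIV. x q $ j * coord_vector M V \<phi> (\<beta> j) q f)" if "q \<in> V" for q
      using vector_field_onD(3)[OF Y that] that coframe_matrix_apply[OF V that] by (simp add: axis_def)
    then show ?thesis using Y by blast
  qed
  have U: "?P k p (U k p)" if p: "p \<in> points M" for k p
  proof -
    obtain V \<phi> where V: "(V, \<phi>) \<in> M" "p \<in> V" using point_chart[OF p] .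
    then obtain v where v: "?P k p v" using loc[OF V(1), of k] by blast
    show ?thesis unfolding U_def
    proof (rule theI[where P = "?P k p", OF v])
      fix w assume "?P k p w"
      then show "w = v" by (rule uniq[OF p _ v])
    qed
  qed
  have field: "vector_field M (U k)" for k
  proof (rule vector_field_on_local[OF M points_open[OF M] subset_refl])
    fix p assume p: "p \<in> points M"
    obtain V \<phi> where V: "(V, \<phi>) \<in> M" "p \<in> V" using point_chart[OF p] .
    obtain Y where Y: "vector_field_on M V Y" "\<forall>q\<in>V. ?P k q (Y q)" using loc[OF V(1), of k] by blast
    have "U k q = Y q" if "q \<in> V" "q \<in> points M" for q
      by (rule uniq[OF that(2) U[OF that(2)] bspec[OF Y(2) that(1)]])
    then show "\<exists>W Y. p \<in> W \<and> vector_field_on M W Y \<and> (\<forall>q\<in>W \<inter> points M. U k q = Y q)"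
      using V(2) Y(1) by blast
  qed
  have expansion: "v = (\<lambda>f. \<Sum>i\<in>UNIV. \<theta> i p v * U i p f)" if p: "p \<in> points M" and v: "v \<in> tangent M p" for p v
  proof (rule one_forms_eqI[OF \<theta> p sep[OF p] v])
    show "(\<lambda>f. \<Sum>i\<in>UNIV. \<theta> i p v * U i p f) \<in> tangent M p"
      using U[OF p] by (intro tangent_combination) auto
    show "\<theta> i p v = \<theta> i p (\<lambda>f. \<Sum>i\<in>UNIV. \<theta> i p v * U i p f)" for i
    proof -
      have "\<theta> i p (\<lambda>f. \<Sum>j\<in>UNIV. \<theta> j p v * U j p f) = (\<Sum>j\<in>UNIV. \<theta> j p v * \<theta> i p (U j p))"
        using U[OF p] by (intro one_form_combination[OF \<theta> p]) auto
      then show ?thesis using U[OF p] by (simp add: if_distrib cong: if_cong)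
    qed
  qed
  have dual: "\<theta> i p (U j p) = (if i = j then 1 else 0)" if "p \<in> points M" for p i j
    using U[OF that, of j] by blast
  show ?thesis
    by (intro exI[of _ U] conjI allI ballI) (rule field dual expansion; assumption)+
qed

text \<open>The coframe matrix is square, so independence of its rows makes it injective.\<close>

lemma independent_separating:
  assumes p: "p \<in> points M"
    and ind: "\<And>y::real ^ 'n. (\<And>v. v \<in> tangent M p \<Longrightarrow> (\<Sum>i\<in>UNIV. y $ i * \<theta> i p v) = 0) \<Longrightarrow> y = 0"
    and v: "v \<in> tangent M p" and zero: "\<And>i. \<theta> i p v = 0"
  shows "v = (\<lambda>f. 0)"
proof -
  obtain V \<phi> where V: "(V, \<phi>) \<in> M" "p \<in> V" using point_chart[OF p] .
  let ?A = "coframe_matrix V \<phi> p"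
  have "y = 0" if y: "transpose ?A *v y = 0" for y
  proof (rule ind)
    fix w assume w: "w \<in> tangent M p"
    define x where "x = (\<chi> j. w (\<lambda>x. \<phi> x \<bullet> \<beta> j))"
    have wx: "w = (\<lambda>f. \<Sum>j\<in>UNIV. x $ j * coord_vector M V \<phi> (\<beta> j) p f)"
      using coord_combination[OF V w] by (simp add: x_def)
    have "\<theta> i p w = (?A *v x) $ i" for i
      using arg_cong[OF wx] coframe_matrix_apply[OF V] by (rule trans)
    then have "(\<Sum>i\<in>UNIV. y $ i * \<theta> i p w) = y \<bullet> (?A *v x)" by (simp add: inner_vec_def)
    also have "\<dots> = (transpose ?A *v y) \<bullet> x" by (simp add: dot_lmul_matrix[symmetric] vector_transpose_matrix)
    finally show "(\<Sum>i\<in>UNIV. y $ i * \<theta> i p w) = 0" using y by simp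
  qed
  then have "invertible (transpose ?A)"
    using matrix_left_invertible_ker invertible_left_inverse by blast
  then have "invertible ?A" by (simp add: invertible_det_nz)
  then have inv: "\<And>x. ?A *v x = 0 \<Longrightarrow> x = 0"
    using matrix_left_invertible_ker invertible_left_inverse by blast
  define x where "x = (\<chi> j. v (\<lambda>x. \<phi> x \<bullet> \<beta> j))"
  have vx: "v = (\<lambda>f. \<Sum>j\<in>UNIV. x $ j * coord_vector M V \<phi> (\<beta> j) p f)"
    using coord_combination[OF V v] by (simp add: x_def)
  have "\<theta> i p v = (?A *v x) $ i" for i
    using arg_cong[OF vx] coframe_matrix_apply[OF V] by (rule trans)
  then have "(?A *v x) $ i = 0" for i using zero by simp
  then have "?A *v x = 0" by (simp add: vec_eq_iff)
  from inv[OF this] have "(\<lambda>f. \<Sum>j\<in>UNIV. x $ j * coord_vector M V \<phi> (\<beta> j) p f) = (\<lambda>f. 0)" by simp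
  with vx show ?thesis by (rule trans)
qed

end

lemma ex_basis_enumeration:
  assumes "CARD('n::finite) = DIM('e::euclidean_space)"
  shows "\<exists>\<beta>::'n \<Rightarrow> 'e. bij_betw \<beta> UNIV Basis"
  using assms by (intro finite_same_card_bij) auto

section \<open>Left-invariant forms on Lie groups\<close>

lemma left_translation_near:
  assumes G: "lie_group G A" and a: "a \<in> carrier G" and x: "x \<in> carrier G"
    and f: "smooth_near A (a \<otimes>\<^bsub>G\<^esub> x) f"
  shows "smooth_near A x (f \<circ> (\<lambda>y. a \<otimes>\<^bsub>G\<^esub> y))"
proof -
  have A: "smooth_manifold A" and P: "points A = carrier G"
    and m: "smooth_map (prod_atlas A A) A (\<lambda>(x, y). x \<otimes>\<^bsub>G\<^esub> y)"
    using G by (auto simp: lie_group_def)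
  note AA = smooth_manifold_prod[OF A A]
  have "smooth_near (prod_atlas A A) (a, x) (f \<circ> (\<lambda>(x, y). x \<otimes>\<^bsub>G\<^esub> y))"
    by (rule smooth_map_near[OF AA A m]) (use a x f P in \<open>auto simp: points_prod\<close>)
  then have "smooth_near A x ((f \<circ> (\<lambda>(x, y). x \<otimes>\<^bsub>G\<^esub> y)) \<circ> Pair a)"
    by (intro smooth_map_near[OF A AA smooth_map_Pair[OF A A]]) (use a x P in auto)
  then show ?thesis by (simp add: o_def)
qed

text \<open>A linear relation between left-invariant forms at one point holds everywhere, since
  left translations act transitively.\<close>

lemma left_invariant_relation:
  assumes G: "lie_group G A" and e: "\<And>i. i \<in> S \<Longrightarrow> left_invariant G A (e i)"
    and p: "p \<in> carrier G" and rel: "\<And>v. v \<in> tangent A p \<Longrightarrow> (\<Sum>i\<in>S. y i * e i p v) = 0"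
    and q: "q \<in> carrier G" and v: "v \<in> tangent A q"
  shows "(\<Sum>i\<in>S. y i * e i q v) = 0"
proof -
  interpret group G using G by (simp add: lie_group_def)
  have A: "smooth_manifold A" using G by (auto simp: lie_group_def)
  define g where "g = p \<otimes>\<^bsub>G\<^esub> inv\<^bsub>G\<^esub> q"
  have g: "g \<in> carrier G" "g \<otimes>\<^bsub>G\<^esub> q = p" using p q by (auto simp: g_def m_assoc)
  let ?v = "push A (\<lambda>x. g \<otimes>\<^bsub>G\<^esub> x) q v"
  have "?v \<in> tangent A (g \<otimes>\<^bsub>G\<^esub> q)"
    by (rule push_tangent[OF A left_translation_near[OF G g(1) q] v])
  then have t: "?v \<in> tangent A p" by (simp add: g(2))
  have "e i q v = e i p ?v" if "i \<in> S" for i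
  proof -
    have "pullback A (\<lambda>x. g \<otimes>\<^bsub>G\<^esub> x) (e i) q v = e i q v"
      using e[OF that] g(1) q v unfolding left_invariant_def by blast
    then show ?thesis by (simp add: pullback_def g(2))
  qed
  then have "(\<Sum>i\<in>S. y i * e i q v) = (\<Sum>i\<in>S. y i * e i p ?v)" by simp
  then show ?thesis using rel[OF t] by simp
qed

lemma left_invariant_basis_separating:
  fixes A :: "('g::{t2_space, second_countable_topology}, real ^ 3) atlas"
  assumes G: "lie_group G A" and e: "left_invariant_basis G A e1 e2 e3"
    and p: "p \<in> carrier G" and v: "v \<in> tangent A p"
    and zero: "e1 p v = 0" "e2 p v = 0" "e3 p v = 0"
  shows "v = (\<lambda>f. 0)"
proof -
  define \<theta> :: "3 \<Rightarrow> 'g form1" where "\<theta> i = (if i = 1 then e1 else if i = 2 then e2 else e3)" for i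
  have \<theta>s: "\<theta> 1 = e1" "\<theta> 2 = e2" "\<theta> 3 = e3" by (simp_all add: \<theta>_def)
  have A: "smooth_manifold A" and P: "points A = carrier G" using G by (auto simp: lie_group_def)
  have li: "left_invariant G A (\<theta> i)" for i
    using e unfolding left_invariant_basis_def \<theta>_def by auto
  have \<theta>: "one_form A (\<theta> i)" for i using li by (auto simp: left_invariant_def)
  obtain \<beta> :: "3 \<Rightarrow> real ^ 3" where \<beta>: "bij_betw \<beta> UNIV Basis"
    using ex_basis_enumeration[where 'n = 3 and 'e = "real ^ 3"] by auto
  show ?thesis
  proof (rule independent_separating[OF A \<theta> \<beta> _ _ v])
    show "p \<in> points A" using p P by simp
    show "\<theta> i p v = 0" for i using zero by (simp add: \<theta>_def)
    fix y :: "real ^ 3"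
    assume y: "\<And>v. v \<in> tangent A p \<Longrightarrow> (\<Sum>i\<in>UNIV. y $ i * \<theta> i p v) = 0"
    have "(\<Sum>i\<in>UNIV. y $ i * \<theta> i q w) = 0" if "q \<in> carrier G" "w \<in> tangent A q" for q w
      by (rule left_invariant_relation[OF G li p y that])
    then have "\<forall>q\<in>carrier G. \<forall>w\<in>tangent A q. y $ 1 * e1 q w + y $ 2 * e2 q w + y $ 3 * e3 q w = 0"
      by (simp add: sum_3 \<theta>s)
    then have "y $ 1 = 0 \<and> y $ 2 = 0 \<and> y $ 3 = 0" using e unfolding left_invariant_basis_def by blast
    then show "y = 0" by (simp add: vec_eq_iff forall_3)
  qed
qed

lemma left_invariant_vector_extension:
  fixes A :: "('g::{t2_space, second_countable_topology}, real ^ 3) atlas"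
  assumes G: "lie_group G A" and e: "left_invariant_basis G A e1 e2 e3"
    and p: "p \<in> points A" and v: "v \<in> tangent A p"
  shows "\<exists>Z. vector_field A Z \<and> Z p = v"
proof -
  define \<theta> :: "3 \<Rightarrow> 'g form1" where "\<theta> i = (if i = 1 then e1 else if i = 2 then e2 else e3)" for i
  have \<theta>s: "\<theta> 1 = e1" "\<theta> 2 = e2" "\<theta> 3 = e3" by (simp_all add: \<theta>_def)
  have A: "smooth_manifold A" and P: "points A = carrier G" using G by (auto simp: lie_group_def)
  have \<theta>: "one_form A (\<theta> i)" for i
    using e unfolding left_invariant_basis_def left_invariant_def \<theta>_def by auto
  obtain \<beta> :: "3 \<Rightarrow> real ^ 3" where \<beta>: "bij_betw \<beta> UNIV Basis"
    using ex_basis_enumeration[where 'n = 3 and 'e = "real ^ 3"] by auto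
  have sep: "w = (\<lambda>f. 0)" if "q \<in> points A" "w \<in> tangent A q" "\<And>i. \<theta> i q w = 0" for q w
    using that(3)[of 1] that(3)[of 2] that(3)[of 3] that(1) P
    by (intro left_invariant_basis_separating[OF G e _ that(2)]) (auto simp: \<theta>s)
  have "\<exists>U. (\<forall>i. vector_field A (U i)) \<and>
      (\<forall>q\<in>points A. \<forall>i j. \<theta> i q (U j q) = (if i = j then 1 else 0)) \<and>
      (\<forall>q\<in>points A. \<forall>w\<in>tangent A q. w = (\<lambda>f. \<Sum>i\<in>UNIV. \<theta> i q w * U i q f))"
    by (rule dual_frame[OF A \<theta> \<beta>]) (rule sep)
  then obtain U where U: "\<forall>i. vector_field A (U i)"
    "\<forall>q\<in>points A. \<forall>w\<in>tangent A q. w = (\<lambda>f. \<Sum>i\<in>UNIV. \<theta> i q w * U i q f)"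
    by blast
  have "vector_field A (\<lambda>q f. \<Sum>i\<in>UNIV. \<theta> i p v * U i q f)"
    by (intro vector_field_on_combination[OF A] points_open[OF A] subset_refl U(1)[rule_format]
        smooth_fun_on_const[OF A])
  then show ?thesis using U(2)[rule_format, OF p v, symmetric] by (intro exI[of _ "\<lambda>q f. \<Sum>i\<in>UNIV. \<theta> i p v * U i q f"]) simp
qed

section \<open>Exterior derivatives of 2-forms\<close>

lemma tangent_diff:
  assumes M: "smooth_manifold M" and v: "v \<in> tangent M p" and fg: "smooth_near M p f" "smooth_near M p g"
  shows "v (\<lambda>x. f x - g x) = v f - v g"
  using tangent_add[OF v fg(1) smooth_near_mult[OF M smooth_near_const[OF M smooth_near_point[OF fg(1)], of "-1"] fg(2)]]
    tangent_cmult[OF v fg(2), of "-1"] by simp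

lemma ext_d2_wedge:
  assumes M: "smooth_manifold M" and \<alpha>: "one_form M \<alpha>" and \<beta>: "one_form M \<beta>"
    and X: "vector_field M X" and Y: "vector_field M Y" and Z: "vector_field M Z"
    and p: "p \<in> points M"
  shows "ext_d2 M (wedge \<alpha> \<beta>) X Y Z p =
    ext_d1 M \<alpha> X Y p * \<beta> p (Z p) - ext_d1 M \<alpha> X Z p * \<beta> p (Y p) + ext_d1 M \<alpha> Y Z p * \<beta> p (X p)
    - (\<alpha> p (X p) * ext_d1 M \<beta> Y Z p - \<alpha> p (Y p) * ext_d1 M \<beta> X Z p + \<alpha> p (Z p) * ext_d1 M \<beta> X Y p)"
proof -
  have s: "smooth_near M p (\<lambda>q. \<theta> q (W q))" if "one_form M \<theta>" "vector_field M W" for \<theta> W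
    by (rule smooth_fun_on_near[OF one_form_smooth[OF that] p])
  have "W p (\<lambda>q. wedge \<alpha> \<beta> q (S q) (T q)) =
      \<alpha> p (S p) * W p (\<lambda>q. \<beta> q (T q)) + \<beta> p (T p) * W p (\<lambda>q. \<alpha> q (S q))
      - \<alpha> p (T p) * W p (\<lambda>q. \<beta> q (S q)) - \<beta> p (S p) * W p (\<lambda>q. \<alpha> q (T q))"
    if W: "vector_field M W" and S: "vector_field M S" and T: "vector_field M T" for W S T
  proof -
    note Wp = vector_field_onD(3)[OF W p]
    note sa = s[OF \<alpha> S] s[OF \<beta> T] and sb = s[OF \<alpha> T] s[OF \<beta> S]
    show ?thesis unfolding wedge_def
      by (simp add: tangent_diff[OF M Wp smooth_near_mult[OF M sa] smooth_near_mult[OF M sb]]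
          tangent_mult[OF Wp sa] tangent_mult[OF Wp sb])
  qed
  from this[OF X Y Z] this[OF Y X Z] this[OF Z X Y] show ?thesis
    unfolding ext_d2_def ext_d1_def by (simp add: wedge_def algebra_simps)
qed

lemma wedge_smooth:
  assumes M: "smooth_manifold M" and \<alpha>: "one_form M \<alpha>" and \<beta>: "one_form M \<beta>"
    and X: "vector_field_on M U X" and Y: "vector_field_on M U Y"
  shows "smooth_fun_on M U (\<lambda>q. wedge \<alpha> \<beta> q (X q) (Y q))"
  unfolding wedge_def
  by (intro smooth_fun_on_diff[OF M] smooth_fun_on_mult[OF M]
      one_form_smooth[OF \<alpha> X] one_form_smooth[OF \<beta> Y] one_form_smooth[OF \<alpha> Y] one_form_smooth[OF \<beta> X])

lemma ext_d2_combination: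
  assumes M: "smooth_manifold M"
    and F: "\<And>X Y. vector_field M X \<Longrightarrow> vector_field M Y \<Longrightarrow> smooth_fun_on M (points M) (\<lambda>q. F q (X q) (Y q))"
    and G: "\<And>X Y. vector_field M X \<Longrightarrow> vector_field M Y \<Longrightarrow> smooth_fun_on M (points M) (\<lambda>q. G q (X q) (Y q))"
    and X: "vector_field M X" and Y: "vector_field M Y" and Z: "vector_field M Z"
    and p: "p \<in> points M"
  shows "ext_d2 M (\<lambda>p u v. s * F p u v + r * G p u v) X Y Z p =
    s * ext_d2 M F X Y Z p + r * ext_d2 M G X Y Z p"
proof -
  have "W p (\<lambda>q. s * F q (S q) (T q) + r * G q (S q) (T q)) =
      s * W p (\<lambda>q. F q (S q) (T q)) + r * W p (\<lambda>q. G q (S q) (T q))"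
    if W: "vector_field M W" and S: "vector_field M S" and T: "vector_field M T" for W S T
  proof -
    note Wp = vector_field_onD(3)[OF W p]
    note sF = smooth_fun_on_near[OF F[OF S T] p] and sG = smooth_fun_on_near[OF G[OF S T] p]
    note c = smooth_near_const[OF M p]
    show ?thesis
      using tangent_add[OF Wp smooth_near_mult[OF M c sF] smooth_near_mult[OF M c sG]]
        tangent_cmult[OF Wp sF] tangent_cmult[OF Wp sG] by simp
  qed
  from this[OF X Y Z] this[OF Y X Z] this[OF Z X Y] show ?thesis
    unfolding ext_d2_def by (simp add: algebra_simps)
qed

text \<open>For a torsion-free metric connection \<open>D\<close> with \<open>DJ = 0\<close> the form \<open>F = g(J\<cdot>, \<cdot>)\<close> satisfies
  \<open>X(F(Y, Z)) = F(D\<^sub>X Y, Z) + F(Y, D\<^sub>X Z)\<close>; in \<open>dF\<close> the derivatives then combine to brackets and cancel.\<close>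

lemma parallel_imp_closed2:
  assumes M: "smooth_manifold M" and g: "smooth_sym_bilinear M g" and J: "endo_field M J"
    and D: "levi_civita_connection M g D" and par: "parallel_endo M D J"
    and F: "\<And>p u v. p \<in> points M \<Longrightarrow> u \<in> tangent M p \<Longrightarrow> v \<in> tangent M p \<Longrightarrow> F p u v = g p (J p u) v"
    and alt: "\<And>p u v. p \<in> points M \<Longrightarrow> u \<in> tangent M p \<Longrightarrow> v \<in> tangent M p \<Longrightarrow> F p u v = - F p v u"
  shows "closed2 M F"
  unfolding closed2_def
proof (intro allI impI ballI)
  fix X Y Z p
  assume X: "vector_field M X" and Y: "vector_field M Y" and Z: "vector_field M Z" and p: "p \<in> points M"
  note D' = D[unfolded levi_civita_connection_def affine_connection_def]
  note DF = D'[THEN conjunct1, THEN conjunct1, rule_format]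
    and torsion = D'[THEN conjunct2, THEN conjunct1, rule_format]
    and metric = D'[THEN conjunct2, THEN conjunct2, rule_format]
  note tp = vector_field_onD(3)[OF _ p]
  have deriv: "W p (\<lambda>q. F q (S q) (T q)) = F p (D W S p) (T p) + F p (S p) (D W T p)"
    if W: "vector_field M W" and S: "vector_field M S" and T: "vector_field M T" for W S T
  proof -
    have JS: "vector_field M (\<lambda>q. J q (S q))" using J S unfolding endo_field_def by blast
    have "smooth_fun_on M (points M) (\<lambda>q. g q (J q (S q)) (T q))"
      using g JS T unfolding smooth_sym_bilinear_def by blast
    then have "W p (\<lambda>q. g q (J q (S q)) (T q)) = W p (\<lambda>q. F q (S q) (T q))"
      using F vector_field_onD(3)[OF S] vector_field_onD(3)[OF T]
      by (intro tangent_local[OF M tp[OF W] smooth_fun_on_near[OF _ p] points_open[OF M] p]) auto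
    moreover have "W p (\<lambda>q. g q (J q (S q)) (T q)) =
        g p (D W (\<lambda>q. J q (S q)) p) (T p) + g p (J p (S p)) (D W T p)"
      by (rule metric[OF W JS T p])
    moreover have "D W (\<lambda>q. J q (S q)) p = J p (D W S p)"
      using par W S p unfolding parallel_endo_def by blast
    ultimately show ?thesis
      using F[OF p] tp[OF DF[OF W S]] tp[OF DF[OF W T]] tp[OF S] tp[OF T] by simp
  qed
  have tor: "F p (D S T p) v = F p (D T S p) v + F p (bracket M S T p) v"
    if S: "vector_field M S" and T: "vector_field M T" and v: "v \<in> tangent M p" for S T v
  proof -
    note b = bracket_tangent[OF M S T p] and d = tp[OF DF[OF T S]]
    have "D S T p = vadd (D T S p) (bracket M S T p)"
      by (rule torsion[OF S T p])
    moreover have "J p (D T S p) \<in> tangent M p" "J p (bracket M S T p) \<in> tangent M p"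
      "J p (vadd (D T S p) (bracket M S T p)) = vadd (J p (D T S p)) (J p (bracket M S T p))"
      using J p b d unfolding endo_field_def by blast+
    moreover have "g p (vadd u w) v = g p u v + g p w v" if "u \<in> tangent M p" "w \<in> tangent M p" for u w
      using g p that v unfolding smooth_sym_bilinear_def by blast
    ultimately show ?thesis
      using F[OF p _ v] b d tangent_vadd[OF d b] by simp
  qed
  show "ext_d2 M F X Y Z p = 0"
    unfolding ext_d2_def deriv[OF X Y Z] deriv[OF Y X Z] deriv[OF Z X Y]
    using tor[OF X Y tp[OF Z]] tor[OF X Z tp[OF Y]] tor[OF Y Z tp[OF X]]
      alt[OF p tp[OF Y] tp[OF DF[OF X Z]]] alt[OF p tp[OF X] tp[OF DF[OF Y Z]]]
      alt[OF p tp[OF X] tp[OF DF[OF Z Y]]]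
    by simp
qed

section \<open>Frames with diagonal structure functions\<close>

text \<open>The metric being diagonal in both signatures, the same coframe serves the Hermitian and the
  parahermitian structure; they differ in signs only. The structure equations are those of \<open>f\<^sub>1 e\<^sup>1, f\<^sub>2 e\<^sup>2, f\<^sub>3 e\<^sup>3, f dt\<close>, with \<open>h\<^sub>i = f\<^sub>i' / (f f\<^sub>i)\<close>.\<close>

locale diagonal_coframe =
  fixes M :: "('p::{t2_space, second_countable_topology}, 'e::euclidean_space) atlas"
    and a b c d :: "'p form1" and U1 U2 U3 U4 :: "'p vfield"
    and h1 h2 h3 A1 A2 A3 :: "'p \<Rightarrow> real"
  assumes M: "smooth_manifold M"
    and forms: "one_form M a" "one_form M b" "one_form M c" "one_form M d"
    and fields: "vector_field M U1" "vector_field M U2" "vector_field M U3" "vector_field M U4"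
    and dual: "\<And>p. p \<in> points M \<Longrightarrow> a p (U1 p) = 1" "\<And>p. p \<in> points M \<Longrightarrow> a p (U2 p) = 0"
      "\<And>p. p \<in> points M \<Longrightarrow> a p (U3 p) = 0" "\<And>p. p \<in> points M \<Longrightarrow> a p (U4 p) = 0"
      "\<And>p. p \<in> points M \<Longrightarrow> b p (U1 p) = 0" "\<And>p. p \<in> points M \<Longrightarrow> b p (U2 p) = 1"
      "\<And>p. p \<in> points M \<Longrightarrow> b p (U3 p) = 0" "\<And>p. p \<in> points M \<Longrightarrow> b p (U4 p) = 0"
      "\<And>p. p \<in> points M \<Longrightarrow> c p (U1 p) = 0" "\<And>p. p \<in> points M \<Longrightarrow> c p (U2 p) = 0"
      "\<And>p. p \<in> points M \<Longrightarrow> c p (U3 p) = 1" "\<And>p. p \<in> points M \<Longrightarrow> c p (U4 p) = 0"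
      "\<And>p. p \<in> points M \<Longrightarrow> d p (U1 p) = 0" "\<And>p. p \<in> points M \<Longrightarrow> d p (U2 p) = 0"
      "\<And>p. p \<in> points M \<Longrightarrow> d p (U3 p) = 0" "\<And>p. p \<in> points M \<Longrightarrow> d p (U4 p) = 1"
    and eqI: "\<And>p v w. p \<in> points M \<Longrightarrow> v \<in> tangent M p \<Longrightarrow> w \<in> tangent M p \<Longrightarrow>
      a p v = a p w \<Longrightarrow> b p v = b p w \<Longrightarrow> c p v = c p w \<Longrightarrow> d p v = d p w \<Longrightarrow> v = w"
    and h: "smooth_fun_on M (points M) h1" "smooth_fun_on M (points M) h2" "smooth_fun_on M (points M) h3"
    and da: "\<And>X Y p. vector_field M X \<Longrightarrow> vector_field M Y \<Longrightarrow> p \<in> points M \<Longrightarrow>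
      ext_d1 M a X Y p = - h1 p * wedge a d p (X p) (Y p) - A1 p * wedge b c p (X p) (Y p)"
    and db: "\<And>X Y p. vector_field M X \<Longrightarrow> vector_field M Y \<Longrightarrow> p \<in> points M \<Longrightarrow>
      ext_d1 M b X Y p = - h2 p * wedge b d p (X p) (Y p) - A2 p * wedge c a p (X p) (Y p)"
    and dc: "\<And>X Y p. vector_field M X \<Longrightarrow> vector_field M Y \<Longrightarrow> p \<in> points M \<Longrightarrow>
      ext_d1 M c X Y p = - h3 p * wedge c d p (X p) (Y p) - A3 p * wedge a b p (X p) (Y p)"
    and dd: "\<And>X Y p. vector_field M X \<Longrightarrow> vector_field M Y \<Longrightarrow> p \<in> points M \<Longrightarrow> ext_d1 M d X Y p = 0"
begin

definition comb :: "real \<Rightarrow> real \<Rightarrow> real \<Rightarrow> real \<Rightarrow> 'p vfield" where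
  "comb x y z w p = vadd (vadd (vscale x (U1 p)) (vscale y (U2 p))) (vadd (vscale z (U3 p)) (vscale w (U4 p)))"

lemma frame_tangent: "p \<in> points M \<Longrightarrow> U1 p \<in> tangent M p" "p \<in> points M \<Longrightarrow> U2 p \<in> tangent M p"
  "p \<in> points M \<Longrightarrow> U3 p \<in> tangent M p" "p \<in> points M \<Longrightarrow> U4 p \<in> tangent M p"
  using fields by (auto intro: vector_field_onD(3))

lemma comb_tangent: "p \<in> points M \<Longrightarrow> comb x y z w p \<in> tangent M p"
  unfolding comb_def by (intro tangent_vadd tangent_vscale frame_tangent)

lemma vadd_comb: "vadd (comb x y z w p) (comb x' y' z' w' p) = comb (x + x') (y + y') (z + z') (w + w') p"
  by (simp add: comb_def vadd_def vscale_def algebra_simps)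

lemma vscale_comb: "vscale s (comb x y z w p) = comb (s * x) (s * y) (s * z) (s * w) p"
  by (simp add: comb_def vadd_def vscale_def algebra_simps)

lemma form_comb:
  assumes "one_form M \<theta>" "p \<in> points M"
  shows "\<theta> p (comb x y z w p) = x * \<theta> p (U1 p) + y * \<theta> p (U2 p) + z * \<theta> p (U3 p) + w * \<theta> p (U4 p)"
  using frame_tangent[OF assms(2)]
  by (simp add: comb_def one_form_add[OF assms] one_form_scale[OF assms] tangent_vadd tangent_vscale)

lemma comb_simps:
  assumes "p \<in> points M"
  shows "a p (comb x y z w p) = x" "b p (comb x y z w p) = y"
    "c p (comb x y z w p) = z" "d p (comb x y z w p) = w"
  by (simp_all add: form_comb forms assms dual)

lemma form_simps:
  assumes "p \<in> points M" "u \<in> tangent M p"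
  shows "v \<in> tangent M p \<Longrightarrow> a p (vadd u v) = a p u + a p v" "a p (vscale s u) = s * a p u"
    "v \<in> tangent M p \<Longrightarrow> b p (vadd u v) = b p u + b p v" "b p (vscale s u) = s * b p u"
    "v \<in> tangent M p \<Longrightarrow> c p (vadd u v) = c p u + c p v" "c p (vscale s u) = s * c p u"
    "v \<in> tangent M p \<Longrightarrow> d p (vadd u v) = d p u + d p v" "d p (vscale s u) = s * d p u"
  using one_form_add[OF _ assms(1,2)] one_form_scale[OF _ assms] forms by auto

lemma comb_eta: "p \<in> points M \<Longrightarrow> v \<in> tangent M p \<Longrightarrow> comb (a p v) (b p v) (c p v) (d p v) p = v"
  by (rule eqI[of p]) (simp_all only: comb_tangent comb_simps)

lemma comb_field:
  assumes U: "open U" "U \<subseteq> points M"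
    and s: "smooth_fun_on M U x" "smooth_fun_on M U y" "smooth_fun_on M U z" "smooth_fun_on M U w"
  shows "vector_field_on M U (\<lambda>p. comb (x p) (y p) (z p) (w p) p)"
proof -
  define X where "X i = (if i = (0::nat) then U1 else if i = 1 then U2 else if i = 2 then U3 else U4)" for i
  define k where "k i = (if i = (0::nat) then x else if i = 1 then y else if i = 2 then z else w)" for i
  have "vector_field_on M U (\<lambda>p f. \<Sum>i\<in>{0,1,2,3}. k i p * X i p f)"
    by (rule vector_field_on_combination[OF M U])
       (auto simp: X_def k_def s intro: vector_field_on_subset[OF _ U] fields)
  then show ?thesis by (simp add: X_def k_def comb_def vadd_def vscale_def algebra_simps)
qed

lemma endo_comb:
  assumes l: "one_form M l1" "one_form M l2" "one_form M l3" "one_form M l4"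
  shows "endo_field M (\<lambda>p v. comb (l1 p v) (l2 p v) (l3 p v) (l4 p v) p)"
  unfolding endo_field_def
proof (intro conjI ballI allI impI)
  fix U X assume X: "vector_field_on M U X"
  show "vector_field_on M U (\<lambda>p. comb (l1 p (X p)) (l2 p (X p)) (l3 p (X p)) (l4 p (X p)) p)"
    by (intro comb_field vector_field_onD(1,2)[OF X] one_form_smooth[OF _ X] l)
next
  fix p v w k assume p: "p \<in> points M" "v \<in> tangent M p" "w \<in> tangent M p"
  show "comb (l1 p v) (l2 p v) (l3 p v) (l4 p v) p \<in> tangent M p" by (rule comb_tangent[OF p(1)])
  show "comb (l1 p (vadd v w)) (l2 p (vadd v w)) (l3 p (vadd v w)) (l4 p (vadd v w)) p =
    vadd (comb (l1 p v) (l2 p v) (l3 p v) (l4 p v) p) (comb (l1 p w) (l2 p w) (l3 p w) (l4 p w) p)"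
    by (simp only: one_form_add[OF l(1) p] one_form_add[OF l(2) p] one_form_add[OF l(3) p]
        one_form_add[OF l(4) p] vadd_comb)
  show "comb (l1 p (vscale k v)) (l2 p (vscale k v)) (l3 p (vscale k v)) (l4 p (vscale k v)) p =
    vscale k (comb (l1 p v) (l2 p v) (l3 p v) (l4 p v) p)"
    by (simp only: one_form_scale[OF l(1) p(1,2)] one_form_scale[OF l(2) p(1,2)]
        one_form_scale[OF l(3) p(1,2)] one_form_scale[OF l(4) p(1,2)] vscale_comb)
qed

lemma one_form_minus: "one_form M \<theta> \<Longrightarrow> one_form M (\<lambda>p v. - \<theta> p v)"
  using one_form_scaled[OF M _ smooth_fun_on_const[OF M points_open[OF M] subset_refl], of \<theta> "-1"] by simp

lemmas forms' = forms forms[THEN one_form_minus]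

lemma metric_smooth:
  shows "smooth_sym_bilinear M (\<lambda>p u v. a p u * a p v + b p u * b p v + s * (c p u * c p v + d p u * d p v))"
  unfolding smooth_sym_bilinear_def
proof (intro conjI ballI allI impI)
  fix U X Y assume X: "vector_field_on M U X" and Y: "vector_field_on M U Y"
  show "smooth_fun_on M U (\<lambda>p. a p (X p) * a p (Y p) + b p (X p) * b p (Y p) +
      s * (c p (X p) * c p (Y p) + d p (X p) * d p (Y p)))"
    by (intro smooth_fun_on_add[OF M] smooth_fun_on_cmult[OF M] smooth_fun_on_mult[OF M]
        one_form_smooth[OF _ X] one_form_smooth[OF _ Y] forms)
qed (auto simp: form_simps algebra_simps)

section \<open>The almost hyper-Hermitian and hyper-parahermitian structures\<close>

definition gH :: "'p form2" where
  "gH p u v = a p u * a p v + b p u * b p v + c p u * c p v + d p u * d p v"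

definition gS :: "'p form2" where
  "gS p u v = a p u * a p v + b p u * b p v - c p u * c p v - d p u * d p v"

text \<open>The tensors are read off from the fundamental forms: \<open>J1, J2, J3\<close> from \<open>F\<^sub>i = gH(J\<^sub>i\<cdot>, \<cdot>)\<close>, and \<open>P1, P2\<close> from
  \<open>\<Omega>\<^sub>2 = gS(\<cdot>, P1\<cdot>)\<close> and \<open>\<Omega>\<^sub>3 = gS(\<cdot>, P2\<cdot>)\<close>. The \<open>J\<close> of \<open>\<Omega>\<^sub>1 = gS(\<cdot>, J\<cdot>)\<close> is \<open>J1\<close> again, because
  the sign from exchanging the arguments appears on \<open>a \<and> b\<close>, and on \<open>c \<and> d\<close> cancels the sign of the metric.\<close>

definition J1 :: "'p endo" where "J1 p v = comb (- b p v) (a p v) (- d p v) (c p v) p"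
definition J2 :: "'p endo" where "J2 p v = comb (- c p v) (d p v) (a p v) (- b p v) p"
definition J3 :: "'p endo" where "J3 p v = comb (- d p v) (- c p v) (b p v) (a p v) p"
definition P1 :: "'p endo" where "P1 p v = comb (c p v) (- d p v) (a p v) (- b p v) p"
definition P2 :: "'p endo" where "P2 p v = comb (d p v) (c p v) (b p v) (a p v) p"

lemmas J_defs = J1_def J2_def J3_def P1_def P2_def

lemma J_endo: "endo_field M J1" "endo_field M J2" "endo_field M J3" "endo_field M P1" "endo_field M P2"
  unfolding J_defs by (intro endo_comb forms')+

lemma gH_metric: "riemannian_metric M gH"
proof -
  have "smooth_sym_bilinear M gH" using metric_smooth[of 1] by (simp add: gH_def[abs_def] algebra_simps)
  moreover have "gH p v v > 0" if p: "p \<in> points M" "v \<in> tangent M p" "v \<noteq> (\<lambda>f. 0)" for p v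
  proof (rule ccontr)
    assume "\<not> gH p v v > 0"
    then have le: "a p v ^ 2 + b p v ^ 2 + c p v ^ 2 + d p v ^ 2 \<le> 0"
      by (simp add: gH_def power2_eq_square)
    have "(a p v)^2 = 0" "(b p v)^2 = 0" "(c p v)^2 = 0" "(d p v)^2 = 0"
      using le zero_le_power2[of "a p v"] zero_le_power2[of "b p v"] zero_le_power2[of "c p v"]
        zero_le_power2[of "d p v"] by linarith+
    then have "v = comb 0 0 0 0 p" using comb_eta[OF p(1,2)] by simp
    then show False using p(3) by (simp add: comb_def vadd_def vscale_def)
  qed
  ultimately show ?thesis by (auto simp: riemannian_metric_def)
qed

lemma gS_metric: "neutral_metric4 M gS"
proof -
  have "smooth_sym_bilinear M gS" using metric_smooth[of "-1"] by (simp add: gS_def[abs_def] algebra_simps)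
  moreover have "\<forall>v\<in>tangent M p. \<exists>k l m n. v = vadd (vscale k (U1 p)) (vadd (vscale l (U2 p))
      (vadd (vscale m (U3 p)) (vscale n (U4 p))))" if p: "p \<in> points M" for p
  proof
    fix v assume v: "v \<in> tangent M p"
    have "v = vadd (vscale (a p v) (U1 p)) (vadd (vscale (b p v) (U2 p))
      (vadd (vscale (c p v) (U3 p)) (vscale (d p v) (U4 p))))"
      by (subst (1) comb_eta[OF p v, symmetric]) (simp add: comb_def vadd_def add.assoc)
    then show "\<exists>k l m n. v = vadd (vscale k (U1 p)) (vadd (vscale l (U2 p))
      (vadd (vscale m (U3 p)) (vscale n (U4 p))))" by (intro exI)
  qed
  ultimately show ?thesis
    unfolding neutral_metric4_def
    by (intro conjI ballI; (rule_tac x = "U1 p" in bexI, rule_tac x = "U2 p" in bexI,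
        rule_tac x = "U3 p" in bexI, rule_tac x = "U4 p" in bexI)?)
       (simp_all add: frame_tangent gS_def dual)
qed

lemma hyper_hermitian: "almost_hyper_hermitian M gH J1 J2 J3"
  unfolding almost_hyper_hermitian_def
proof (intro conjI ballI gH_metric J_endo)
  fix p u v assume p: "p \<in> points M" and u: "u \<in> tangent M p" and v: "v \<in> tangent M p"
  note [simp] = comb_simps[OF p] comb_tangent[OF p] form_simps[OF p comb_tangent[OF p]] form_simps[OF p v] v
    tangent_vscale
  show "J1 p (J1 p v) = vscale (-1) v" "J2 p (J2 p v) = vscale (-1) v" "J3 p (J3 p v) = vscale (-1) v"
    "J1 p (J2 p v) = J3 p v" "J2 p (J1 p v) = vscale (-1) (J3 p v)"
    by (rule eqI[OF p]; simp add: J_defs)+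
  show "gH p (J1 p u) (J1 p v) = gH p u v" "gH p (J2 p u) (J2 p v) = gH p u v" "gH p (J3 p u) (J3 p v) = gH p u v"
    by (simp_all add: gH_def J_defs)
qed

lemma hyper_parahermitian: "almost_hyper_parahermitian M gS J1 P1 P2"
  unfolding almost_hyper_parahermitian_def
proof (intro conjI ballI gS_metric J_endo)
  fix p u v assume p: "p \<in> points M" and u: "u \<in> tangent M p" and v: "v \<in> tangent M p"
  note [simp] = comb_simps[OF p] comb_tangent[OF p] form_simps[OF p comb_tangent[OF p]] form_simps[OF p v] v
    tangent_vscale
  show "J1 p (J1 p v) = vscale (-1) v" "P1 p (P1 p v) = v" "P2 p (P2 p v) = v"
    "J1 p (P1 p v) = P2 p v" "P1 p (J1 p v) = vscale (-1) (P2 p v)"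
    by (rule eqI[OF p]; simp add: J_defs)+
  show "gS p (J1 p u) (J1 p v) = gS p u v" "gS p (P1 p u) (P1 p v) = - gS p u v" "gS p (P2 p u) (P2 p v) = - gS p u v"
    by (simp_all add: gS_def J_defs)
qed

section \<open>Closedness of the fundamental forms\<close>

definition vol3 :: "'p form1 \<Rightarrow> 'p form1 \<Rightarrow> 'p form1 \<Rightarrow> 'p \<Rightarrow> 'p tvec \<Rightarrow> 'p tvec \<Rightarrow> 'p tvec \<Rightarrow> real" where
  "vol3 \<alpha> \<beta> \<gamma> p u v w = \<alpha> p u * wedge \<beta> \<gamma> p v w - \<alpha> p v * wedge \<beta> \<gamma> p u w + \<alpha> p w * wedge \<beta> \<gamma> p u v"

lemma closed2_iff:
  assumes F: "\<And>X Y Z p. vector_field M X \<Longrightarrow> vector_field M Y \<Longrightarrow> vector_field M Z \<Longrightarrow> p \<in> points M \<Longrightarrow>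
      ext_d2 M F X Y Z p = k p * vol3 \<alpha> \<beta> \<gamma> p (X p) (Y p) (Z p)"
    and W: "vector_field M X" "vector_field M Y" "vector_field M Z"
      "\<And>p. p \<in> points M \<Longrightarrow> vol3 \<alpha> \<beta> \<gamma> p (X p) (Y p) (Z p) = 1"
  shows "closed2 M F \<longleftrightarrow> (\<forall>p\<in>points M. k p = 0)"
proof
  assume "closed2 M F"
  then show "\<forall>p\<in>points M. k p = 0" using F[OF W(1-3)] W unfolding closed2_def by (metis mult.right_neutral)
qed (simp add: closed2_def F)

lemma wedge2_ext_d2:
  assumes "one_form M \<alpha>" "one_form M \<beta>" "one_form M \<gamma>" "one_form M \<delta>"
    and X: "vector_field M X" and Y: "vector_field M Y" and Z: "vector_field M Z" and p: "p \<in> points M"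
  shows "ext_d2 M (\<lambda>p u v. s * wedge \<alpha> \<beta> p u v + r * wedge \<gamma> \<delta> p u v) X Y Z p =
    s * ext_d2 M (wedge \<alpha> \<beta>) X Y Z p + r * ext_d2 M (wedge \<gamma> \<delta>) X Y Z p"
  by (rule ext_d2_combination[OF M wedge_smooth[OF M assms(1,2)] wedge_smooth[OF M assms(3,4)] X Y Z p])

lemma closed_ab_cd:
  "closed2 M (\<lambda>p u v. s * wedge a b p u v + wedge c d p u v) \<longleftrightarrow>
    (\<forall>p\<in>points M. s * (h1 p + h2 p) = A3 p)"
proof -
  have "closed2 M (\<lambda>p u v. s * wedge a b p u v + 1 * wedge c d p u v) \<longleftrightarrow>
      (\<forall>p\<in>points M. s * (h1 p + h2 p) - A3 p = 0)"
  proof (rule closed2_iff[where \<alpha> = a and \<beta> = b and \<gamma> = d and X = U1 and Y = U2 and Z = U4])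
    fix X Y Z p
    assume X: "vector_field M X" and Y: "vector_field M Y" and Z: "vector_field M Z" and p: "p \<in> points M"
    show "ext_d2 M (\<lambda>p u v. s * wedge a b p u v + 1 * wedge c d p u v) X Y Z p =
        (s * (h1 p + h2 p) - A3 p) * vol3 a b d p (X p) (Y p) (Z p)"
      unfolding wedge2_ext_d2[OF forms X Y Z p]
      unfolding ext_d2_wedge[OF M forms(1,2) X Y Z p]
        ext_d2_wedge[OF M forms(3,4) X Y Z p]
      unfolding da[OF X Y p] da[OF X Z p] da[OF Y Z p]
        db[OF X Y p] db[OF X Z p] db[OF Y Z p] dc[OF X Y p] dc[OF X Z p] dc[OF Y Z p]
        dd[OF X Y p] dd[OF X Z p] dd[OF Y Z p]
      by (simp add: vol3_def wedge_def algebra_simps)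
  qed (use fields dual in \<open>auto simp: vol3_def wedge_def\<close>)
  then show ?thesis by simp
qed

lemma closed_ac_bd:
  "closed2 M (\<lambda>p u v. wedge a c p u v - wedge b d p u v) \<longleftrightarrow> (\<forall>p\<in>points M. h1 p + h3 p = A2 p)"
proof -
  have "closed2 M (\<lambda>p u v. 1 * wedge a c p u v + (-1) * wedge b d p u v) \<longleftrightarrow>
      (\<forall>p\<in>points M. h1 p + h3 p - A2 p = 0)"
  proof (rule closed2_iff[where \<alpha> = a and \<beta> = c and \<gamma> = d and X = U1 and Y = U3 and Z = U4])
    fix X Y Z p
    assume X: "vector_field M X" and Y: "vector_field M Y" and Z: "vector_field M Z" and p: "p \<in> points M"
    show "ext_d2 M (\<lambda>p u v. 1 * wedge a c p u v + (-1) * wedge b d p u v) X Y Z p =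
        (h1 p + h3 p - A2 p) * vol3 a c d p (X p) (Y p) (Z p)"
      unfolding wedge2_ext_d2[OF forms(1,3,2,4) X Y Z p]
      unfolding ext_d2_wedge[OF M forms(1,3) X Y Z p]
        ext_d2_wedge[OF M forms(2,4) X Y Z p]
      unfolding da[OF X Y p] da[OF X Z p] da[OF Y Z p]
        db[OF X Y p] db[OF X Z p] db[OF Y Z p] dc[OF X Y p] dc[OF X Z p] dc[OF Y Z p]
        dd[OF X Y p] dd[OF X Z p] dd[OF Y Z p]
      by (simp add: vol3_def wedge_def algebra_simps)
  qed (use fields dual in \<open>auto simp: vol3_def wedge_def\<close>)
  then show ?thesis by simp
qed

lemma closed_bc_ad:
  "closed2 M (\<lambda>p u v. wedge b c p u v + wedge a d p u v) \<longleftrightarrow> (\<forall>p\<in>points M. h2 p + h3 p = A1 p)"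
proof -
  have "closed2 M (\<lambda>p u v. 1 * wedge b c p u v + 1 * wedge a d p u v) \<longleftrightarrow>
      (\<forall>p\<in>points M. h2 p + h3 p - A1 p = 0)"
  proof (rule closed2_iff[where \<alpha> = b and \<beta> = c and \<gamma> = d and X = U2 and Y = U3 and Z = U4])
    fix X Y Z p
    assume X: "vector_field M X" and Y: "vector_field M Y" and Z: "vector_field M Z" and p: "p \<in> points M"
    show "ext_d2 M (\<lambda>p u v. 1 * wedge b c p u v + 1 * wedge a d p u v) X Y Z p =
        (h2 p + h3 p - A1 p) * vol3 b c d p (X p) (Y p) (Z p)"
      unfolding wedge2_ext_d2[OF forms(2,3,1,4) X Y Z p]
      unfolding ext_d2_wedge[OF M forms(2,3) X Y Z p]
        ext_d2_wedge[OF M forms(1,4) X Y Z p]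
      unfolding da[OF X Y p] da[OF X Z p] da[OF Y Z p]
        db[OF X Y p] db[OF X Z p] db[OF Y Z p] dc[OF X Y p] dc[OF X Z p] dc[OF Y Z p]
        dd[OF X Y p] dd[OF X Z p] dd[OF Y Z p]
      by (simp add: vol3_def wedge_def algebra_simps)
  qed (use fields dual in \<open>auto simp: vol3_def wedge_def\<close>)
  then show ?thesis by simp
qed

theorem hyper_symplectic_iff:
  "hyper_symplectic M gS (\<lambda>p u v. - wedge a b p u v + wedge c d p u v)
      (\<lambda>p u v. wedge a c p u v - wedge b d p u v) (\<lambda>p u v. wedge b c p u v + wedge a d p u v) \<longleftrightarrow>
    (\<forall>p\<in>points M. h1 p + h2 p = - A3 p \<and> h1 p + h3 p = A2 p \<and> h2 p + h3 p = A1 p)"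
proof -
  have alg: "\<forall>p\<in>points M. \<forall>u\<in>tangent M p. \<forall>v\<in>tangent M p.
      - wedge a b p u v + wedge c d p u v = gS p u (J1 p v) \<and>
      wedge a c p u v - wedge b d p u v = gS p u (P1 p v) \<and>
      wedge b c p u v + wedge a d p u v = gS p u (P2 p v)"
    by (auto simp: wedge_def gS_def J_defs comb_simps algebra_simps)
  have "(-1) * (h1 p + h2 p) = A3 p \<longleftrightarrow> h1 p + h2 p = - A3 p" for p by auto
  then show ?thesis
    unfolding hyper_symplectic_def
    using alg hyper_parahermitian closed_ab_cd[of "-1"] closed_ac_bd closed_bc_ad by auto
qed

section \<open>The Levi-Civita connection\<close>

text \<open>In the frame, \<open>D\<^sub>X = X + h\<^sub>1 a(X) K\<^sub>1 + h\<^sub>2 b(X) K\<^sub>2 + h\<^sub>3 c(X) K\<^sub>3\<close>, where \<open>K\<^sub>1\<close> maps \<open>U4\<close> to \<open>U1\<close>, \<open>U1\<close> to \<open>-U4\<close>, \<open>U2\<close> to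
  \<open>U3\<close> and \<open>U3\<close> to \<open>-U2\<close>, and \<open>K\<^sub>2\<close>, \<open>K\<^sub>3\<close> arise from it by cyclic permutation of \<open>U1, U2, U3\<close>. These are the
  quaternionic units commuting with \<open>J1, J2, J3\<close>. The coefficients \<open>h\<^sub>i\<close> make the torsion vanish on
  \<open>U4, U\<^sub>i\<close>, because \<open>[U4, U\<^sub>i] = - h\<^sub>i U\<^sub>i\<close>.\<close>

definition conn :: "'p vfield \<Rightarrow> 'p vfield \<Rightarrow> 'p vfield" where
  "conn X Y p = comb
     (X p (\<lambda>q. a q (Y q)) + h1 p * a p (X p) * d p (Y p) + h2 p * b p (X p) * c p (Y p) - h3 p * c p (X p) * b p (Y p))
     (X p (\<lambda>q. b q (Y q)) - h1 p * a p (X p) * c p (Y p) + h2 p * b p (X p) * d p (Y p) + h3 p * c p (X p) * a p (Y p))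
     (X p (\<lambda>q. c q (Y q)) + h1 p * a p (X p) * b p (Y p) - h2 p * b p (X p) * a p (Y p) + h3 p * c p (X p) * d p (Y p))
     (X p (\<lambda>q. d q (Y q)) - h1 p * a p (X p) * a p (Y p) - h2 p * b p (X p) * b p (Y p) - h3 p * c p (X p) * c p (Y p)) p"

lemma field_form_near:
  assumes "one_form M \<theta>" "vector_field M Y" "p \<in> points M"
  shows "smooth_near M p (\<lambda>q. \<theta> q (Y q))"
  by (rule smooth_fun_on_near[OF one_form_smooth[OF assms(1,2)] assms(3)])

lemma field_cong:
  assumes "v \<in> tangent M p" "smooth_near M p f" "\<And>q. q \<in> points M \<Longrightarrow> f q = g q"
  shows "v g = v f"
  by (rule tangent_local[OF M assms(1,2) points_open[OF M] smooth_near_point[OF assms(2)] assms(3), symmetric])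

lemma field_form_add:
  assumes \<theta>: "one_form M \<theta>" and Y: "vector_field M Y" and Z: "vector_field M Z" and p: "p \<in> points M"
    and v: "v \<in> tangent M p"
  shows "v (\<lambda>q. \<theta> q (vadd (Y q) (Z q))) = v (\<lambda>q. \<theta> q (Y q)) + v (\<lambda>q. \<theta> q (Z q))"
proof -
  note s = field_form_near[OF \<theta> Y p] field_form_near[OF \<theta> Z p]
  have "v (\<lambda>q. \<theta> q (vadd (Y q) (Z q))) = v (\<lambda>q. \<theta> q (Y q) + \<theta> q (Z q))"
    by (rule field_cong[OF v smooth_near_add[OF M s]])
       (simp add: one_form_add[OF \<theta>] vector_field_onD(3)[OF Y] vector_field_onD(3)[OF Z])
  then show ?thesis using tangent_add[OF v s] by simp
qed

lemma field_form_scale: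
  assumes \<theta>: "one_form M \<theta>" and Y: "vector_field M Y" and k: "smooth_fun_on M (points M) k"
    and p: "p \<in> points M" and v: "v \<in> tangent M p"
  shows "v (\<lambda>q. \<theta> q (vscale (k q) (Y q))) = k p * v (\<lambda>q. \<theta> q (Y q)) + \<theta> p (Y p) * v k"
proof -
  note s = smooth_fun_on_near[OF k p] field_form_near[OF \<theta> Y p]
  have "v (\<lambda>q. \<theta> q (vscale (k q) (Y q))) = v (\<lambda>q. k q * \<theta> q (Y q))"
    by (rule field_cong[OF v smooth_near_mult[OF M s]])
       (simp add: one_form_scale[OF \<theta>] vector_field_onD(3)[OF Y])
  then show ?thesis using tangent_mult[OF v s] by simp
qed

lemma conn_field:
  assumes X: "vector_field M X" and Y: "vector_field M Y"
  shows "vector_field M (conn X Y)"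
proof -
  note sX = forms[THEN one_form_smooth, OF X] and sY = forms[THEN one_form_smooth, OF Y]
  note sD = sY[THEN vector_field_onD(4)[OF X subset_refl]]
  show ?thesis
    unfolding conn_def[abs_def]
    by (rule comb_field[OF points_open[OF M] subset_refl];
        intro smooth_fun_on_add[OF M] smooth_fun_on_diff[OF M] smooth_fun_on_mult[OF M] sX sY sD h)
qed

lemma comb_cong:
  "x = x' \<Longrightarrow> y = y' \<Longrightarrow> z = z' \<Longrightarrow> w = w' \<Longrightarrow> comb x y z w p = comb x' y' z' w' p"
  by simp

lemma conn_affine: "affine_connection M conn"
  unfolding affine_connection_def
proof (intro conjI allI impI ballI conn_field)
  fix X Y Z p assume F: "vector_field M X" "vector_field M Y" "vector_field M Z" and p: "p \<in> points M"
  note t = vector_field_onD(3)[OF _ p]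
  note aXY = forms[THEN one_form_add, OF p t[OF F(1)] t[OF F(2)]]
    and aYZ = forms[THEN one_form_add, OF p t[OF F(2)] t[OF F(3)]]
    and dYZ = forms[THEN field_form_add, OF F(2,3) p t[OF F(1)]]
  show "conn (\<lambda>q. vadd (X q) (Y q)) Z p = vadd (conn X Z p) (conn Y Z p)"
    unfolding conn_def vadd_comb aXY by (rule comb_cong) (simp_all add: vadd_def algebra_simps)
  show "conn X (\<lambda>q. vadd (Y q) (Z q)) p = vadd (conn X Y p) (conn X Z p)"
    unfolding conn_def vadd_comb aYZ dYZ by (rule comb_cong) (simp_all add: algebra_simps)
next
  fix X Y k p assume F: "vector_field M X" "vector_field M Y" and k: "smooth_fun_on M (points M) k"
    and p: "p \<in> points M"
  note t = vector_field_onD(3)[OF _ p]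
  note sX = forms[THEN one_form_scale, OF p t[OF F(1)]]
    and sY = forms[THEN one_form_scale, OF p t[OF F(2)]]
    and dY = forms[THEN field_form_scale, OF F(2) k p t[OF F(1)]]
  show "conn (\<lambda>q. vscale (k q) (X q)) Y p = vscale (k p) (conn X Y p)"
    unfolding conn_def vscale_comb sX by (rule comb_cong) (simp_all add: vscale_def algebra_simps)
  have "vscale (X p k) (Y p) =
      comb (X p k * a p (Y p)) (X p k * b p (Y p)) (X p k * c p (Y p)) (X p k * d p (Y p)) p"
    using arg_cong[OF comb_eta[OF p t[OF F(2)]], of "vscale (X p k)"] by (simp add: vscale_comb)
  then show "conn X (\<lambda>q. vscale (k q) (Y q)) p = vadd (vscale (X p k) (Y p)) (vscale (k p) (conn X Y p))"
    unfolding conn_def vscale_comb vadd_comb sY dY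
    by (simp only: vadd_comb) (rule comb_cong; simp add: algebra_simps)
qed

text \<open>The torsion of \<open>conn\<close> has the components \<open>(h\<^sub>2 + h\<^sub>3 - A\<^sub>1) b \<and> c\<close>, \<open>(h\<^sub>1 + h\<^sub>3 - A\<^sub>2) c \<and> a\<close> and
  \<open>(h\<^sub>1 + h\<^sub>2 - A\<^sub>3) a \<and> b\<close>.\<close>

lemma conn_torsion_free:
  assumes eqs: "\<And>p. p \<in> points M \<Longrightarrow> h1 p + h2 p = A3 p" "\<And>p. p \<in> points M \<Longrightarrow> h1 p + h3 p = A2 p"
      "\<And>p. p \<in> points M \<Longrightarrow> h2 p + h3 p = A1 p"
    and X: "vector_field M X" and Y: "vector_field M Y" and p: "p \<in> points M"
  shows "conn X Y p = vadd (conn Y X p) (bracket M X Y p)"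
proof -
  let ?B = "bracket M X Y p"
  have "?B = comb (a p ?B) (b p ?B) (c p ?B) (d p ?B) p"
    by (rule comb_eta[OF p bracket_tangent[OF M X Y p], symmetric])
  moreover have "a p ?B = X p (\<lambda>q. a q (Y q)) - Y p (\<lambda>q. a q (X q)) - ext_d1 M a X Y p"
    "b p ?B = X p (\<lambda>q. b q (Y q)) - Y p (\<lambda>q. b q (X q)) - ext_d1 M b X Y p"
    "c p ?B = X p (\<lambda>q. c q (Y q)) - Y p (\<lambda>q. c q (X q)) - ext_d1 M c X Y p"
    "d p ?B = X p (\<lambda>q. d q (Y q)) - Y p (\<lambda>q. d q (X q)) - ext_d1 M d X Y p"
    by (simp_all add: ext_d1_def)
  ultimately have B: "?B = comb
      (X p (\<lambda>q. a q (Y q)) - Y p (\<lambda>q. a q (X q)) - ext_d1 M a X Y p)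
      (X p (\<lambda>q. b q (Y q)) - Y p (\<lambda>q. b q (X q)) - ext_d1 M b X Y p)
      (X p (\<lambda>q. c q (Y q)) - Y p (\<lambda>q. c q (X q)) - ext_d1 M c X Y p)
      (X p (\<lambda>q. d q (Y q)) - Y p (\<lambda>q. d q (X q)) - ext_d1 M d X Y p) p"
    by (simp only:)
  show ?thesis
    unfolding conn_def B vadd_comb da[OF X Y p] db[OF X Y p] dc[OF X Y p] dd[OF X Y p]
      eqs[OF p, symmetric]
    by (rule comb_cong) (simp_all add: wedge_def algebra_simps)
qed

lemma conn_metric:
  assumes X: "vector_field M X" and Y: "vector_field M Y" and Z: "vector_field M Z" and p: "p \<in> points M"
  shows "X p (\<lambda>q. gH q (Y q) (Z q)) = gH p (conn X Y p) (Z p) + gH p (Y p) (conn X Z p)"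
proof -
  note Xp = vector_field_onD(3)[OF X p]
  note s = forms[THEN field_form_near, OF Y p] forms[THEN field_form_near, OF Z p]
  note m = smooth_near_mult[OF M s(1) s(5)] smooth_near_mult[OF M s(2) s(6)]
    smooth_near_mult[OF M s(3) s(7)] smooth_near_mult[OF M s(4) s(8)]
  note n = smooth_near_add[OF M m(1,2)]
  note o = smooth_near_add[OF M n m(3)]
  have "X p (\<lambda>q. gH q (Y q) (Z q)) =
      (a p (Y p) * X p (\<lambda>q. a q (Z q)) + a p (Z p) * X p (\<lambda>q. a q (Y q))) +
      (b p (Y p) * X p (\<lambda>q. b q (Z q)) + b p (Z p) * X p (\<lambda>q. b q (Y q))) +
      (c p (Y p) * X p (\<lambda>q. c q (Z q)) + c p (Z p) * X p (\<lambda>q. c q (Y q))) +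
      (d p (Y p) * X p (\<lambda>q. d q (Z q)) + d p (Z p) * X p (\<lambda>q. d q (Y q)))"
    unfolding gH_def
    by (simp only: tangent_add[OF Xp o m(4)] tangent_add[OF Xp n m(3)] tangent_add[OF Xp m(1,2)]
        tangent_mult[OF Xp s(1) s(5)] tangent_mult[OF Xp s(2) s(6)]
        tangent_mult[OF Xp s(3) s(7)] tangent_mult[OF Xp s(4) s(8)])
  then show ?thesis
    unfolding gH_def conn_def comb_simps[OF p] by (simp add: algebra_simps)
qed

lemma field_form_comb:
  assumes Y: "vector_field M Y" and p: "p \<in> points M" and v: "v \<in> tangent M p"
    and l: "one_form M l1" "one_form M l2" "one_form M l3" "one_form M l4"
  shows "v (\<lambda>q. a q (comb (l1 q (Y q)) (l2 q (Y q)) (l3 q (Y q)) (l4 q (Y q)) q)) = v (\<lambda>q. l1 q (Y q))"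
    "v (\<lambda>q. b q (comb (l1 q (Y q)) (l2 q (Y q)) (l3 q (Y q)) (l4 q (Y q)) q)) = v (\<lambda>q. l2 q (Y q))"
    "v (\<lambda>q. c q (comb (l1 q (Y q)) (l2 q (Y q)) (l3 q (Y q)) (l4 q (Y q)) q)) = v (\<lambda>q. l3 q (Y q))"
    "v (\<lambda>q. d q (comb (l1 q (Y q)) (l2 q (Y q)) (l3 q (Y q)) (l4 q (Y q)) q)) = v (\<lambda>q. l4 q (Y q))"
  by (rule field_cong[OF v field_form_near[OF _ Y p]], rule l, simp only: comb_simps)+

lemma field_form_minus:
  assumes "one_form M \<theta>" "vector_field M Y" "p \<in> points M" "v \<in> tangent M p"
  shows "v (\<lambda>q. - \<theta> q (Y q)) = - v (\<lambda>q. \<theta> q (Y q))"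
  using tangent_cmult[OF assms(4) field_form_near[OF assms(1-3)], of "-1"] by simp

lemma conn_parallel: "parallel_endo M conn J1" "parallel_endo M conn J2" "parallel_endo M conn J3"
proof -
  have "conn X (\<lambda>q. J1 q (Y q)) p = J1 p (conn X Y p) \<and>
      conn X (\<lambda>q. J2 q (Y q)) p = J2 p (conn X Y p) \<and>
      conn X (\<lambda>q. J3 q (Y q)) p = J3 p (conn X Y p)"
    if X: "vector_field M X" and Y: "vector_field M Y" and p: "p \<in> points M" for X Y p
  proof -
    note Xp = vector_field_onD(3)[OF X p]
    note m = forms[THEN field_form_minus, OF Y p Xp]
    note f = field_form_comb[OF Y p Xp]
    show ?thesis
      unfolding J1_def J2_def J3_def conn_def comb_simps[OF p]
        f[OF forms'(6,1,8,3)] f[OF forms'(7,4,1,6)] f[OF forms'(8,7,2,1)] m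
      by (intro conjI comb_cong) (simp_all add: algebra_simps)
  qed
  then show "parallel_endo M conn J1" "parallel_endo M conn J2" "parallel_endo M conn J3"
    unfolding parallel_endo_def by blast+
qed

theorem hyper_kaehler_iff:
  "hyper_kaehler M gH (\<lambda>p u v. wedge a b p u v + wedge c d p u v)
      (\<lambda>p u v. wedge a c p u v - wedge b d p u v) (\<lambda>p u v. wedge b c p u v + wedge a d p u v) \<longleftrightarrow>
    (\<forall>p\<in>points M. h1 p + h2 p = A3 p \<and> h1 p + h3 p = A2 p \<and> h2 p + h3 p = A1 p)"
    (is "?K \<longleftrightarrow> ?E")
proof
  assume ?K
  then obtain I1 I2 I3 D where ah: "almost_hyper_hermitian M gH I1 I2 I3"
    and F: "\<forall>p\<in>points M. \<forall>u\<in>tangent M p. \<forall>v\<in>tangent M p.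
      wedge a b p u v + wedge c d p u v = gH p (I1 p u) v \<and>
      wedge a c p u v - wedge b d p u v = gH p (I2 p u) v \<and>
      wedge b c p u v + wedge a d p u v = gH p (I3 p u) v"
    and D: "levi_civita_connection M gH D" "parallel_endo M D I1" "parallel_endo M D I2" "parallel_endo M D I3"
    unfolding hyper_kaehler_def by blast
  have g: "smooth_sym_bilinear M gH" and I: "endo_field M I1" "endo_field M I2" "endo_field M I3"
    using ah unfolding almost_hyper_hermitian_def riemannian_metric_def by blast+
  have "closed2 M (\<lambda>p u v. wedge a b p u v + wedge c d p u v)"
    by (rule parallel_imp_closed2[OF M g I(1) D(1,2)]) (use F in blast, simp add: wedge_def)
  moreover have "closed2 M (\<lambda>p u v. wedge a c p u v - wedge b d p u v)"
    by (rule parallel_imp_closed2[OF M g I(2) D(1,3)]) (use F in blast, simp add: wedge_def)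
  moreover have "closed2 M (\<lambda>p u v. wedge b c p u v + wedge a d p u v)"
    by (rule parallel_imp_closed2[OF M g I(3) D(1,4)]) (use F in blast, simp add: wedge_def)
  ultimately show ?E using closed_ab_cd[of 1] closed_ac_bd closed_bc_ad by auto
next
  assume E: ?E
  have eqs: "\<And>p. p \<in> points M \<Longrightarrow> h1 p + h2 p = A3 p" "\<And>p. p \<in> points M \<Longrightarrow> h1 p + h3 p = A2 p"
    "\<And>p. p \<in> points M \<Longrightarrow> h2 p + h3 p = A1 p" using E by blast+
  have "\<forall>p\<in>points M. \<forall>u\<in>tangent M p. \<forall>v\<in>tangent M p.
      wedge a b p u v + wedge c d p u v = gH p (J1 p u) v \<and>
      wedge a c p u v - wedge b d p u v = gH p (J2 p u) v \<and>
      wedge b c p u v + wedge a d p u v = gH p (J3 p u) v"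
    by (auto simp: wedge_def gH_def J_defs comb_simps algebra_simps)
  moreover have "levi_civita_connection M gH conn"
    unfolding levi_civita_connection_def
    by (intro conjI allI impI ballI conn_affine conn_torsion_free eqs conn_metric)
  ultimately show ?K
    unfolding hyper_kaehler_def using hyper_hermitian conn_parallel by blast
qed

end

section \<open>Forms on the cylinder\<close>

lemma smooth_fun_on_compose:
  fixes h :: "real \<Rightarrow> real"
  assumes M: "smooth_manifold M" and u: "smooth_fun_on M U u" and h: "open I" "smooth_eucl h I"
    and sub: "\<And>x. x \<in> U \<Longrightarrow> u x \<in> I"
  shows "smooth_fun_on M U (\<lambda>x. h (u x))"
proof -
  have o: "open U" "U \<subseteq> points M" using u by (auto simp: smooth_fun_on_def)
  have "smooth_eucl (\<lambda>x. h ((u \<circ> inv_into V \<phi>) x)) (\<phi> ` (V \<inter> U))" if V: "(V, \<phi>) \<in> M" for V \<phi>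
    by (rule smooth_eucl_compose[OF chart_image_open[OF M V o(1)] h(1) _ smooth_fun_on_chart[OF u V] h(2)])
       (use sub chart_facts(4)[OF M V] in auto)
  then show ?thesis using o by (auto simp: smooth_fun_on_def o_def Int_commute)
qed

lemma tangent_chain:
  fixes h :: "real \<Rightarrow> real"
  assumes M: "smooth_manifold M" and v: "v \<in> tangent M p" and u: "smooth_near M p u"
    and hu: "smooth_near M p (\<lambda>x. h (u x))" and h: "(h has_real_derivative D) (at (u p))"
  shows "v (\<lambda>x. h (u x)) = D * v u"
proof -
  obtain V \<phi> where V: "(V, \<phi>) \<in> M" "p \<in> V" using point_chart[OF smooth_near_point[OF u]] .
  have "coord_vector M V \<phi> w p (\<lambda>x. h (u x)) = D * coord_vector M V \<phi> w p u" for w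
  proof (rule coord_vector_eqI[OF M V hu])
    have "(h has_derivative (*) D) (at ((u \<circ> inv_into V \<phi>) (\<phi> p)))"
      using h chart_facts(4)[OF M V(1,2)] by (simp add: has_field_derivative_def)
    from diff_chain_at[OF coord_vector_derivative[OF M V u] this]
    show "((\<lambda>x. h (u x)) \<circ> inv_into V \<phi> has_derivative (\<lambda>w. D * coord_vector M V \<phi> w p u)) (at (\<phi> p))"
      by (simp add: o_def)
  qed
  then have "(\<Sum>b\<in>Basis. v (\<lambda>x. \<phi> x \<bullet> b) * coord_vector M V \<phi> b p (\<lambda>x. h (u x))) =
      D * (\<Sum>b\<in>Basis. v (\<lambda>x. \<phi> x \<bullet> b) * coord_vector M V \<phi> b p u)"
    by (simp add: sum_distrib_left mult_ac)
  then show ?thesis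
    using fun_cong[OF tangent_eq_coord[OF M V v], of "\<lambda>x. h (u x)"] fun_cong[OF tangent_eq_coord[OF M V v], of u]
    by simp
qed

text \<open>The derivative in the form in which its smoothness is part of \<^const>\<open>smooth_eucl\<close>.\<close>

definition real_deriv :: "(real \<Rightarrow> real) \<Rightarrow> real \<Rightarrow> real" where
  "real_deriv h t = frechet_derivative h (at t) 1"

lemma real_deriv_smooth: "smooth_eucl h I \<Longrightarrow> smooth_eucl (real_deriv h) I"
  unfolding real_deriv_def[abs_def] by (rule smooth_eucl_frechet)

lemma real_deriv_derivative:
  assumes "smooth_eucl h I" "t \<in> I"
  shows "(h has_real_derivative real_deriv h t) (at t)"
proof -
  note d = smooth_eucl_derivative[OF assms]
  have "frechet_derivative h (at t) x = real_deriv h t * x" for x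
    using linear_cmul[OF has_derivative_linear[OF d], of x 1] by (simp add: real_deriv_def)
  then show ?thesis using d unfolding has_field_derivative_def by (metis (no_types, lifting) ext)
qed

context
  fixes A :: "('g::{t2_space, second_countable_topology}, 'e::euclidean_space) atlas" and I :: "real set"
  assumes A: "smooth_manifold A" and I: "open I"
begin

lemma cylinder_manifold: "smooth_manifold (cylinder A I)"
  unfolding cylinder_def by (intro smooth_manifold_prod A smooth_manifold_open_set I)

lemma points_cylinder: "points (cylinder A I) = points A \<times> I"
  unfolding cylinder_def points_prod by (simp add: points_def)

lemma cylinder_fst: "smooth_map (cylinder A I) A fst"
  unfolding cylinder_def by (intro smooth_map_fst A smooth_manifold_open_set I)

lemma cylinder_chart: "(V, \<phi>) \<in> A \<Longrightarrow> (V \<times> I, map_prod \<phi> (\<lambda>t. t)) \<in> cylinder A I"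
  unfolding cylinder_def prod_atlas_iff by blast

lemma cylinder_snd: "smooth_fun_on (cylinder A I) (points (cylinder A I)) snd"
proof (rule smooth_fun_on_iff_near[OF cylinder_manifold points_open[OF cylinder_manifold]])
  fix p assume "p \<in> points (cylinder A I)"
  then have p: "fst p \<in> points A" "snd p \<in> I" by (auto simp: points_cylinder)
  obtain V \<phi> where "(V, \<phi>) \<in> A" "fst p \<in> V" using point_chart[OF p(1)] .
  with p have V: "(V, \<phi>) \<in> A" "p \<in> V \<times> I" by (auto simp: mem_Times_iff)
  have "smooth_fun_on (cylinder A I) ((V \<times> I) \<inter> map_prod \<phi> (\<lambda>t. t) -` UNIV) (\<lambda>x. snd (map_prod \<phi> (\<lambda>t. t) x))"
    by (rule smooth_fun_on_chartI[OF cylinder_manifold cylinder_chart[OF V(1)] open_UNIV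
          smooth_eucl_linear[OF bounded_linear_snd]])
  then show "smooth_near (cylinder A I) p snd" using V(2) by (auto intro: smooth_fun_on_near)
qed

lemma time_smooth:
  "smooth_eucl h I \<Longrightarrow> smooth_fun_on (cylinder A I) (points (cylinder A I)) (\<lambda>p. h (snd p))"
  by (rule smooth_fun_on_compose[OF cylinder_manifold cylinder_snd I]) (auto simp: points_cylinder)

lemma tangent_time:
  assumes h: "smooth_eucl h I" and p: "p \<in> points (cylinder A I)" and v: "v \<in> tangent (cylinder A I) p"
  shows "v (\<lambda>p. h (snd p)) = real_deriv h (snd p) * v snd"
  using tangent_chain[OF cylinder_manifold v smooth_fun_on_near[OF cylinder_snd p]
      smooth_fun_on_near[OF time_smooth[OF h] p] real_deriv_derivative[OF h]] p
  by (auto simp: points_cylinder)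

abbreviation dt :: "('g \<times> real) form1" where "dt \<equiv> (\<lambda>p v. v snd)"

lemma one_form_dt: "one_form (cylinder A I) dt"
  unfolding one_form_def
proof (intro conjI allI impI ballI)
  fix U X assume X: "vector_field_on (cylinder A I) U X"
  show "smooth_fun_on (cylinder A I) U (\<lambda>p. X p snd)"
    by (rule vector_field_onD(4)[OF X subset_refl smooth_fun_on_subset[OF cylinder_snd vector_field_onD(1,2)[OF X]]])
qed (simp_all add: vadd_def vscale_def)

lemma one_form_dt_form: "smooth_eucl h I \<Longrightarrow> one_form (cylinder A I) (dt_form h)"
  unfolding dt_form_def by (rule one_form_scaled[OF cylinder_manifold one_form_dt time_smooth])

lemma one_form_evolve:
  "one_form A \<theta> \<Longrightarrow> smooth_eucl h I \<Longrightarrow> one_form (cylinder A I) (evolve A h \<theta>)"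
  unfolding evolve_def
  by (rule one_form_scaled[OF cylinder_manifold one_form_pullback[OF cylinder_manifold A cylinder_fst] time_smooth])

lemma ext_d1_dt_form:
  assumes h: "smooth_eucl h I" and X: "vector_field (cylinder A I) X" and Y: "vector_field (cylinder A I) Y"
    and p: "p \<in> points (cylinder A I)"
  shows "ext_d1 (cylinder A I) (dt_form h) X Y p = 0"
proof -
  have "ext_d1 (cylinder A I) dt X Y p = 0"
    using smooth_fun_on_near[OF cylinder_snd p] by (simp add: ext_d1_def bracket_def)
  then show ?thesis
    unfolding dt_form_def
    using ext_d1_scale[OF cylinder_manifold X Y one_form_dt time_smooth[OF h] p]
      tangent_time[OF h p vector_field_onD(3)[OF X p]] tangent_time[OF h p vector_field_onD(3)[OF Y p]]
    by simp
qed

lemma ext_d1_evolve: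
  assumes h: "smooth_eucl h I" and \<theta>: "one_form A \<theta>"
    and d: "d1_is A \<theta> (\<lambda>p u v. - l * wedge \<alpha> \<beta> p u v)"
    and ext: "\<And>q v. q \<in> points A \<Longrightarrow> v \<in> tangent A q \<Longrightarrow> \<exists>Z. vector_field A Z \<and> Z q = v"
    and X: "vector_field (cylinder A I) X" and Y: "vector_field (cylinder A I) Y"
    and p: "p \<in> points (cylinder A I)"
  shows "ext_d1 (cylinder A I) (evolve A h \<theta>) X Y p =
    - real_deriv h (snd p) * wedge (pullback A fst \<theta>) dt p (X p) (Y p)
    - l * h (snd p) * wedge (pullback A fst \<alpha>) (pullback A fst \<beta>) p (X p) (Y p)"
proof -
  let ?C = "cylinder A I" and ?\<theta> = "pullback A fst \<theta>"
  have "ext_d1 ?C ?\<theta> X Y p = - l * wedge \<alpha> \<beta> (fst p) (push A fst p (X p)) (push A fst p (Y p))"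
    by (rule ext_d1_pullback[OF cylinder_manifold A cylinder_fst \<theta> d ext X Y p])
  then have d\<theta>: "ext_d1 ?C ?\<theta> X Y p = - l * wedge (pullback A fst \<alpha>) (pullback A fst \<beta>) p (X p) (Y p)"
    by (simp add: wedge_def pullback_def)
  have "ext_d1 ?C (evolve A h \<theta>) X Y p =
      X p (\<lambda>p. h (snd p)) * ?\<theta> p (Y p) - Y p (\<lambda>p. h (snd p)) * ?\<theta> p (X p) + h (snd p) * ext_d1 ?C ?\<theta> X Y p"
    unfolding evolve_def
    by (rule ext_d1_scale[OF cylinder_manifold X Y one_form_pullback[OF cylinder_manifold A cylinder_fst \<theta>]
          time_smooth[OF h] p])
  then show ?thesis
    unfolding d\<theta> tangent_time[OF h p vector_field_onD(3)[OF X p]]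
      tangent_time[OF h p vector_field_onD(3)[OF Y p]]
    by (simp add: wedge_def algebra_simps)
qed

text \<open>The coordinates of the cylinder are \<open>t\<close> and functions pulled back from the base, so a derivation is
  determined by its two projections.\<close>

lemma cylinder_tangent_eq_zero:
  assumes p: "p \<in> points (cylinder A I)" and v: "v \<in> tangent (cylinder A I) p"
    and fst: "push A fst p v = (\<lambda>f. 0)" and snd: "v snd = 0"
  shows "v = (\<lambda>f. 0)"
proof -
  note C = cylinder_manifold
  have p': "fst p \<in> points A" "snd p \<in> I" using p by (auto simp: points_cylinder)
  obtain V \<phi> where "(V, \<phi>) \<in> A" "fst p \<in> V" using point_chart[OF p'(1)] .
  with p' have V: "(V, \<phi>) \<in> A" "p \<in> V \<times> I" by (auto simp: mem_Times_iff)
  show ?thesis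
  proof (rule tangent_eqI[OF C cylinder_chart[OF V(1)] V(2) v tangent_zero])
    fix b :: "'e \<times> real"
    have s: "smooth_near A (fst p) (\<lambda>x. \<phi> x \<bullet> fst b)"
      using V by (auto intro: smooth_fun_on_near[OF smooth_fun_on_coordinate[OF A V(1)]])
    have 1: "smooth_near (cylinder A I) p (\<lambda>x. \<phi> (fst x) \<bullet> fst b)"
      using smooth_map_near[OF C A cylinder_fst p s] by (simp add: o_def)
    have 2: "smooth_near (cylinder A I) p snd" by (rule smooth_fun_on_near[OF cylinder_snd p])
    note 3 = smooth_near_mult[OF C smooth_near_const[OF C p] 2, of "snd b"]
    have "v (\<lambda>x. \<phi> (fst x) \<bullet> fst b) = 0" using fun_cong[OF fst, of "\<lambda>x. \<phi> x \<bullet> fst b"] s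
      by (simp add: push_def o_def)
    then have "v (\<lambda>x. \<phi> (fst x) \<bullet> fst b + snd b * snd x) = 0"
      using tangent_add[OF v 1 3] tangent_cmult[OF v 2] snd by simp
    moreover have "(\<lambda>x. map_prod \<phi> (\<lambda>t. t) x \<bullet> b) = (\<lambda>x. \<phi> (fst x) \<bullet> fst b + snd b * snd x)"
      by (simp add: inner_prod_def fun_eq_iff)
    ultimately show "v (\<lambda>x. map_prod \<phi> (\<lambda>t. t) x \<bullet> b) = (\<lambda>f. 0) (\<lambda>x. map_prod \<phi> (\<lambda>t. t) x \<bullet> b)" by simp
  qed
qed

end

section \<open>Diagonal structures as diagonal coframes\<close>

locale diagonal_cylinder =
  fixes G :: "'g::{t2_space, second_countable_topology} monoid"
    and A :: "('g, real ^ 3) atlas" and e1 e2 e3 :: "'g form1" and l1 l2 l3 :: real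
    and I :: "real set" and f1 f2 f3 f :: "real \<Rightarrow> real"
  assumes G: "lie_group G A" and e: "left_invariant_basis G A e1 e2 e3"
    and de1: "d1_is A e1 (\<lambda>p u v. - l1 * wedge e2 e3 p u v)"
    and de2: "d1_is A e2 (\<lambda>p u v. - l2 * wedge e3 e1 p u v)"
    and de3: "d1_is A e3 (\<lambda>p u v. - l3 * wedge e1 e2 p u v)"
    and I: "open I"
    and smooth: "smooth_eucl f1 I" "smooth_eucl f2 I" "smooth_eucl f3 I" "smooth_eucl f I"
    and nz: "\<And>t. t \<in> I \<Longrightarrow> f1 t \<noteq> 0" "\<And>t. t \<in> I \<Longrightarrow> f2 t \<noteq> 0" "\<And>t. t \<in> I \<Longrightarrow> f3 t \<noteq> 0" "\<And>t. t \<in> I \<Longrightarrow> f t \<noteq> 0"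
begin

abbreviation "C \<equiv> cylinder A I"
abbreviation "a \<equiv> evolve A f1 e1"
abbreviation "b \<equiv> evolve A f2 e2"
abbreviation "c \<equiv> evolve A f3 e3"
abbreviation "d \<equiv> dt_form f"
abbreviation "rate h \<equiv> (\<lambda>p. real_deriv h (snd p) * inverse (f (snd p) * h (snd p)))"

lemma group_manifold: "smooth_manifold A" "points A = carrier G"
  using G by (auto simp: lie_group_def)

lemma C: "smooth_manifold C"
  by (rule cylinder_manifold[OF group_manifold(1) I])

lemma C_points: "points C = carrier G \<times> I"
  by (simp add: points_cylinder group_manifold I)

lemma one_forms_e: "one_form A e1" "one_form A e2" "one_form A e3"
  using e unfolding left_invariant_basis_def left_invariant_def by auto

lemma coframe_forms: "one_form C a" "one_form C b" "one_form C c" "one_form C d"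
  by (intro one_form_evolve one_form_dt_form group_manifold one_forms_e smooth I)+

lemma coframe_separating:
  assumes p: "p \<in> points C" and v: "v \<in> tangent C p"
    and zero: "a p v = 0" "b p v = 0" "c p v = 0" "d p v = 0"
  shows "v = (\<lambda>f. 0)"
proof (rule cylinder_tangent_eq_zero[OF group_manifold(1) I p v])
  have t: "snd p \<in> I" "fst p \<in> carrier G" using p by (auto simp: C_points)
  show "v snd = 0" using zero(4) nz(4)[OF t(1)] by (simp add: dt_form_def)
  show "push A fst p v = (\<lambda>f. 0)"
    by (rule left_invariant_basis_separating[OF G e t(2)
          push_tangent_map[OF C group_manifold(1) cylinder_fst[OF group_manifold(1) I] p v]])
       (use zero nz(1-3)[OF t(1)] in \<open>simp_all add: evolve_def pullback_def\<close>)
qed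

lemma rate_smooth:
  assumes h: "smooth_eucl h I" "\<And>t. t \<in> I \<Longrightarrow> h t \<noteq> 0"
  shows "smooth_fun_on C (points C) (rate h)"
  by (rule time_smooth[OF group_manifold(1) I])
     (intro smooth_eucl_mult smooth_eucl_inverse real_deriv_smooth smooth h I, simp add: nz h)

lemma ext_d1_coframe:
  assumes h: "smooth_eucl h I" "\<And>t. t \<in> I \<Longrightarrow> h t \<noteq> 0"
    and \<theta>: "one_form A \<theta>" and d\<theta>: "d1_is A \<theta> (\<lambda>p u v. - l * wedge \<alpha> \<beta> p u v)"
    and k: "\<And>t. t \<in> I \<Longrightarrow> k t \<noteq> 0" and m: "\<And>t. t \<in> I \<Longrightarrow> m t \<noteq> 0"
    and X: "vector_field C X" and Y: "vector_field C Y" and p: "p \<in> points C"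
  shows "ext_d1 C (evolve A h \<theta>) X Y p =
    - rate h p * wedge (evolve A h \<theta>) d p (X p) (Y p)
    - (l * h (snd p) / (k (snd p) * m (snd p))) * wedge (evolve A k \<alpha>) (evolve A m \<beta>) p (X p) (Y p)"
proof -
  have t: "snd p \<in> I" using p by (auto simp: C_points)
  have E: "ext_d1 C (evolve A h \<theta>) X Y p =
      - real_deriv h (snd p) * wedge (pullback A fst \<theta>) (\<lambda>p v. v snd) p (X p) (Y p)
      - l * h (snd p) * wedge (pullback A fst \<alpha>) (pullback A fst \<beta>) p (X p) (Y p)"
    by (rule ext_d1_evolve[OF group_manifold(1) I h(1) \<theta> d\<theta> left_invariant_vector_extension[OF G e] X Y p])
  show ?thesis
    unfolding E
    using h(2)[OF t] k[OF t] m[OF t] nz(4)[OF t]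
    by (simp add: wedge_def evolve_def dt_form_def field_simps)
qed

lemma ex_diagonal_coframe:
  "\<exists>U1 U2 U3 U4. diagonal_coframe C a b c d U1 U2 U3 U4 (rate f1) (rate f2) (rate f3)
     (\<lambda>p. l1 * f1 (snd p) / (f2 (snd p) * f3 (snd p)))
     (\<lambda>p. l2 * f2 (snd p) / (f3 (snd p) * f1 (snd p)))
     (\<lambda>p. l3 * f3 (snd p) / (f1 (snd p) * f2 (snd p)))"
proof -
  define \<theta> :: "4 \<Rightarrow> ('g \<times> real) form1" where
    "\<theta> i = (if i = 1 then a else if i = 2 then b else if i = 3 then c else d)" for i
  have \<theta>s: "\<theta> 1 = a" "\<theta> 2 = b" "\<theta> 3 = c" "\<theta> 4 = d" by (simp_all add: \<theta>_def)
  have \<theta>: "one_form C (\<theta> i)" for i using coframe_forms by (simp add: \<theta>_def)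
  obtain \<beta> :: "4 \<Rightarrow> (real ^ 3) \<times> real" where \<beta>: "bij_betw \<beta> UNIV Basis"
    using ex_basis_enumeration[where 'n = 4 and 'e = "(real ^ 3) \<times> real"] by auto
  have sep: "v = (\<lambda>f. 0)" if "p \<in> points C" "v \<in> tangent C p" "\<And>i. \<theta> i p v = 0" for p v
    using that(3)[of 1] that(3)[of 2] that(3)[of 3] that(3)[of 4]
    by (intro coframe_separating[OF that(1,2)]) (simp_all add: \<theta>s)
  have "\<exists>U. (\<forall>i. vector_field C (U i)) \<and>
      (\<forall>q\<in>points C. \<forall>i j. \<theta> i q (U j q) = (if i = j then 1 else 0)) \<and>
      (\<forall>q\<in>points C. \<forall>w\<in>tangent C q. w = (\<lambda>f. \<Sum>i\<in>UNIV. \<theta> i q w * U i q f))"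
    by (rule dual_frame[OF C \<theta> \<beta>]) (rule sep)
  then obtain U where U: "\<forall>i. vector_field C (U i)"
    and dual: "\<forall>q\<in>points C. \<forall>i j. \<theta> i q (U j q) = (if i = j then 1 else 0)" by blast
  have du: "a q (U j q) = (if 1 = j then 1 else 0)" "b q (U j q) = (if 2 = j then 1 else 0)"
    "c q (U j q) = (if 3 = j then 1 else 0)" "d q (U j q) = (if 4 = j then 1 else 0)"
    if "q \<in> points C" for q j
    using dual[rule_format, OF that, of 1 j] dual[rule_format, OF that, of 2 j]
      dual[rule_format, OF that, of 3 j] dual[rule_format, OF that, of 4 j] by (simp_all only: \<theta>s)
  have "diagonal_coframe C a b c d (U 1) (U 2) (U 3) (U 4) (rate f1) (rate f2) (rate f3)
     (\<lambda>p. l1 * f1 (snd p) / (f2 (snd p) * f3 (snd p)))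
     (\<lambda>p. l2 * f2 (snd p) / (f3 (snd p) * f1 (snd p)))
     (\<lambda>p. l3 * f3 (snd p) / (f1 (snd p) * f2 (snd p)))"
  proof (unfold_locales)
    show "v = w" if "p \<in> points C" "v \<in> tangent C p" "w \<in> tangent C p"
      "a p v = a p w" "b p v = b p w" "c p v = c p w" "d p v = d p w" for p v w
    proof (rule one_forms_eqI[OF \<theta> that(1) sep[OF that(1)] that(2,3)])
      show "\<theta> i p v = \<theta> i p w" for i using that by (simp add: \<theta>_def)
    qed
  qed (use U in \<open>auto simp: C coframe_forms rate_smooth smooth nz du
         ext_d1_dt_form[OF group_manifold(1) I smooth(4)]
         ext_d1_coframe[OF smooth(1) nz(1) one_forms_e(1) de1 nz(2,3)]
         ext_d1_coframe[OF smooth(2) nz(2) one_forms_e(2) de2 nz(3,1)]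
         ext_d1_coframe[OF smooth(3) nz(3) one_forms_e(3) de3 nz(1,2)]
         simp del: inverse_mult_distrib\<close>)
  then show ?thesis by blast
qed

text \<open>The sum of the logarithmic derivatives of \<open>h\<close> and \<open>k\<close> is that of \<open>h k\<close>; this turns the algebraic
  conditions on the coframe into the differential equations.\<close>

lemma rate_equation:
  assumes t: "t \<in> I" and h: "smooth_eucl h I" "\<And>t. t \<in> I \<Longrightarrow> h t \<noteq> 0"
    and k: "smooth_eucl k I" "\<And>t. t \<in> I \<Longrightarrow> k t \<noteq> 0"
  shows "rate h (x, t) + rate k (x, t) = l * m t / (h t * k t) \<longleftrightarrow>
    ((\<lambda>s. h s * k s) has_real_derivative l * f t * m t) (at t)"
proof -
  have D: "((\<lambda>s. h s * k s) has_real_derivative real_deriv h t * k t + real_deriv k t * h t) (at t)"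
    by (rule DERIV_mult[OF real_deriv_derivative[OF h(1) t] real_deriv_derivative[OF k(1) t]])
  have "rate h (x, t) + rate k (x, t) = l * m t / (h t * k t) \<longleftrightarrow>
      real_deriv h t * k t + real_deriv k t * h t = l * f t * m t"
    using h(2)[OF t] k(2)[OF t] nz(4)[OF t] by (simp add: divide_simps) (simp add: algebra_simps)
  also have "\<dots> \<longleftrightarrow> ((\<lambda>s. h s * k s) has_real_derivative l * f t * m t) (at t)"
    using D DERIV_unique by metis
  finally show ?thesis .
qed

lemma ball_points_iff: "(\<forall>p\<in>points C. P p) \<longleftrightarrow> (\<forall>t\<in>I. \<forall>x\<in>carrier G. P (x, t))"
  by (auto simp: C_points)

lemma carrier_nonempty: "\<exists>x. x \<in> carrier G"
  using G group.is_monoid monoid.one_closed by (fastforce simp: lie_group_def)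

theorem hyper_kaehler_system:
  "diagonal_hyper_kaehler A I e1 e2 e3 f1 f2 f3 f \<longleftrightarrow>
    (\<forall>t\<in>I. ((\<lambda>s. f1 s * f2 s) has_real_derivative l3 * f t * f3 t) (at t) \<and>
      ((\<lambda>s. f1 s * f3 s) has_real_derivative l2 * f t * f2 t) (at t) \<and>
      ((\<lambda>s. f2 s * f3 s) has_real_derivative l1 * f t * f1 t) (at t))"
proof -
  obtain U1 U2 U3 U4 where D: "diagonal_coframe C a b c d U1 U2 U3 U4 (rate f1) (rate f2) (rate f3)
     (\<lambda>p. l1 * f1 (snd p) / (f2 (snd p) * f3 (snd p)))
     (\<lambda>p. l2 * f2 (snd p) / (f3 (snd p) * f1 (snd p)))
     (\<lambda>p. l3 * f3 (snd p) / (f1 (snd p) * f2 (snd p)))"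
    using ex_diagonal_coframe by blast
  have swap: "l2 * f2 t / (f3 t * f1 t) = l2 * f2 t / (f1 t * f3 t)" for t by (simp add: mult.commute)
  show ?thesis
    unfolding diagonal_hyper_kaehler_def Let_def
      diagonal_coframe.hyper_kaehler_iff[OF D, unfolded diagonal_coframe.gH_def[OF D, abs_def]]
      ball_points_iff
    using carrier_nonempty
    by (simp add: swap rate_equation[OF _ smooth(1) nz(1) smooth(2) nz(2), simplified]
        rate_equation[OF _ smooth(1) nz(1) smooth(3) nz(3), simplified]
        rate_equation[OF _ smooth(2) nz(2) smooth(3) nz(3), simplified] cong: ball_cong)
qed

theorem hyper_symplectic_system:
  "diagonal_hyper_symplectic A I e1 e2 e3 f1 f2 f3 f \<longleftrightarrow>
    (\<forall>t\<in>I. ((\<lambda>s. f1 s * f2 s) has_real_derivative (- l3) * f t * f3 t) (at t) \<and>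
      ((\<lambda>s. f1 s * f3 s) has_real_derivative l2 * f t * f2 t) (at t) \<and>
      ((\<lambda>s. f2 s * f3 s) has_real_derivative l1 * f t * f1 t) (at t))"
proof -
  obtain U1 U2 U3 U4 where D: "diagonal_coframe C a b c d U1 U2 U3 U4 (rate f1) (rate f2) (rate f3)
     (\<lambda>p. l1 * f1 (snd p) / (f2 (snd p) * f3 (snd p)))
     (\<lambda>p. l2 * f2 (snd p) / (f3 (snd p) * f1 (snd p)))
     (\<lambda>p. l3 * f3 (snd p) / (f1 (snd p) * f2 (snd p)))"
    using ex_diagonal_coframe by blast
  have swap: "l2 * f2 t / (f3 t * f1 t) = l2 * f2 t / (f1 t * f3 t)" for t by (simp add: mult.commute)
  show ?thesis
    unfolding diagonal_hyper_symplectic_def Let_def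
      diagonal_coframe.hyper_symplectic_iff[OF D, unfolded diagonal_coframe.gS_def[OF D, abs_def]]
      ball_points_iff
    using carrier_nonempty
    by (simp add: swap rate_equation[OF _ smooth(1) nz(1) smooth(2) nz(2), of _ _ "- l3", simplified]
        rate_equation[OF _ smooth(1) nz(1) smooth(3) nz(3), simplified]
        rate_equation[OF _ smooth(2) nz(2) smooth(3) nz(3), simplified] cong: ball_cong)
qed

end

section \<open>The Bianchi types\<close>

text \<open>The numbers \<open>\<lambda>\<^sub>i\<close> in \<open>de\<^sup>1 = - \<lambda>\<^sub>1 e\<^sup>2\<^sup>3\<close>, \<open>de\<^sup>2 = - \<lambda>\<^sub>2 e\<^sup>3\<^sup>1\<close>, \<open>de\<^sup>3 = - \<lambda>\<^sub>3 e\<^sup>1\<^sup>2\<close>.\<close>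

fun structure_constants :: "bianchi \<Rightarrow> real \<times> real \<times> real" where
  "structure_constants IX = (1, 1, 1)"
| "structure_constants VIII = (1, 1, -1)"
| "structure_constants VII0 = (0, 1, 1)"
| "structure_constants VI0 = (0, 1, -1)"
| "structure_constants II = (0, 0, 1)"

lemma d1_is_cong: "d1_is A \<theta> F \<Longrightarrow> (\<And>p u v. F p u v = F' p u v) \<Longrightarrow> d1_is A \<theta> F'"
  unfolding d1_is_def by simp

lemma structure_equations_constants:
  assumes "structure_equations T A e1 e2 e3" "structure_constants T = (l1, l2, l3)"
  shows "d1_is A e1 (\<lambda>p u v. - l1 * wedge e2 e3 p u v)"
    "d1_is A e2 (\<lambda>p u v. - l2 * wedge e3 e1 p u v)"
    "d1_is A e3 (\<lambda>p u v. - l3 * wedge e1 e2 p u v)"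
  using assms by (cases T; auto simp: wedge_def elim!: d1_is_cong)+

lemma bianchi_cylinder:
  assumes "bianchi_group T G A e1 e2 e3" "structure_constants T = (l1, l2, l3)"
    and "open I" "smooth_eucl f1 I" "smooth_eucl f2 I" "smooth_eucl f3 I" "smooth_eucl f I"
    and "\<forall>t\<in>I. f1 t \<noteq> 0 \<and> f2 t \<noteq> 0 \<and> f3 t \<noteq> 0 \<and> f t \<noteq> 0"
  shows "diagonal_cylinder G A e1 e2 e3 l1 l2 l3 I f1 f2 f3 f"
  using assms structure_equations_constants[of T A e1 e2 e3]
  by unfold_locales (auto simp: bianchi_group_def)

lemma has_real_derivative_minus_iff:
  "((\<lambda>s. - g s) has_real_derivative D) (at t) \<longleftrightarrow> (g has_real_derivative - D) (at t)"
  using DERIV_minus[of g "- D"] DERIV_minus[of "\<lambda>s. - g s" D] by auto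

theorem mainTheorem1:
  fixes G :: "'g::{t2_space, second_countable_topology} monoid"
    and G' :: "'h::{t2_space, second_countable_topology} monoid"
    and A :: "('g, real ^ 3) atlas" and A' :: "('h, real ^ 3) atlas"
    and e1 e2 e3 :: "'g form1" and e1' e2' e3' :: "'h form1"
    and \<epsilon>1 \<epsilon>2 \<epsilon>3 :: real
    and I :: "real set" and f1 f2 f3 f :: "real \<Rightarrow> real"
  assumes types: "(T, T', \<epsilon>1, \<epsilon>2, \<epsilon>3) \<in>
      {(IX, VIII, 1, 1, 1), (VIII, IX, 1, 1, -1), (VII0, VI0, 0, 1, 1),
       (VI0, VII0, 0, 1, -1), (II, II, 0, 0, 1)}"
    and "bianchi_group T G A e1 e2 e3"
    and "bianchi_group T' G' A' e1' e2' e3'"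
    and "open I" and "is_interval I"
    and "smooth_eucl f1 I" and "smooth_eucl f2 I" and "smooth_eucl f3 I" and "smooth_eucl f I"
    and "\<forall>t\<in>I. f1 t \<noteq> 0 \<and> f2 t \<noteq> 0 \<and> f3 t \<noteq> 0 \<and> f t \<noteq> 0"
  defines "system \<equiv> (\<forall>t\<in>I.
      ((\<lambda>s. f1 s * f2 s) has_real_derivative \<epsilon>3 * f t * f3 t) (at t) \<and>
      ((\<lambda>s. f1 s * f3 s) has_real_derivative \<epsilon>2 * f t * f2 t) (at t) \<and>
      ((\<lambda>s. f2 s * f3 s) has_real_derivative \<epsilon>1 * f t * f1 t) (at t))"
  shows "(diagonal_hyper_kaehler A I e1 e2 e3 f1 f2 f3 f \<longleftrightarrow> system) \<and>
         (diagonal_hyper_symplectic A' I e1' e2' e3' f1 f2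
            (if T = II then (\<lambda>t. - f3 t) else f3) f \<longleftrightarrow> system)"
proof
  note smooth = \<open>smooth_eucl f1 I\<close> \<open>smooth_eucl f2 I\<close> \<open>smooth_eucl f3 I\<close> \<open>smooth_eucl f I\<close>
  note nz = \<open>\<forall>t\<in>I. f1 t \<noteq> 0 \<and> f2 t \<noteq> 0 \<and> f3 t \<noteq> 0 \<and> f t \<noteq> 0\<close>
  have "structure_constants T = (\<epsilon>1, \<epsilon>2, \<epsilon>3)" using types by auto
  from diagonal_cylinder.hyper_kaehler_system[OF bianchi_cylinder[OF assms(2) this \<open>open I\<close> smooth nz]]
  show "diagonal_hyper_kaehler A I e1 e2 e3 f1 f2 f3 f \<longleftrightarrow> system" unfolding system_def .
  show "diagonal_hyper_symplectic A' I e1' e2' e3' f1 f2 (if T = II then (\<lambda>t. - f3 t) else f3) f \<longleftrightarrow> system"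
  proof (cases "T = II")
    case True
    then have c: "structure_constants T' = (0, 0, 1)" "\<epsilon>1 = 0" "\<epsilon>2 = 0" "\<epsilon>3 = 1" using types by auto
    have m: "smooth_eucl (\<lambda>t. - f3 t) I"
      by (rule smooth_eucl_bounded_linear[OF bounded_linear_minus[OF bounded_linear_ident] \<open>open I\<close> smooth(3)])
    have nz': "\<forall>t\<in>I. f1 t \<noteq> 0 \<and> f2 t \<noteq> 0 \<and> - f3 t \<noteq> 0 \<and> f t \<noteq> 0" using nz by auto
    show ?thesis
      unfolding system_def
      using diagonal_cylinder.hyper_symplectic_system[OF bianchi_cylinder[OF assms(3) c(1) \<open>open I\<close>
            smooth(1,2) m smooth(4) nz']] True c
      by (simp add: has_real_derivative_minus_iff)
  next
    case False
    then have "structure_constants T' = (\<epsilon>1, \<epsilon>2, - \<epsilon>3)" using types by auto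
    from diagonal_cylinder.hyper_symplectic_system[OF bianchi_cylinder[OF assms(3) this \<open>open I\<close> smooth nz]]
    show ?thesis using False unfolding system_def by simp
  qed
qed

end
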